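(* Let $\mathcal H$ be an infinite-dimensional separable Hilbert space, and let $\tau$ and $\sigma$ be operator means on $B(\mathcal H)^+$ with $\sigma\neq\mathfrak l$. For $A,B\in B(\mathcal H)^{++}$ let $A\tau_\sigma B\in B(\mathcal H)^{++}$ denote the unique solution $X\in B(\mathcal H)^{++}$ of the equation $X=(X\sigma A)\tau(X\sigma B)$, and for $A,B\in B(\mathcal H)^+$ set $A\tau_\sigma B:=\lim_{\varepsilon\searrow0}(A+\varepsilon I)\tau_\sigma(B+\varepsilon I)$. Then the binary operation $\tau_\sigma$ on $B(\mathcal H)^+$ is an operator mean. Moreover, its representing operator monotone function $f_{\tau_\sigma}$ is determined in such a way that, for every $t>0$, $x=f_{\tau_\sigma}(t)$ is the unique solution of $$(x\sigma1)\tau(x\sigma t)=x,\qquad x>0,$$ that is, of $$f_\sigma(1/x)\,f_\tau\!\left(\frac{f_\sigma(t/x)}{f_\sigma(1/x)}\right)=1,\qquad x>0.$$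
   Context: $B(\mathcal H)$ is the space of bounded linear operators on $\mathcal H$, $B(\mathcal H)^+$ the cone of positive (semidefinite) operators, $B(\mathcal H)^{++}$ the cone of positive invertible operators. An operator mean (Kubo–Ando) is a map $\sigma:B(\mathcal H)^+\times B(\mathcal H)^+\to B(\mathcal H)^+$ satisfying, for $A,A',B,B',C\in B(\mathcal H)^+$: (I) $A\le A'$, $B\le B'$ imply $A\sigma B\le A'\sigma B'$; (II) $C(A\sigma B)C\le(CAC)\sigma(CBC)$; (III) if $A_k\searrow A$ and $B_k\searrow B$ then $A_k\sigma B_k\searrow A\sigma B$, where $A_k\searrow A$ means $A_1\ge A_2\ge\cdots$ and $A_k\to A$ in the strong operator topology; (IV) $I\sigma I=I$. By Kubo–Ando, each operator mean $\sigma$ corresponds to a unique non-negative operator monotone function $f_\sigma$ on $[0,\infty)$ with $f_\sigma(1)=1$ (its representing function) such that $A\sigma B=A^{1/2}f_\sigma(A^{-1/2}BA^{-1/2})A^{1/2}$ for $A,B\in B(\mathcal H)^{++}$ and $A\sigma B=\lim_{\varepsilon\searrow0}(A+\varepsilon I)\sigma(B+\varepsilon I)$ for $A,B\in B(\mathcal H)^+$; conversely every such function arises. For scalars $a,b>0$, $a\sigma b:=a f_\sigma(b/a)$. $\mathfrak l$ is the left trivial mean $A\mathfrak lB=A$ (representing function $\equiv1$). It is known (as a preliminary result) that for $A,B\in B(\mathcal H)^{++}$ the equation $X=(X\sigma A)\tau(X\sigma B)$ has a unique solution $X\in B(\mathcal H)^{++}$, and that the limit defining $A\tau_\sigma B$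 for $A,B\in B(\mathcal H)^+$ exists in the strong operator topology (decreasing as $\varepsilon\searrow0$). *)

theory Defs
  imports "HOL-Analysis.Analysis"
begin

subsection \<open>Complex Hilbert spaces\<close>

text \<open>
  A complex inner product space is presented on top of the library class \<open>real_inner\<close>: the
  real inner product is the real part of the complex one, which is linear in its first argument.
  Since \<open>cinner x x\<close> is real by Hermitian symmetry, positive definiteness and
  \<open>norm x = sqrt (Re (cinner x x))\<close> are inherited.
\<close>

class complex_inner = real_inner +
  fixes scaleC :: "complex \<Rightarrow> 'a \<Rightarrow> 'a" (infixr "*\<^sub>C" 75)
    and cinner :: "'a \<Rightarrow> 'a \<Rightarrow> complex"
  assumes scaleC_add_right: "a *\<^sub>C (x + y) = a *\<^sub>C x + a *\<^sub>C y"
    and scaleC_add_left: "(a + b) *\<^sub>C x = a *\<^sub>C x + b *\<^sub>C x"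
    and scaleC_scaleC: "a *\<^sub>C b *\<^sub>C x = (a * b) *\<^sub>C x"
    and scaleC_of_real: "complex_of_real r *\<^sub>C x = r *\<^sub>R x"
    and cinner_commute: "cinner x y = cnj (cinner y x)"
    and cinner_add_left: "cinner (x + y) z = cinner x z + cinner y z"
    and cinner_scaleC_left: "cinner (a *\<^sub>C x) y = a * cinner x y"
    and Re_cinner: "Re (cinner x y) = inner x y"

class complex_hilbert = complex_inner + complete_space

definition infinite_dimensional :: "'a::complex_inner itself \<Rightarrow> bool" where
  "infinite_dimensional _ \<longleftrightarrow>
     \<not> (\<exists>S :: 'a set. finite S \<and> module.span scaleC S = UNIV)"

definition separable :: "'a::topological_space itself \<Rightarrow> bool" where
  "separable _ \<longleftrightarrow> (\<exists>D :: 'a set. countable D \<and> closure D = UNIV)"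


subsection \<open>Bounded linear operators\<close>

text \<open>
  The type \<open>'a \<Rightarrow>\<^sub>L 'a\<close> consists of the bounded real-linear maps; \<open>B(H)\<close> is the
  subset of the complex-linear ones.
\<close>

definition bops :: "('a::complex_hilbert \<Rightarrow>\<^sub>L 'a) set" where
  "bops = {A. \<forall>c x. blinfun_apply A (c *\<^sub>C x) = c *\<^sub>C blinfun_apply A x}"

definition positive_ops :: "('a::complex_hilbert \<Rightarrow>\<^sub>L 'a) set" where
  "positive_ops = {A \<in> bops. \<forall>x. cinner (blinfun_apply A x) x \<in> \<real>\<^sub>\<ge>\<^sub>0}"

definition op_invertible :: "('a::complex_hilbert \<Rightarrow>\<^sub>L 'a) \<Rightarrow> bool" where
  "op_invertible A \<longleftrightarrow>
     (\<exists>B \<in> bops. A o\<^sub>L B = id_blinfun \<and> B o\<^sub>L A = id_blinfun)"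

definition positive_inv_ops :: "('a::complex_hilbert \<Rightarrow>\<^sub>L 'a) set" where
  "positive_inv_ops = {A \<in> positive_ops. op_invertible A}"

definition op_le :: "('a::complex_hilbert \<Rightarrow>\<^sub>L 'a) \<Rightarrow> ('a \<Rightarrow>\<^sub>L 'a) \<Rightarrow> bool"
    (infix "\<sqsubseteq>" 50) where
  "A \<sqsubseteq> B \<longleftrightarrow> B - A \<in> positive_ops"

definition sot_tendsto ::
    "('b \<Rightarrow> 'a::complex_hilbert \<Rightarrow>\<^sub>L 'a) \<Rightarrow> ('a \<Rightarrow>\<^sub>L 'a) \<Rightarrow> 'b filter \<Rightarrow> bool" where
  "sot_tendsto F T net \<longleftrightarrow>
     (\<forall>x. ((\<lambda>b. blinfun_apply (F b) x) \<longlongrightarrow> blinfun_apply T x) net)"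

definition decreases_to ::
    "(nat \<Rightarrow> 'a::complex_hilbert \<Rightarrow>\<^sub>L 'a) \<Rightarrow> ('a \<Rightarrow>\<^sub>L 'a) \<Rightarrow> bool" where
  "decreases_to F T \<longleftrightarrow> (\<forall>k. F (Suc k) \<sqsubseteq> F k) \<and> sot_tendsto F T sequentially"


subsection \<open>Continuous functional calculus for self-adjoint operators\<close>

text \<open>The real part of the spectrum, which is the whole spectrum of a self-adjoint operator.\<close>

definition real_spectrum :: "('a::complex_hilbert \<Rightarrow>\<^sub>L 'a) \<Rightarrow> real set" where
  "real_spectrum A = {t. \<not> op_invertible (A - t *\<^sub>R id_blinfun)}"

definition op_poly :: "real poly \<Rightarrow> ('a::complex_hilbert \<Rightarrow>\<^sub>L 'a) \<Rightarrow> ('a \<Rightarrow>\<^sub>L 'a)" where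
  "op_poly p A = (\<Sum>i\<le>degree p. coeff p i *\<^sub>R ((\<lambda>T. A o\<^sub>L T) ^^ i) id_blinfun)"

text \<open>
  For \<open>A\<close> self-adjoint and \<open>f\<close> continuous on its spectrum, \<open>f(A)\<close> is the common norm limit of
  \<open>p\<^sub>n(A)\<close> over all sequences of polynomials converging to \<open>f\<close> uniformly on the spectrum.
\<close>

definition cfc :: "(real \<Rightarrow> real) \<Rightarrow> ('a::complex_hilbert \<Rightarrow>\<^sub>L 'a) \<Rightarrow> ('a \<Rightarrow>\<^sub>L 'a)" where
  "cfc f A = (THE T. \<forall>p :: nat \<Rightarrow> real poly.
     uniform_limit (real_spectrum A) (\<lambda>n t. poly (p n) t) f sequentially \<longrightarrow>
     (\<lambda>n. op_poly (p n) A) \<longlonglongrightarrow> T)"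

definition op_powr :: "('a::complex_hilbert \<Rightarrow>\<^sub>L 'a) \<Rightarrow> real \<Rightarrow> ('a \<Rightarrow>\<^sub>L 'a)" where
  "op_powr A r = cfc (\<lambda>t. t powr r) A"

text \<open>
  As usual, continuity on \<open>[0,\<infinity>)\<close> is part of operator monotonicity; it is automatic except at the
  end point \<open>0\<close>.
\<close>

definition operator_monotone :: "'a::complex_hilbert itself \<Rightarrow> (real \<Rightarrow> real) \<Rightarrow> bool" where
  "operator_monotone _ f \<longleftrightarrow> continuous_on {0..} f \<and>
     (\<forall>A \<in> positive_ops. \<forall>B \<in> (positive_ops :: ('a \<Rightarrow>\<^sub>L 'a) set).
        A \<sqsubseteq> B \<longrightarrow> cfc f A \<sqsubseteq> cfc f B)"


subsection \<open>Operator means\<close>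

text \<open>
  Binary operations on the positive cone are represented by functions on all pairs of operators,
  whose values outside the cone are irrelevant.
\<close>

type_synonym 'a binop = "('a \<Rightarrow>\<^sub>L 'a) \<Rightarrow> ('a \<Rightarrow>\<^sub>L 'a) \<Rightarrow> ('a \<Rightarrow>\<^sub>L 'a)"

definition operator_mean :: "'a::complex_hilbert binop \<Rightarrow> bool" where
  "operator_mean \<sigma> \<longleftrightarrow>
     (\<forall>A \<in> positive_ops. \<forall>B \<in> positive_ops. \<sigma> A B \<in> positive_ops) \<and>
     (\<forall>A \<in> positive_ops. \<forall>A' \<in> positive_ops. \<forall>B \<in> positive_ops. \<forall>B' \<in> positive_ops.
        A \<sqsubseteq> A' \<longrightarrow> B \<sqsubseteq> B' \<longrightarrow> \<sigma> A B \<sqsubseteq> \<sigma> A' B') \<and>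
     (\<forall>A \<in> positive_ops. \<forall>B \<in> positive_ops. \<forall>C \<in> positive_ops.
        C o\<^sub>L \<sigma> A B o\<^sub>L C \<sqsubseteq> \<sigma> (C o\<^sub>L A o\<^sub>L C) (C o\<^sub>L B o\<^sub>L C)) \<and>
     (\<forall>F G. \<forall>A \<in> positive_ops. \<forall>B \<in> positive_ops.
        range F \<subseteq> positive_ops \<longrightarrow> range G \<subseteq> positive_ops \<longrightarrow>
        decreases_to F A \<longrightarrow> decreases_to G B \<longrightarrow>
        decreases_to (\<lambda>k. \<sigma> (F k) (G k)) (\<sigma> A B)) \<and>
     \<sigma> id_blinfun id_blinfun = id_blinfun"

definition same_mean :: "'a::complex_hilbert binop \<Rightarrow> 'a binop \<Rightarrow> bool" where
  "same_mean \<sigma> \<rho> \<longleftrightarrow> (\<forall>A \<in> positive_ops. \<forall>B \<in> positive_ops. \<sigma> A B = \<rho> A B)"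

definition left_trivial_mean :: "'a::complex_hilbert binop" where
  "left_trivial_mean A B = A"

definition represents :: "(real \<Rightarrow> real) \<Rightarrow> 'a::complex_hilbert binop \<Rightarrow> bool" where
  "represents f \<sigma> \<longleftrightarrow>
     (\<forall>t\<ge>0. f t \<ge> 0) \<and> operator_monotone TYPE('a) f \<and> f 1 = 1 \<and>
     (\<forall>A \<in> positive_inv_ops. \<forall>B \<in> positive_inv_ops.
        \<sigma> A B = op_powr A (1/2) o\<^sub>L
                  cfc f (op_powr A (-1/2) o\<^sub>L B o\<^sub>L op_powr A (-1/2)) o\<^sub>L
                  op_powr A (1/2)) \<and>
     (\<forall>A \<in> positive_ops. \<forall>B \<in> positive_ops.
        sot_tendsto (\<lambda>\<epsilon>. \<sigma> (A + \<epsilon> *\<^sub>R id_blinfun) (B + \<epsilon> *\<^sub>R id_blinfun)) (\<sigma> A B) (at_right 0))"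

text \<open>Being a function on \<open>[0,\<infinity>)\<close>, it is made unique as a HOL function by extensionality.\<close>

definition rep_fun :: "'a::complex_hilbert binop \<Rightarrow> real \<Rightarrow> real" where
  "rep_fun \<sigma> = (THE f. f \<in> extensional {0..} \<and> represents f \<sigma>)"

definition scalar_mean :: "'a::complex_hilbert binop \<Rightarrow> real \<Rightarrow> real \<Rightarrow> real" where
  "scalar_mean \<sigma> a b = a * rep_fun \<sigma> (b / a)"


subsection \<open>The deformed operation\<close>

definition deformed_inv :: "'a::complex_hilbert binop \<Rightarrow> 'a binop \<Rightarrow> 'a binop" where
  "deformed_inv \<tau> \<sigma> A B = (THE X. X \<in> positive_inv_ops \<and> X = \<tau> (\<sigma> X A) (\<sigma> X B))"

text \<open>
  The solution operation is kept on invertible operators and extended by limits to the other pairs.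
  Hence on invertible operators the limit formula is not built in; it is the instance
  \<open>A + \<epsilon>I \<searrow> A\<close>, \<open>B + \<epsilon>I \<searrow> B\<close> of the continuity axiom of operator means.
\<close>

definition deformed_mean :: "'a::complex_hilbert binop \<Rightarrow> 'a binop \<Rightarrow> 'a binop" where
  "deformed_mean \<tau> \<sigma> A B =
     (if A \<in> positive_inv_ops \<and> B \<in> positive_inv_ops then deformed_inv \<tau> \<sigma> A B
      else (THE T. sot_tendsto
              (\<lambda>\<epsilon>. deformed_inv \<tau> \<sigma> (A + \<epsilon> *\<^sub>R id_blinfun) (B + \<epsilon> *\<^sub>R id_blinfun))
              T (at_right 0)))"

end

(*
  Axiom (II) with projections shows that I \<sigma> B commutes with every projection commuting with B;
  hence I \<sigma> tI = f(t) I, and cutting B along its spectral projections gives I \<sigma> B = f(B).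
  If f were constant on an interval without being constant, slightly rotated two-valued operators
  would contradict operator monotonicity, so f is strictly increasing when \<sigma> is not left trivial.
  Then a subsolution X of the equation lies below every supersolution Y: for the largest \<alpha> with
  \<alpha>X \<le> Y, \<alpha> < 1 would allow a larger factor. This comparison gives uniqueness and monotonicity,
  and existence follows by iterating downwards from a large multiple of I.
*)

theory Submission
  imports Defs "HOL-Computational_Algebra.Fundamental_Theorem_Algebra"
begin

text \<open>The correspondence between a mean and its function is proved from the axioms, and
  \<open>cfc\<close> is a definite description over all approximating polynomial sequences. So a
  bound of \<open>norm (op_poly p A)\<close> by the values of \<open>p\<close> on the real spectrum
  has to come before anything else about functions of operators. Strict monotonicity is invisible on
  scalars, where a function may be flat and rise later. A rotated projection needs two orthonormal
  vectors, and infinite dimension supplies them. The larger factor in the comparison must serve the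
  whole operator at once. It comes from a quotient f(s/\<alpha>)/f(s) that exceeds 1 and attains its
  minimum on a compact interval; invertibility matters because this interval has to avoid 0, where
  the quotient may degenerate. For non-invertible operators there is no equation to compare. There
  the value is handled as a greatest lower bound of regularized solutions, which reduces the axioms
  to inequalities between solutions.\<close>

context complex_hilbert
begin
\<comment> \<open>Completeness of the operator space, hence convergence of Neumann series and of
  Cauchy sequences of polynomials in an operator, is inferred from this class.\<close>
subclass banach ..
end

subsection \<open>Self-adjoint and positive operators\<close>

lemma scaleC_imaginary_unit_twice: "\<i> *\<^sub>C \<i> *\<^sub>C x = - x"
  for x :: "'a::complex_inner"
  using scaleC_of_real[of "-1" x] by (simp add: scaleC_scaleC)

lemma scaleC_scaleR: "c *\<^sub>C r *\<^sub>R x = r *\<^sub>R c *\<^sub>C x"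
  for x :: "'a::complex_inner"
  by (simp add: scaleC_of_real[symmetric] scaleC_scaleC mult.commute)

text \<open>Splitting the scalar reduces complex homogeneity of a real-linear map to commuting with
  the imaginary unit, as \<open>bops_iff\<close> exploits.\<close>

lemma scaleC_eq: "c *\<^sub>C x = Re c *\<^sub>R x + Im c *\<^sub>R \<i> *\<^sub>C x"
  for x :: "'a::complex_inner"
proof -
  have "c = complex_of_real (Re c) + complex_of_real (Im c) * \<i>"
    by (simp add: complex_eq_iff)
  then have "c *\<^sub>C x = (complex_of_real (Re c) + complex_of_real (Im c) * \<i>) *\<^sub>C x"
    by simp
  also have "\<dots> = Re c *\<^sub>R x + Im c *\<^sub>R \<i> *\<^sub>C x"
    by (simp only: scaleC_add_left scaleC_scaleC[symmetric] scaleC_of_real)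
  finally show ?thesis .
qed

text \<open>Hermitian symmetry as seen by the real inner product. It lets the later arguments work
  with \<open>inner\<close> instead of \<open>cinner\<close>.\<close>

lemma inner_imaginary_unit: "(\<i> *\<^sub>C x) \<bullet> y = - (x \<bullet> (\<i> *\<^sub>C y))"
  for x y :: "'a::complex_inner"
proof -
  have "(\<i> *\<^sub>C x) \<bullet> y = - Im (cinner x y)"
    by (simp add: Re_cinner[symmetric] cinner_scaleC_left)
  moreover have "x \<bullet> (\<i> *\<^sub>C y) = - Im (cinner y x)"
    by (subst inner_commute) (simp add: Re_cinner[symmetric] cinner_scaleC_left)
  moreover have "Im (cinner x y) = - Im (cinner y x)"
    by (subst cinner_commute) simp
  ultimately show ?thesis by simp
qed

lemma inner_imaginary_unit_self [simp]: "x \<bullet> (\<i> *\<^sub>C x) = 0" "(\<i> *\<^sub>C x) \<bullet> x = 0"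
  for x :: "'a::complex_inner"
  using inner_imaginary_unit[of x x] by (simp_all add: inner_commute)

lemma norm_imaginary_unit [simp]: "norm (\<i> *\<^sub>C x) = norm x"
  for x :: "'a::complex_inner"
  by (simp add: norm_eq_sqrt_inner inner_imaginary_unit scaleC_imaginary_unit_twice)

lemma bounded_linear_imaginary_unit: "bounded_linear ((*\<^sub>C) \<i> :: 'a \<Rightarrow> 'a::complex_inner)"
  by (rule bounded_linear_intro[where K = 1]) (simp_all add: scaleC_add_right scaleC_scaleR)

lemmas imaginary_unit_linear =
  linear_add[OF bounded_linear.linear[OF bounded_linear_imaginary_unit]]
  linear_diff[OF bounded_linear.linear[OF bounded_linear_imaginary_unit]]
  linear_neg[OF bounded_linear.linear[OF bounded_linear_imaginary_unit]]
  linear_scale[OF bounded_linear.linear[OF bounded_linear_imaginary_unit]]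
  linear_0[OF bounded_linear.linear[OF bounded_linear_imaginary_unit]]

lemma bops_iff: "A \<in> bops \<longleftrightarrow> (\<forall>x. A (\<i> *\<^sub>C x) = \<i> *\<^sub>C A x)"
proof
  assume "\<forall>x. A (\<i> *\<^sub>C x) = \<i> *\<^sub>C A x"
  then have "A (c *\<^sub>C x) = c *\<^sub>C A x" for c x
    unfolding scaleC_eq[of c x] scaleC_eq[of c "A x"] by (simp add: blinfun.bilinear_simps)
  then show "A \<in> bops" by (simp add: bops_def)
qed (simp add: bops_def)

text \<open>Symmetry is asked of the real inner product; since the operator commutes with the
  imaginary unit, Hermitian symmetry for \<open>cinner\<close> follows.\<close>

definition sa_ops :: "('a::complex_hilbert \<Rightarrow>\<^sub>L 'a) set" where
  "sa_ops = {A \<in> bops. \<forall>x y. A x \<bullet> y = x \<bullet> A y}"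

lemma bops_closed [simp, intro]:
  "id_blinfun \<in> bops" "0 \<in> bops"
  "A \<in> bops \<Longrightarrow> B \<in> bops \<Longrightarrow> A + B \<in> bops"
  "A \<in> bops \<Longrightarrow> B \<in> bops \<Longrightarrow> A - B \<in> bops"
  "A \<in> bops \<Longrightarrow> - A \<in> bops"
  "A \<in> bops \<Longrightarrow> r *\<^sub>R A \<in> bops"
  "A \<in> bops \<Longrightarrow> B \<in> bops \<Longrightarrow> A o\<^sub>L B \<in> bops"
  by (auto simp: bops_iff blinfun.bilinear_simps imaginary_unit_linear)

lemma sa_ops_sym: "A \<in> sa_ops \<Longrightarrow> A x \<bullet> y = x \<bullet> A y"
  by (simp add: sa_ops_def)

lemma sa_ops_bops: "A \<in> sa_ops \<Longrightarrow> A \<in> bops"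
  by (simp add: sa_ops_def)

lemma sa_ops_closed [simp, intro]:
  "id_blinfun \<in> sa_ops" "0 \<in> sa_ops"
  "A \<in> sa_ops \<Longrightarrow> B \<in> sa_ops \<Longrightarrow> A + B \<in> sa_ops"
  "A \<in> sa_ops \<Longrightarrow> B \<in> sa_ops \<Longrightarrow> A - B \<in> sa_ops"
  "A \<in> sa_ops \<Longrightarrow> - A \<in> sa_ops"
  "A \<in> sa_ops \<Longrightarrow> r *\<^sub>R A \<in> sa_ops"
  by (auto simp: sa_ops_def blinfun.bilinear_simps inner_simps)

lemma sa_ops_compose: "A \<in> sa_ops \<Longrightarrow> B \<in> sa_ops \<Longrightarrow> A o\<^sub>L B = B o\<^sub>L A \<Longrightarrow> A o\<^sub>L B \<in> sa_ops"
  by (auto simp: sa_ops_def, metis blinfun_apply_blinfun_compose)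

lemma sa_ops_sandwich: "A \<in> sa_ops \<Longrightarrow> C \<in> sa_ops \<Longrightarrow> C o\<^sub>L A o\<^sub>L C \<in> sa_ops"
  by (auto simp: sa_ops_def)

text \<open>Over the complex numbers a real quadratic form forces symmetry: a vanishing imaginary
  part says that \<open>A x\<close> is orthogonal to \<open>\<i> *\<^sub>C x\<close>, and polarizing
  this gives \<open>A x \<bullet> y = x \<bullet> A y\<close>.\<close>

lemma positive_ops_iff: "A \<in> positive_ops \<longleftrightarrow> A \<in> sa_ops \<and> (\<forall>x. 0 \<le> A x \<bullet> x)"
proof
  assume A: "A \<in> positive_ops"
  then have lin: "\<And>x. A (\<i> *\<^sub>C x) = \<i> *\<^sub>C A x"
    and Im: "\<And>x. Im (cinner (A x) x) = 0" and Re: "\<And>x. 0 \<le> A x \<bullet> x"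
    by (auto simp: positive_ops_def bops_iff complex_nonneg_Reals_iff Re_cinner)
  have Im_eq: "Im (cinner x y) = - ((\<i> *\<^sub>C x) \<bullet> y)" for x y :: 'a
    by (simp add: Re_cinner[symmetric] cinner_scaleC_left)
  have "A x \<bullet> (\<i> *\<^sub>C x) = 0" for x
    using Im[of x] unfolding Im_eq by (simp add: inner_imaginary_unit)
  from this[of "x + y" for x y] this
  have skew: "A x \<bullet> (\<i> *\<^sub>C y) = - (A y \<bullet> (\<i> *\<^sub>C x))" for x y
    by (simp add: blinfun.bilinear_simps imaginary_unit_linear inner_simps eq_neg_iff_add_eq_0)
  have "A x \<bullet> y = x \<bullet> A y" for x y
    using skew[of x "\<i> *\<^sub>C y"]
    by (simp add: lin scaleC_imaginary_unit_twice inner_imaginary_unit inner_commute)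
  then show "A \<in> sa_ops \<and> (\<forall>x. 0 \<le> A x \<bullet> x)"
    using A Re by (simp add: sa_ops_def positive_ops_def)
next
  assume A: "A \<in> sa_ops \<and> (\<forall>x. 0 \<le> A x \<bullet> x)"
  then have lin: "\<And>x. A (\<i> *\<^sub>C x) = \<i> *\<^sub>C A x" and sym: "\<And>x y. A x \<bullet> y = x \<bullet> A y"
    by (auto simp: sa_ops_def bops_iff)
  have "Im (cinner (A x) x) = - ((\<i> *\<^sub>C A x) \<bullet> x)" for x
    by (simp add: Re_cinner[symmetric] cinner_scaleC_left)
  moreover have "(\<i> *\<^sub>C A x) \<bullet> x = 0" for x
    using sym[of x "\<i> *\<^sub>C x"] inner_imaginary_unit[of "A x" x] inner_commute[of x "\<i> *\<^sub>C A x"]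
    by (simp add: lin)
  ultimately show "A \<in> positive_ops"
    using A sa_ops_bops[of A] by (auto simp: positive_ops_def complex_nonneg_Reals_iff Re_cinner)
qed

lemmas [simp] = sa_ops_bops

lemma positive_ops_sa [simp]: "A \<in> positive_ops \<Longrightarrow> A \<in> sa_ops"
  and positive_ops_nonneg [simp]: "A \<in> positive_ops \<Longrightarrow> 0 \<le> A x \<bullet> x"
  by (auto simp: positive_ops_iff)

lemma positive_opsI: "A \<in> sa_ops \<Longrightarrow> (\<And>x. 0 \<le> A x \<bullet> x) \<Longrightarrow> A \<in> positive_ops"
  unfolding positive_ops_iff by blast

lemma positive_ops_closed [simp, intro]:
  "id_blinfun \<in> positive_ops" "0 \<in> positive_ops"
  "A \<in> positive_ops \<Longrightarrow> B \<in> positive_ops \<Longrightarrow> A + B \<in> positive_ops"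
  "A \<in> positive_ops \<Longrightarrow> 0 \<le> r \<Longrightarrow> r *\<^sub>R A \<in> positive_ops"
  unfolding positive_ops_iff by (auto simp: blinfun.bilinear_simps inner_simps)

lemma positive_ops_sandwich [simp, intro]:
  "A \<in> positive_ops \<Longrightarrow> C \<in> sa_ops \<Longrightarrow> C o\<^sub>L A o\<^sub>L C \<in> positive_ops"
  using sa_ops_sandwich[of A C] unfolding positive_ops_iff by (auto simp: sa_ops_sym[of C])

lemma positive_ops_square [simp, intro]: "C \<in> sa_ops \<Longrightarrow> C o\<^sub>L C \<in> positive_ops"
  using sa_ops_compose[of C C] unfolding positive_ops_iff by (auto simp: sa_ops_sym[of C "C x" for x])

lemma op_leD: "A \<sqsubseteq> B \<Longrightarrow> A x \<bullet> x \<le> B x \<bullet> x"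
  unfolding op_le_def positive_ops_iff by (auto simp: blinfun.bilinear_simps inner_simps)

lemma op_leI: "A \<in> sa_ops \<Longrightarrow> B \<in> sa_ops \<Longrightarrow> (\<And>x. A x \<bullet> x \<le> B x \<bullet> x) \<Longrightarrow> A \<sqsubseteq> B"
  unfolding op_le_def positive_ops_iff by (auto simp: blinfun.bilinear_simps inner_simps)

lemma op_le_refl [simp]: "A \<sqsubseteq> A"
  by (simp add: op_le_def)

lemma op_le_trans [trans]: "A \<sqsubseteq> B \<Longrightarrow> B \<sqsubseteq> C \<Longrightarrow> A \<sqsubseteq> C"
  unfolding op_le_def using positive_ops_closed(3)[of "B - A" "C - B"] by simp

lemma op_le_add: "A \<sqsubseteq> B \<Longrightarrow> C \<sqsubseteq> D \<Longrightarrow> A + C \<sqsubseteq> B + D"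
  unfolding op_le_def using positive_ops_closed(3)[of "B - A" "D - C"] by (simp add: algebra_simps)

lemma op_le_scaleR: "A \<sqsubseteq> B \<Longrightarrow> 0 \<le> r \<Longrightarrow> r *\<^sub>R A \<sqsubseteq> r *\<^sub>R B"
  unfolding op_le_def using positive_ops_closed(4)[of "B - A" r] by (simp add: algebra_simps)

lemma op_le_scaleR_left: "A \<in> positive_ops \<Longrightarrow> r \<le> s \<Longrightarrow> r *\<^sub>R A \<sqsubseteq> s *\<^sub>R A"
  unfolding op_le_def using positive_ops_closed(4)[of A "s - r"] by (simp add: algebra_simps)

lemma op_le_sandwich: "A \<sqsubseteq> B \<Longrightarrow> C \<in> sa_ops \<Longrightarrow> C o\<^sub>L A o\<^sub>L C \<sqsubseteq> C o\<^sub>L B o\<^sub>L C"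
  unfolding op_le_def using positive_ops_sandwich[of "B - A" C]
  by (simp add: bounded_bilinear.diff_left[OF bounded_bilinear_blinfun_compose]
      bounded_bilinear.diff_right[OF bounded_bilinear_blinfun_compose])

lemma positive_le_imp_positive: "A \<in> positive_ops \<Longrightarrow> A \<sqsubseteq> B \<Longrightarrow> B \<in> positive_ops"
  unfolding op_le_def using positive_ops_closed(3)[of A "B - A"] by simp

text \<open>Evaluating the form at \<open>x + A x\<close> leaves only the cross term, twice the
  squared norm of \<open>A x\<close>.\<close>

lemma sa_ops_eq_0:
  assumes "A \<in> sa_ops" "\<And>x. A x \<bullet> x = 0" shows "A = 0"
proof (rule blinfun_eqI)
  fix x
  have "A (x + A x) \<bullet> (x + A x) = 0" by (rule assms)
  then have "A x \<bullet> A x = 0"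
    using assms(2)[of x] assms(2)[of "A x"] sa_ops_sym[OF assms(1), of "A x" x]
    by (simp add: blinfun.bilinear_simps inner_simps)
  then show "A x = blinfun_apply 0 x" by simp
qed

lemma op_le_antisym: "A \<sqsubseteq> B \<Longrightarrow> B \<sqsubseteq> A \<Longrightarrow> A = B"
proof -
  assume *: "A \<sqsubseteq> B" "B \<sqsubseteq> A"
  have "B - A = 0"
    using *[THEN op_leD] * by (intro sa_ops_eq_0) (auto simp: op_le_def blinfun.bilinear_simps inner_simps intro!: antisym)
  then show ?thesis by simp
qed

lemma positive_cauchy_schwarz:
  assumes "A \<in> positive_ops" shows "(A x \<bullet> y)\<^sup>2 \<le> (A x \<bullet> x) * (A y \<bullet> y)"
proof -
  have q: "0 \<le> A x \<bullet> x + 2 * t * (A x \<bullet> y) + t\<^sup>2 * (A y \<bullet> y)" for t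
  proof -
    have "A y \<bullet> x = A x \<bullet> y" using assms by (metis inner_commute positive_ops_sa sa_ops_sym)
    then show ?thesis
      using positive_ops_nonneg[OF assms, of "x + t *\<^sub>R y"]
      by (simp add: blinfun.bilinear_simps inner_simps power2_eq_square algebra_simps)
  qed
  show ?thesis
  proof (cases "A y \<bullet> y = 0")
    case True
    have "A x \<bullet> y = 0"
    proof (rule ccontr)
      assume nz: "A x \<bullet> y \<noteq> 0"
      show False
        \<comment> \<open>With a vanishing leading coefficient the quadratic is affine in
          \<open>t\<close>; at this \<open>t\<close> its value would be -1.\<close>
        using q[of "- (A x \<bullet> x + 1) / (2 * (A x \<bullet> y))"] True nz by (simp add: field_simps)
    qed
    then show ?thesis using assms by simp
  next
    case False
    then have pos: "0 < A y \<bullet> y" using positive_ops_nonneg[OF assms, of y] by linarith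
    show ?thesis
      using q[of "- (A x \<bullet> y) / (A y \<bullet> y)"] pos
      by (simp add: field_simps power2_eq_square)
  qed
qed

text \<open>Cauchy-Schwarz with \<open>y = A x\<close>. It turns control of the form into control of
  the vectors \<open>A x\<close>, which makes monotone sequences converge strongly.\<close>

lemma positive_norm_square_le:
  assumes "A \<in> positive_ops" "\<And>y. A y \<bullet> y \<le> K * (norm y)\<^sup>2"
  shows "(norm (A x))\<^sup>2 \<le> K * (A x \<bullet> x)"
proof (cases "A x = 0")
  case True then show ?thesis by simp
next
  case False
  have "((norm (A x))\<^sup>2)\<^sup>2 \<le> (A x \<bullet> x) * (A (A x) \<bullet> A x)"
    using positive_cauchy_schwarz[OF assms(1), of x "A x"] by (simp add: power2_norm_eq_inner)
  also have "\<dots> \<le> (A x \<bullet> x) * (K * (norm (A x))\<^sup>2)"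
    using assms by (intro mult_left_mono) auto
  finally show ?thesis using False by (simp add: power2_eq_square mult.commute)
qed

text \<open>Polarization bounds \<open>4 * (A x \<bullet> y)\<close> by \<open>c\<close> times a
  parallelogram sum; \<open>y\<close> is then taken parallel to \<open>A x\<close> and as long as
  \<open>x\<close>.\<close>

lemma sa_ops_norm_le:
  assumes A: "A \<in> sa_ops" and le: "\<And>x. \<bar>A x \<bullet> x\<bar> \<le> c * (norm x)\<^sup>2" and c: "0 \<le> c"
  shows "norm A \<le> c"
proof (rule norm_blinfun_bound[OF c])
  fix x
  show "norm (A x) \<le> c * norm x"
  proof (cases "A x = 0 \<or> x = 0")
    case False
    define y where "y = (norm x / norm (A x)) *\<^sub>R A x"
    have ny: "norm y = norm x" using False by (simp add: y_def)
    have "4 * (A x \<bullet> y) = A (x + y) \<bullet> (x + y) - A (x - y) \<bullet> (x - y)"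
      by (simp add: blinfun.bilinear_simps inner_simps sa_ops_sym[OF A, of y x] inner_commute[of y])
    also have "\<dots> \<le> c * (norm (x + y))\<^sup>2 + c * (norm (x - y))\<^sup>2"
      using le[of "x + y"] le[of "x - y"] by linarith
    also have "\<dots> = c * (2 * (norm x)\<^sup>2 + 2 * (norm y)\<^sup>2)"
      by (simp add: power2_norm_eq_inner inner_simps inner_commute algebra_simps)
    finally have "A x \<bullet> y \<le> c * (norm x)\<^sup>2" by (simp add: ny)
    moreover have "A x \<bullet> y = norm x * norm (A x)"
      using False by (simp add: y_def power2_norm_eq_inner[symmetric] power2_eq_square)
    ultimately show ?thesis
      using False by (simp add: power2_eq_square mult.commute mult.left_commute)
  qed (use c in auto)
qed

lemma inner_le_norm: "\<bar>A x \<bullet> x\<bar> \<le> norm A * (norm x)\<^sup>2"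
  for A :: "'a::real_inner \<Rightarrow>\<^sub>L 'a"
proof -
  have "\<bar>A x \<bullet> x\<bar> \<le> norm (A x) * norm x" by (rule Cauchy_Schwarz_ineq2)
  also have "\<dots> \<le> (norm A * norm x) * norm x" by (intro mult_right_mono norm_blinfun) auto
  finally show ?thesis by (simp add: power2_eq_square mult.assoc)
qed

lemma op_le_norm:
  assumes "A \<in> sa_ops" "norm A \<le> c" shows "A \<sqsubseteq> c *\<^sub>R id_blinfun"
proof (rule op_leI)
  fix x
  have "A x \<bullet> x \<le> c * (norm x)\<^sup>2"
    using inner_le_norm[of A x] mult_right_mono[OF assms(2), of "(norm x)\<^sup>2"] by auto
  then show "A x \<bullet> x \<le> (c *\<^sub>R id_blinfun) x \<bullet> x"
    by (simp add: blinfun.bilinear_simps power2_norm_eq_inner)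
qed (use assms in auto)


lemmas blinfun_compose_bilinear =
  bounded_bilinear.add_left[OF bounded_bilinear_blinfun_compose]
  bounded_bilinear.add_right[OF bounded_bilinear_blinfun_compose]
  bounded_bilinear.diff_left[OF bounded_bilinear_blinfun_compose]
  bounded_bilinear.diff_right[OF bounded_bilinear_blinfun_compose]
  bounded_bilinear.minus_left[OF bounded_bilinear_blinfun_compose]
  bounded_bilinear.minus_right[OF bounded_bilinear_blinfun_compose]
  bounded_bilinear.scaleR_left[OF bounded_bilinear_blinfun_compose]
  bounded_bilinear.scaleR_right[OF bounded_bilinear_blinfun_compose]

lemma blinfun_compose_id [simp]: "id_blinfun o\<^sub>L A = A" "A o\<^sub>L id_blinfun = A"
  by (auto intro: blinfun_eqI)

lemma blinfun_compose_assoc: "(A o\<^sub>L B) o\<^sub>L C = A o\<^sub>L (B o\<^sub>L C)"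
  by (auto intro: blinfun_eqI)


subsection \<open>Invertibility\<close>

lemma op_invertible_compose:
  assumes "op_invertible A" "op_invertible B" shows "op_invertible (A o\<^sub>L B)"
proof -
  obtain A' B' where *: "A' \<in> bops" "B' \<in> bops" "A o\<^sub>L A' = id_blinfun" "A' o\<^sub>L A = id_blinfun"
    "B o\<^sub>L B' = id_blinfun" "B' o\<^sub>L B = id_blinfun"
    using assms unfolding op_invertible_def by metis
  have "\<And>x. A (A' x) = x" "\<And>x. A' (A x) = x" "\<And>x. B (B' x) = x" "\<And>x. B' (B x) = x"
    using *(3-) by (metis blinfun_apply_blinfun_compose blinfun_apply_id_blinfun id_apply)+
  then have "(A o\<^sub>L B) o\<^sub>L (B' o\<^sub>L A') = id_blinfun" "(B' o\<^sub>L A') o\<^sub>L (A o\<^sub>L B) = id_blinfun"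
    by (auto intro!: blinfun_eqI)
  then show ?thesis unfolding op_invertible_def using * by blast
qed

lemma op_invertible_scaleR:
  assumes "op_invertible A" "c \<noteq> 0" shows "op_invertible (c *\<^sub>R A)"
proof -
  obtain B where B: "B \<in> bops" "A o\<^sub>L B = id_blinfun" "B o\<^sub>L A = id_blinfun"
    using assms(1) unfolding op_invertible_def by metis
  then have "(c *\<^sub>R A) o\<^sub>L ((1 / c) *\<^sub>R B) = id_blinfun" "((1 / c) *\<^sub>R B) o\<^sub>L (c *\<^sub>R A) = id_blinfun"
    using assms(2) by (auto simp: bounded_bilinear.scaleR_left[OF bounded_bilinear_blinfun_compose]
      bounded_bilinear.scaleR_right[OF bounded_bilinear_blinfun_compose])
  then show ?thesis unfolding op_invertible_def using B by blast
qed

text \<open>A Neumann series yields an inverse among the real-linear operators, whereas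
  \<open>op_invertible\<close> asks for a complex-linear one.\<close>

lemma bops_inverse:
  assumes "A \<in> bops" "A o\<^sub>L B = id_blinfun" "B o\<^sub>L A = id_blinfun" shows "B \<in> bops"
  unfolding bops_iff
proof
  fix x
  have inv: "\<And>x. A (B x) = x" "\<And>x. B (A x) = x"
    using assms(2,3) by (metis blinfun_apply_blinfun_compose blinfun_apply_id_blinfun id_apply)+
  have "B (\<i> *\<^sub>C x) = B (\<i> *\<^sub>C A (B x))" by (simp add: inv)
  also have "\<dots> = B (A (\<i> *\<^sub>C B x))" using assms(1) by (simp add: bops_iff)
  also have "\<dots> = \<i> *\<^sub>C B x" by (simp add: inv)
  finally show "B (\<i> *\<^sub>C x) = \<i> *\<^sub>C B x" .
qed

lemma neumann:
  fixes K :: "'a::banach \<Rightarrow>\<^sub>L 'a"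
  assumes "norm K < 1"
  shows "\<exists>B. (id_blinfun - K) o\<^sub>L B = id_blinfun \<and> B o\<^sub>L (id_blinfun - K) = id_blinfun"
proof -
  define P where "P n = ((\<lambda>T. K o\<^sub>L T) ^^ n) id_blinfun" for n
  have P0: "P 0 = id_blinfun" and PS: "P (Suc n) = K o\<^sub>L P n" for n by (simp_all add: P_def)
  have PS': "P (Suc n) = P n o\<^sub>L K" for n
    by (induction n) (auto simp: P0 PS intro!: blinfun_eqI, metis PS blinfun_apply_blinfun_compose)
  have nP: "norm (P n) \<le> norm K ^ n" for n
  proof (induction n)
    case 0 show ?case by (simp add: P0 norm_blinfun_id_le)
  next
    case (Suc n)
    have "norm (P (Suc n)) \<le> norm K * norm (P n)" unfolding PS by (rule norm_blinfun_compose)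
    also have "\<dots> \<le> norm K * norm K ^ n" using Suc by (intro mult_left_mono) auto
    finally show ?case by simp
  qed
  have sm: "summable P"
    by (rule summable_comparison_test'[OF summable_geometric[of "norm K"]]) (use assms nP in auto)
  have split: "suminf P = id_blinfun + (\<Sum>n. P (Suc n))"
    using suminf_split_head[OF sm] by (simp add: P0)
  have L: "(\<Sum>n. P (Suc n)) = K o\<^sub>L suminf P" unfolding PS
    by (rule bounded_linear.suminf[OF bounded_bilinear.bounded_linear_right[OF bounded_bilinear_blinfun_compose] sm, symmetric])
  have R: "(\<Sum>n. P (Suc n)) = suminf P o\<^sub>L K" unfolding PS'
    by (rule bounded_linear.suminf[OF bounded_bilinear.bounded_linear_left[OF bounded_bilinear_blinfun_compose] sm, symmetric])
  have "(id_blinfun - K) o\<^sub>L suminf P = suminf P - (K o\<^sub>L suminf P)"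
    "suminf P o\<^sub>L (id_blinfun - K) = suminf P - (suminf P o\<^sub>L K)"
    by (auto intro!: blinfun_eqI simp: blinfun.bilinear_simps)
  then have "(id_blinfun - K) o\<^sub>L suminf P = id_blinfun" "suminf P o\<^sub>L (id_blinfun - K) = id_blinfun"
    using split L R by (metis add_diff_cancel_right')+
  then show ?thesis by blast
qed

text \<open>After division by an upper bound \<open>M\<close>, the form of \<open>K\<close> lies
  between 0 and \<open>1 - c / M\<close>, so \<open>norm K < 1\<close> and the Neumann series
  applies.\<close>

lemma coercive_imp_invertible:
  assumes S: "S \<in> sa_ops" and c: "0 < c" "\<And>x. c * (norm x)\<^sup>2 \<le> S x \<bullet> x"
  shows "op_invertible S"
proof -
  \<comment> \<open>The maximum with \<open>c\<close> keeps \<open>M\<close> positive and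
    \<open>c / M\<close> at most 1, also on the trivial space.\<close>
  define M where "M = max (norm S) c"
  have M: "0 < M" "c \<le> M" "norm S \<le> M" using c by (auto simp: M_def)
  define K where "K = id_blinfun - (1 / M) *\<^sub>R S"
  have Ksa: "K \<in> sa_ops" using S by (auto simp: K_def)
  have K: "K x \<bullet> x = (norm x)\<^sup>2 - (S x \<bullet> x) / M" for x
    by (simp add: K_def blinfun.bilinear_simps inner_simps power2_norm_eq_inner)
  have "\<bar>K x \<bullet> x\<bar> \<le> (1 - c / M) * (norm x)\<^sup>2" for x
  proof -
    have "S x \<bullet> x \<le> M * (norm x)\<^sup>2"
      using inner_le_norm[of S x] M mult_right_mono[of "norm S" M "(norm x)\<^sup>2"] by auto
    then have "0 \<le> K x \<bullet> x" using M by (simp add: K field_simps)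
    moreover have "K x \<bullet> x \<le> (1 - c / M) * (norm x)\<^sup>2"
      using c(2)[of x] M by (simp add: K field_simps)
    ultimately show ?thesis by simp
  qed
  then have "norm K \<le> 1 - c / M" using Ksa M by (intro sa_ops_norm_le) auto
  moreover have "0 < c / M" using M c by simp
  ultimately have "norm K < 1" by linarith
  moreover have eq: "S = M *\<^sub>R (id_blinfun - K)" using M by (simp add: K_def)
  ultimately obtain B where "(id_blinfun - K) o\<^sub>L B = id_blinfun" "B o\<^sub>L (id_blinfun - K) = id_blinfun"
    using neumann by blast
  then have "op_invertible (id_blinfun - K)"
    using bops_inverse[of "id_blinfun - K" B] Ksa unfolding op_invertible_def by auto
  then show ?thesis unfolding eq using M by (intro op_invertible_scaleR) auto
qed

text \<open>The inverse bounds \<open>norm x\<close> by a multiple of \<open>norm (A x)\<close>,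
  whose square positivity bounds by a multiple of the form. Adding 1 to both norms keeps
  \<open>K\<close> positive.\<close>

lemma positive_inv_coercive:
  assumes "A \<in> positive_inv_ops"
  obtains c where "0 < c" "\<And>x. c * (norm x)\<^sup>2 \<le> A x \<bullet> x"
proof -
  obtain B where B: "A o\<^sub>L B = id_blinfun" "B o\<^sub>L A = id_blinfun"
    using assms unfolding positive_inv_ops_def op_invertible_def by blast
  have A: "A \<in> positive_ops" using assms by (simp add: positive_inv_ops_def)
  define K where "K = (norm B + 1)\<^sup>2 * (norm A + 1)"
  have "0 < norm A + 1" "0 < norm B + 1" by (simp_all add: add_nonneg_pos)
  then have K: "0 < K" by (simp add: K_def)
  have "(1 / K) * (norm x)\<^sup>2 \<le> A x \<bullet> x" for x
  proof -
    have "norm x = norm (B (A x))"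
      using B(2) by (metis blinfun_apply_blinfun_compose blinfun_apply_id_blinfun id_apply)
    also have "\<dots> \<le> norm B * norm (A x)" by (rule norm_blinfun)
    also have "\<dots> \<le> (norm B + 1) * norm (A x)" by (simp add: mult_right_mono)
    finally have "(norm x)\<^sup>2 \<le> ((norm B + 1) * norm (A x))\<^sup>2" by (rule power_mono) simp
    also have "\<dots> = (norm B + 1)\<^sup>2 * (norm (A x))\<^sup>2" by (simp add: power_mult_distrib)
    also have "\<dots> \<le> (norm B + 1)\<^sup>2 * ((norm A + 1) * (A x \<bullet> x))"
    proof (intro mult_left_mono positive_norm_square_le[OF A])
      fix y
      show "A y \<bullet> y \<le> (norm A + 1) * (norm y)\<^sup>2"
        using inner_le_norm[of A y] mult_right_mono[of "norm A" "norm A + 1" "(norm y)\<^sup>2"] by auto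
    qed auto
    finally show ?thesis using K by (simp add: K_def field_simps)
  qed
  then show ?thesis using that[of "1 / K"] K by auto
qed

lemma positive_inv_iff:
  "A \<in> positive_inv_ops \<longleftrightarrow> A \<in> sa_ops \<and> (\<exists>c>0. c *\<^sub>R id_blinfun \<sqsubseteq> A)"
proof
  assume A: "A \<in> positive_inv_ops"
  then obtain c where "0 < c" "\<And>x. c * (norm x)\<^sup>2 \<le> A x \<bullet> x" by (rule positive_inv_coercive) blast
  moreover have "A \<in> sa_ops" using A by (simp add: positive_inv_ops_def)
  ultimately show "A \<in> sa_ops \<and> (\<exists>c>0. c *\<^sub>R id_blinfun \<sqsubseteq> A)"
    by (auto intro!: exI[of _ c] op_leI simp: blinfun.bilinear_simps power2_norm_eq_inner)
next
  assume "A \<in> sa_ops \<and> (\<exists>c>0. c *\<^sub>R id_blinfun \<sqsubseteq> A)"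
  then obtain c where A: "A \<in> sa_ops" and c: "0 < c" "c *\<^sub>R id_blinfun \<sqsubseteq> A" by blast
  have "c * (norm x)\<^sup>2 \<le> A x \<bullet> x" for x
    using op_leD[OF c(2), of x] by (simp add: blinfun.bilinear_simps power2_norm_eq_inner)
  then show "A \<in> positive_inv_ops"
    using c A coercive_imp_invertible[of A c] positive_le_imp_positive[of "c *\<^sub>R id_blinfun" A]
    by (auto simp: positive_inv_ops_def)
qed

lemma positive_inv_opsI: "A \<in> positive_ops \<Longrightarrow> op_invertible A \<Longrightarrow> A \<in> positive_inv_ops"
  by (simp add: positive_inv_ops_def)

lemma positive_inv_opsD: "A \<in> positive_inv_ops \<Longrightarrow> op_invertible A"
  by (simp add: positive_inv_ops_def)

lemma positive_inv_positive [simp]: "A \<in> positive_inv_ops \<Longrightarrow> A \<in> positive_ops"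
  by (simp add: positive_inv_ops_def)

lemma positive_inv_ge: "A \<in> positive_inv_ops \<Longrightarrow> A \<sqsubseteq> B \<Longrightarrow> B \<in> positive_inv_ops"
  by (meson op_le_trans positive_inv_iff positive_inv_positive positive_le_imp_positive positive_ops_sa)

lemma positive_inv_add: "A \<in> positive_ops \<Longrightarrow> 0 < c \<Longrightarrow> A + c *\<^sub>R id_blinfun \<in> positive_inv_ops"
  unfolding positive_inv_iff by (auto intro!: exI[of _ c] simp: op_le_def)

lemma positive_inv_sandwich: "A \<in> positive_inv_ops \<Longrightarrow> C \<in> positive_inv_ops \<Longrightarrow> C o\<^sub>L A o\<^sub>L C \<in> positive_inv_ops"
  by (rule positive_inv_opsI) (simp_all add: op_invertible_compose positive_inv_opsD positive_ops_sandwich)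

lemma positive_inv_scaleR: "A \<in> positive_inv_ops \<Longrightarrow> 0 < c \<Longrightarrow> c *\<^sub>R A \<in> positive_inv_ops"
  by (rule positive_inv_opsI) (simp_all add: op_invertible_scaleR positive_inv_opsD)

lemma positive_inv_scaled_id [simp]: "0 < c \<Longrightarrow> c *\<^sub>R id_blinfun \<in> positive_inv_ops"
  using positive_inv_add[of 0 c] by simp

lemma positive_inv_id [simp]: "id_blinfun \<in> positive_inv_ops"
  using positive_inv_scaled_id[of 1] by simp


subsection \<open>Strong limits\<close>

lemma sot_tendstoD: "sot_tendsto F T net \<Longrightarrow> ((\<lambda>b. F b x) \<longlongrightarrow> T x) net"
  by (simp add: sot_tendsto_def)

lemma sot_tendsto_inner: "sot_tendsto F T net \<Longrightarrow> ((\<lambda>b. F b x \<bullet> y) \<longlongrightarrow> T x \<bullet> y) net"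
  by (intro tendsto_intros sot_tendstoD)

lemma sot_tendsto_unique:
  "net \<noteq> bot \<Longrightarrow> sot_tendsto F T net \<Longrightarrow> sot_tendsto F T' net \<Longrightarrow> T = T'"
  by (intro blinfun_eqI) (auto simp: sot_tendsto_def intro: tendsto_unique)

lemma norm_tendsto_imp_sot: "(F \<longlongrightarrow> T) net \<Longrightarrow> sot_tendsto F T net"
  unfolding sot_tendsto_def by (intro allI blinfun.tendsto) auto

lemma sot_limit_bops:
  assumes "net \<noteq> bot" "sot_tendsto F T net" "\<And>b. F b \<in> bops"
  shows "T \<in> bops"
  unfolding bops_iff
proof
  fix x
  have "((\<lambda>b. F b (\<i> *\<^sub>C x)) \<longlongrightarrow> \<i> *\<^sub>C T x) net"
    using assms(3) bounded_linear.tendsto[OF bounded_linear_imaginary_unit sot_tendstoD[OF assms(2)]]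
    by (simp add: bops_iff)
  then show "T (\<i> *\<^sub>C x) = \<i> *\<^sub>C T x"
    using assms(1) sot_tendstoD[OF assms(2)] tendsto_unique by blast
qed

lemma sot_limit_sa:
  assumes "net \<noteq> bot" "sot_tendsto F T net" "\<And>b. F b \<in> sa_ops"
  shows "T \<in> sa_ops"
proof -
  have "T x \<bullet> y = x \<bullet> T y" for x y
  proof (rule tendsto_unique[OF assms(1) sot_tendsto_inner[OF assms(2)]])
    show "((\<lambda>b. F b x \<bullet> y) \<longlongrightarrow> x \<bullet> T y) net"
      unfolding sa_ops_sym[OF assms(3)] by (intro tendsto_intros sot_tendstoD assms)
  qed
  then show ?thesis
    using sot_limit_bops[OF assms(1,2)] assms(3)[THEN sa_ops_bops] unfolding sa_ops_def by simp
qed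

lemma sot_limit_positive:
  assumes "net \<noteq> bot" "sot_tendsto F T net" "\<And>b. F b \<in> positive_ops"
  shows "T \<in> positive_ops"
proof (rule positive_opsI)
  show "T \<in> sa_ops" using assms by (intro sot_limit_sa[OF assms(1,2)]) auto
  show "0 \<le> T x \<bullet> x" for x
    using tendsto_lowerbound[OF sot_tendsto_inner[OF assms(2)] _ assms(1)] assms(3)
    by (auto intro!: always_eventually)
qed

lemma sot_tendsto_cong: "eventually (\<lambda>b. F b = G b) net \<Longrightarrow> sot_tendsto F T net = sot_tendsto G T net"
  unfolding sot_tendsto_def by (intro all_cong1 tendsto_cong) (auto elim: eventually_mono)

lemma sot_tendsto_intros:
  "sot_tendsto (\<lambda>b. A) A net"
  "sot_tendsto F A net \<Longrightarrow> sot_tendsto G B net \<Longrightarrow> sot_tendsto (\<lambda>b. F b + G b) (A + B) net"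
  "sot_tendsto F A net \<Longrightarrow> sot_tendsto G B net \<Longrightarrow> sot_tendsto (\<lambda>b. F b - G b) (A - B) net"
  "sot_tendsto F A net \<Longrightarrow> sot_tendsto (\<lambda>b. C o\<^sub>L F b) (C o\<^sub>L A) net"
  "sot_tendsto F A net \<Longrightarrow> sot_tendsto (\<lambda>b. F b o\<^sub>L C) (A o\<^sub>L C) net"
  unfolding sot_tendsto_def
  by (auto simp: blinfun.bilinear_simps
      intro: tendsto_add tendsto_diff bounded_linear.tendsto[OF blinfun.bounded_linear_right])

lemma sot_limit_le:
  assumes "net \<noteq> bot" "sot_tendsto F A net" "sot_tendsto G B net"
    and "eventually (\<lambda>b. F b \<sqsubseteq> G b) net" "A \<in> sa_ops" "B \<in> sa_ops"
  shows "A \<sqsubseteq> B"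
proof (rule op_leI)
  show "A x \<bullet> x \<le> B x \<bullet> x" for x
    by (rule tendsto_le[OF assms(1) sot_tendsto_inner[OF assms(3)] sot_tendsto_inner[OF assms(2)]])
      (use assms(4) in \<open>auto elim!: eventually_mono dest: op_leD\<close>)
qed (use assms in auto)

lemma decreasing_le:
  assumes "\<And>k. F (Suc k) \<sqsubseteq> F k" "m \<le> n" shows "F n \<sqsubseteq> F m"
  using assms(2) by (induction n rule: dec_induct) (use assms(1) op_le_trans in auto)

lemma decreases_to_lower:
  assumes "decreases_to F T" "\<And>k. F k \<in> sa_ops"
  shows "T \<sqsubseteq> F k"
proof (rule sot_limit_le[of sequentially F T "\<lambda>_. F k" "F k"])
  show "eventually (\<lambda>n. F n \<sqsubseteq> F k) sequentially"
    using eventually_ge_at_top[of k]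
    by eventually_elim (use assms(1) decreasing_le[of F] in \<open>auto simp: decreases_to_def\<close>)
  show "T \<in> sa_ops" using assms sot_limit_sa[of sequentially F T] by (auto simp: decreases_to_def)
qed (use assms in \<open>auto simp: decreases_to_def intro: sot_tendsto_intros\<close>)

text \<open>The forms decrease to a limit, and by \<open>positive_norm_square_le\<close> their
  differences dominate the squared distances of the vectors, which are therefore Cauchy.\<close>

lemma decreasing_convergent:
  fixes F :: "nat \<Rightarrow> 'a::complex_hilbert \<Rightarrow>\<^sub>L 'a"
  assumes pos: "\<And>k. F k \<in> positive_ops" and dec: "\<And>k. F (Suc k) \<sqsubseteq> F k"
  obtains T where "T \<in> positive_ops" "decreases_to F T"
proof -
  have mono: "F n \<sqsubseteq> F m" if "m \<le> n" for m n using decreasing_le[of F, OF dec that] .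
  have "norm (F n) \<le> norm (F 0)" for n
  proof (rule sa_ops_norm_le)
    show "\<bar>F n x \<bullet> x\<bar> \<le> norm (F 0) * (norm x)\<^sup>2" for x
      using positive_ops_nonneg[OF pos[of n], of x] op_leD[OF mono[of 0 n], of x] inner_le_norm[of "F 0" x] by auto
  qed (use pos in auto)
  then have bnd: "norm (F n x) \<le> norm x * norm (F 0)" for n x
    using norm_blinfun[of "F n" x] mult_right_mono[of "norm (F n)" "norm (F 0)" "norm x"]
    by (metis norm_ge_zero order_trans mult.commute)
  define K where "K = norm (F 0)"
  have step: "(norm (F m x - F n x))\<^sup>2 \<le> K * (F m x \<bullet> x - F n x \<bullet> x)" if "m \<le> n" for m n x
  proof -
    have R: "F m - F n \<in> positive_ops" using mono[OF that] by (simp add: op_le_def)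
    have "(norm ((F m - F n) x))\<^sup>2 \<le> K * ((F m - F n) x \<bullet> x)"
    proof (rule positive_norm_square_le[OF R])
      fix y
      show "(F m - F n) y \<bullet> y \<le> K * (norm y)\<^sup>2"
        using positive_ops_nonneg[OF pos[of n], of y] op_leD[OF mono[of 0 m], of y] inner_le_norm[of "F 0" y]
        by (simp add: blinfun.bilinear_simps inner_simps K_def)
    qed
    then show ?thesis by (simp add: blinfun.bilinear_simps inner_simps)
  qed
  have conv: "convergent (\<lambda>n. F n x)" for x
  proof -
    have "decseq (\<lambda>n. F n x \<bullet> x)" by (auto simp: decseq_def intro: op_leD mono)
    then have "convergent (\<lambda>n. F n x \<bullet> x)"
      using decseq_convergent[of "\<lambda>n. F n x \<bullet> x" 0] pos convergentI positive_ops_nonneg by metis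
    then have C: "Cauchy (\<lambda>n. F n x \<bullet> x)" by (simp add: Cauchy_convergent_iff)
    have "Cauchy (\<lambda>n. F n x)"
      unfolding Cauchy_altdef
    proof (intro allI impI)
      fix e :: real assume e: "0 < e"
      \<comment> \<open>\<open>K\<close> is 0 when \<open>F 0\<close> is, so \<open>K + 1\<close>
        serves as the divisor.\<close>
      have K1: "0 < K + 1" by (simp add: K_def add_nonneg_pos)
      then obtain M where M: "\<And>m n. M \<le> m \<Longrightarrow> m < n \<Longrightarrow> dist (F m x \<bullet> x) (F n x \<bullet> x) < e\<^sup>2 / (K + 1)"
        using C e unfolding Cauchy_altdef by (meson divide_pos_pos zero_less_power)
      show "\<exists>M. \<forall>m\<ge>M. \<forall>n>m. dist (F m x) (F n x) < e"
      proof (intro exI[of _ M] allI impI)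
        fix m n assume mn: "M \<le> m" "m < n"
        have d: "F m x \<bullet> x - F n x \<bullet> x < e\<^sup>2 / (K + 1)" "0 \<le> F m x \<bullet> x - F n x \<bullet> x"
          using M[OF mn] op_leD[OF mono[of m n], of x] mn by (auto simp: dist_real_def)
        have "(norm (F m x - F n x))\<^sup>2 \<le> K * (F m x \<bullet> x - F n x \<bullet> x)" using step mn by simp
        also have "\<dots> \<le> (K + 1) * (F m x \<bullet> x - F n x \<bullet> x)" using d by (intro mult_right_mono) auto
        also have "\<dots> < e\<^sup>2" using d(1) K1 by (simp add: field_simps)
        finally show "dist (F m x) (F n x) < e" using e by (simp add: dist_norm power_less_imp_less_base)
      qed
    qed
    then show ?thesis by (simp add: Cauchy_convergent_iff)
  qed
  define t where "t x = lim (\<lambda>n. F n x)" for x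
  have t: "(\<lambda>n. F n x) \<longlonglongrightarrow> t x" for x using conv[of x] by (simp add: t_def convergent_LIMSEQ_iff)
  have bl: "bounded_linear t"
  proof (rule bounded_linear_intro[where K = K])
    fix x y r
    show "t (x + y) = t x + t y"
      by (rule LIMSEQ_unique[OF t]) (auto simp: blinfun.bilinear_simps intro!: tendsto_intros t)
    show "t (r *\<^sub>R x) = r *\<^sub>R t x"
      by (rule LIMSEQ_unique[OF t]) (auto simp: blinfun.bilinear_simps intro!: tendsto_intros t)
    show "norm (t x) \<le> norm x * K"
      by (rule LIMSEQ_le_const2[OF tendsto_norm[OF t]]) (use bnd in \<open>auto simp: K_def\<close>)
  qed
  have "sot_tendsto F (Blinfun t) sequentially"
    unfolding sot_tendsto_def using t by (simp add: bounded_linear_Blinfun_apply[OF bl])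
  moreover from this have "Blinfun t \<in> positive_ops"
    by (rule sot_limit_positive[OF trivial_limit_sequentially _ pos])
  ultimately show ?thesis using that dec unfolding decreases_to_def by blast
qed

lemma decreases_to_unique: "decreases_to F S \<Longrightarrow> decreases_to F T \<Longrightarrow> S = T"
  unfolding decreases_to_def using sot_tendsto_unique[of sequentially F S T] by auto

lemma decreases_to_const: "decreases_to (\<lambda>_. A) A"
  by (simp add: decreases_to_def sot_tendsto_intros)

lemma decreases_to_add_const: "decreases_to F A \<Longrightarrow> decreases_to (\<lambda>n. F n + C) (A + C)"
  unfolding decreases_to_def by (auto intro: op_le_add sot_tendsto_intros)

text \<open>Monotonicity squeezes \<open>G s\<close> between \<open>T\<close> and a member of the
  sequence with a larger parameter; the form estimate then carries this over to vectors.\<close>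

lemma sot_tendsto_at_rightI:
  fixes G :: "real \<Rightarrow> 'a::complex_hilbert \<Rightarrow>\<^sub>L 'a"
  assumes mono: "\<And>s t. 0 < s \<Longrightarrow> s \<le> t \<Longrightarrow> G s \<sqsubseteq> G t" and pos: "\<And>s. 0 < s \<Longrightarrow> G s \<in> positive_ops"
    and lim: "sot_tendsto (\<lambda>n. G (1 / real (Suc n))) T sequentially"
  shows "sot_tendsto G T (at_right 0)"
  unfolding sot_tendsto_def
proof
  fix x
  have dec: "decreases_to (\<lambda>n. G (1 / real (Suc n))) T"
    unfolding decreases_to_def
  proof (intro conjI allI lim mono)
    show "1 / real (Suc (Suc k)) \<le> 1 / real (Suc k)" for k by (intro divide_left_mono) auto
  qed auto
  have le: "T \<sqsubseteq> G s" if s: "0 < s" for s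
  proof -
    obtain n where n: "1 / real (Suc n) < s" using nat_approx_posE[OF s] by blast
    have "T \<sqsubseteq> G (1 / real (Suc n))" using decreases_to_lower[OF dec, of n] pos by auto
    also have "G (1 / real (Suc n)) \<sqsubseteq> G s" using n by (intro mono) auto
    finally show ?thesis .
  qed
  have T: "T \<in> positive_ops" using sot_limit_positive[OF _ lim] pos by simp
  define K where "K = norm (G 1) + 1"
  have K: "0 < K" by (simp add: K_def add_nonneg_pos)
  have est: "(norm (G s x - T x))\<^sup>2 \<le> K * (G s x \<bullet> x - T x \<bullet> x)" if "0 < s" "s \<le> 1" for s x
  proof -
    have R: "G s - T \<in> positive_ops" using le[OF that(1)] by (simp add: op_le_def)
    have "(norm ((G s - T) x))\<^sup>2 \<le> K * ((G s - T) x \<bullet> x)"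
    proof (rule positive_norm_square_le[OF R])
      fix y :: 'a
      have "norm (G 1) * (norm y)\<^sup>2 \<le> K * (norm y)\<^sup>2" by (simp add: K_def mult_right_mono)
      then show "(G s - T) y \<bullet> y \<le> K * (norm y)\<^sup>2"
        using positive_ops_nonneg[OF T, of y] op_leD[OF mono[of s 1], of y] inner_le_norm[of "G 1" y] that
        by (simp add: blinfun.bilinear_simps inner_simps)
    qed
    then show ?thesis by (simp add: blinfun.bilinear_simps inner_simps)
  qed
  show "((\<lambda>s. G s x) \<longlongrightarrow> T x) (at_right 0)"
  proof (rule tendstoI)
    fix e :: real assume e: "0 < e"
    have "\<forall>\<^sub>F n in sequentially. G (1 / real (Suc n)) x \<bullet> x < T x \<bullet> x + e\<^sup>2 / K"
      using order_tendstoD(2)[OF sot_tendsto_inner[OF lim]] e K by simp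
    then obtain n where n: "G (1 / real (Suc n)) x \<bullet> x < T x \<bullet> x + e\<^sup>2 / K"
      by (auto dest: eventually_happens)
    show "\<forall>\<^sub>F s in at_right 0. dist (G s x) (T x) < e"
      unfolding eventually_at_right_field
    proof (intro exI[of _ "1 / real (Suc n)"] conjI allI impI)
      fix s assume s: "0 < s" "s < 1 / real (Suc n)"
      have s1: "s \<le> 1" using s by (simp add: field_simps) (smt (verit) of_nat_0_le_iff mult_nonneg_nonneg)
      have "G s x \<bullet> x \<le> G (1 / real (Suc n)) x \<bullet> x" using s by (intro op_leD mono) auto
      then have "G s x \<bullet> x - T x \<bullet> x < e\<^sup>2 / K" using n by linarith
      then have "K * (G s x \<bullet> x - T x \<bullet> x) < e\<^sup>2" using K by (simp add: pos_less_divide_eq mult.commute)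
      then show "dist (G s x) (T x) < e"
        using power_less_imp_less_base[OF order_le_less_trans[OF est[OF s(1) s1, of x]]] e
        by (simp add: dist_norm)
    qed auto
  qed
qed


subsection \<open>Polynomials of an operator\<close>

lemma op_poly_altdef:
  assumes "degree p \<le> n"
  shows "op_poly p A = (\<Sum>i\<le>n. coeff p i *\<^sub>R ((\<lambda>T. A o\<^sub>L T) ^^ i) id_blinfun)"
  unfolding op_poly_def using assms
  by (intro sum.mono_neutral_left) (auto simp: coeff_eq_0)

lemma op_poly_0 [simp]: "op_poly 0 A = 0"
  by (simp add: op_poly_def)

lemma op_poly_pCons: "op_poly (pCons a p) A = a *\<^sub>R id_blinfun + (A o\<^sub>L op_poly p A)"
proof -
  have "op_poly (pCons a p) A
      = (\<Sum>i\<le>Suc (degree p). coeff (pCons a p) i *\<^sub>R ((\<lambda>T. A o\<^sub>L T) ^^ i) id_blinfun)"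
    by (rule op_poly_altdef) (rule degree_pCons_le)
  also have "\<dots> = a *\<^sub>R id_blinfun + (\<Sum>i\<le>degree p. coeff p i *\<^sub>R (A o\<^sub>L ((\<lambda>T. A o\<^sub>L T) ^^ i) id_blinfun))"
    by (subst sum.atMost_Suc_shift) simp
  also have "(\<Sum>i\<le>degree p. coeff p i *\<^sub>R (A o\<^sub>L ((\<lambda>T. A o\<^sub>L T) ^^ i) id_blinfun)) = A o\<^sub>L op_poly p A"
    unfolding op_poly_def
    by (simp add: bounded_bilinear.sum_right[OF bounded_bilinear_blinfun_compose] blinfun_compose_bilinear)
  finally show ?thesis .
qed

lemma op_poly_add: "op_poly (p + q) A = op_poly p A + op_poly q A"
proof -
  define n where "n = max (degree p) (degree q)"
  have "degree p \<le> n" "degree q \<le> n" "degree (p + q) \<le> n"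
    by (auto simp: n_def degree_add_le_max)
  then show ?thesis by (simp add: op_poly_altdef[of _ n] sum.distrib scaleR_add_left)
qed

lemma op_poly_smult: "op_poly (smult c p) A = c *\<^sub>R op_poly p A"
  by (simp add: op_poly_altdef[of "smult c p" "degree p"] degree_smult_le op_poly_def scaleR_sum_right)

lemma op_poly_diff: "op_poly (p - q) A = op_poly p A - op_poly q A"
  using op_poly_add[of p "- q" A] op_poly_smult[of "- 1" q A] by simp

lemma op_poly_mult: "op_poly (p * q) A = op_poly p A o\<^sub>L op_poly q A"
proof (induction p)
  case 0 show ?case by simp
next
  case (pCons a p)
  then show ?case
    by (simp add: mult_pCons_left op_poly_add op_poly_smult op_poly_pCons blinfun_compose_bilinear blinfun_compose_assoc)
qed

lemma op_poly_const [simp]: "op_poly [:c:] A = c *\<^sub>R id_blinfun"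
  by (simp add: op_poly_pCons)

lemma op_poly_X [simp]: "op_poly [:0, 1:] A = A"
  by (simp add: op_poly_pCons)

lemma op_poly_commute:
  assumes "B o\<^sub>L A = A o\<^sub>L B" shows "B o\<^sub>L op_poly p A = op_poly p A o\<^sub>L B"
proof (induction p)
  case 0 show ?case by simp
next
  case (pCons a p)
  have "B o\<^sub>L (A o\<^sub>L op_poly p A) = A o\<^sub>L (B o\<^sub>L op_poly p A)"
    using assms by (metis blinfun_compose_assoc)
  then show ?case using pCons
    by (simp add: op_poly_pCons blinfun_compose_bilinear blinfun_compose_assoc)
qed

lemma op_poly_sa [simp]:
  assumes "A \<in> sa_ops" shows "op_poly p A \<in> sa_ops"
proof (induction p)
  case (pCons a p)
  then show ?case unfolding op_poly_pCons
    by (intro sa_ops_closed sa_ops_compose) (use assms in \<open>auto simp: op_poly_commute\<close>)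
qed simp

lemma op_poly_pcompose_scale: "op_poly (pcompose p [:0, c:]) A = op_poly p (c *\<^sub>R A)"
proof (induction p)
  case (pCons a p)
  have "op_poly [:0, c:] A = c *\<^sub>R A" by (simp add: op_poly_pCons blinfun_compose_bilinear)
  then show ?case
    using pCons by (simp only: pcompose_pCons op_poly_add op_poly_mult op_poly_const op_poly_pCons[of a p])
qed simp

text \<open>\<open>B\<close> maps the range of \<open>P\<close> into itself and agrees with
  \<open>B'\<close> there, so all powers agree there. This localizes the functional calculus to
  spectral subspaces.\<close>

lemma op_poly_compose_cong:
  assumes "P o\<^sub>L B = B o\<^sub>L P" "B o\<^sub>L P = B' o\<^sub>L P"
  shows "op_poly p B o\<^sub>L P = op_poly p B' o\<^sub>L P"
proof (induction p)
  case (pCons a p)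
  have "B o\<^sub>L (op_poly p B o\<^sub>L P) = (B o\<^sub>L P) o\<^sub>L op_poly p B"
    using op_poly_commute[OF assms(1), of p] by (simp add: blinfun_compose_assoc)
  also have "\<dots> = B' o\<^sub>L (P o\<^sub>L op_poly p B)" by (simp only: assms(2) blinfun_compose_assoc)
  also have "\<dots> = B' o\<^sub>L (op_poly p B' o\<^sub>L P)"
    using op_poly_commute[OF assms(1), of p] pCons by simp
  finally show ?case by (simp add: op_poly_pCons blinfun_compose_bilinear blinfun_compose_assoc)
qed simp


subsection \<open>The spectral bound\<close>

text \<open>\<open>real_spectrum\<close> records only real points. Invertibility is therefore tested
  on real factors, where a non-real root \<open>z\<close> contributes the quadratic
  \<open>(t - a)\<^sup>2 + b\<^sup>2\<close>.\<close>

lemma real_poly_linear_or_quadratic_factor: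
  fixes q :: "real poly"
  assumes "0 < degree q"
  shows "(\<exists>r. [:- r, 1:] dvd q) \<or> (\<exists>a b. b \<noteq> 0 \<and> [:a\<^sup>2 + b\<^sup>2, - 2 * a, 1:] dvd q)"
proof -
  define ev where "ev p z = poly (map_poly complex_of_real p) z" for p z
  have ev_pCons: "ev (pCons a p) z = complex_of_real a + z * ev p z" for a p z
    by (simp add: ev_def map_poly_pCons)
  have ev_0: "ev 0 z = 0" for z by (simp add: ev_def)
  have ev_add: "ev (p + r) z = ev p z + ev r z" for p r z
    by (induction p r rule: poly_induct2) (simp_all add: ev_0 ev_pCons algebra_simps)
  have ev_smult: "ev (smult c p) z = complex_of_real c * ev p z" for c p z
    by (induction p) (simp_all add: ev_0 ev_pCons algebra_simps)
  have ev_mult: "ev (p * r) z = ev p z * ev r z" for p r z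
    by (induction p) (simp_all add: ev_0 ev_pCons ev_add ev_smult algebra_simps)
  have "\<not> constant (poly (map_poly complex_of_real q))"
    using assms by (simp add: constant_degree degree_map_poly)
  then obtain z where z: "ev q z = 0" unfolding ev_def using fundamental_theorem_of_algebra by blast
  show ?thesis
  proof (cases "Im z = 0")
    case True
    then have zr: "z = complex_of_real (Re z)" by (simp add: complex_eq_iff)
    have "ev p (complex_of_real t) = complex_of_real (poly p t)" for p t
      by (induction p) (simp_all add: ev_0 ev_pCons)
    then have "poly q (Re z) = 0" using z zr by (metis of_real_eq_0_iff)
    then show ?thesis by (auto simp: poly_eq_0_iff_dvd)
  next
    case False
    \<comment> \<open>The minimal polynomial of \<open>z\<close> over the reals: a real remainder of
      degree below 2 that vanishes at a non-real \<open>z\<close> is zero.\<close>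
    define d where "d = [:(Re z)\<^sup>2 + (Im z)\<^sup>2, - 2 * Re z, 1:]"
    have evd: "ev d z = 0"
      by (simp add: d_def ev_pCons ev_0 complex_eq_iff power2_eq_square algebra_simps)
    have "q = (q div d) * d + q mod d" by simp
    then have "ev (q mod d) z = 0" using z evd by (metis add_0 ev_add ev_mult mult_zero_right)
    moreover have "degree (q mod d) < 2"
      using degree_mod_less[of d q] by (auto simp: d_def)
    then obtain c0 c1 where c: "q mod d = [:c0, c1:]"
      by (metis One_nat_def degree_eq_zeroE less_2_cases_iff pCons_0_0 degree_pCons_eq_if pCons_cases nat.inject)
    ultimately have "complex_of_real c0 + z * complex_of_real c1 = 0" by (simp add: ev_pCons ev_0)
    then have "c1 = 0" "c0 = 0" using False by (auto simp: complex_eq_iff)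
    then have "d dvd q" using c by (simp add: mod_eq_0_iff_dvd)
    then show ?thesis using False unfolding d_def by blast
  qed
qed

text \<open>Induction along the factorization: a linear factor is invertible because its root is
  outside the spectrum, a quadratic one because it becomes a square plus a positive multiple of the
  identity.\<close>

lemma op_poly_invertible:
  fixes A :: "'a::complex_hilbert \<Rightarrow>\<^sub>L 'a"
  assumes A: "A \<in> sa_ops" and "q \<noteq> 0" "\<And>t. t \<in> real_spectrum A \<Longrightarrow> poly q t \<noteq> 0"
  shows "op_invertible (op_poly q A)"
  using assms(2,3)
proof (induction "degree q" arbitrary: q rule: less_induct)
  case less
  show ?case
  proof (cases "degree q = 0")
    case True
    then obtain c where "q = [:c:]" by (rule degree_eq_zeroE)
    moreover have "op_invertible (id_blinfun :: 'a \<Rightarrow>\<^sub>L 'a)"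
      unfolding op_invertible_def by (intro bexI[of _ id_blinfun]) auto
    ultimately show ?thesis using less.prems by (simp add: op_invertible_scaleR)
  next
    case False
    have step: "op_invertible (op_poly q A)"
      if "d dvd q" "0 < degree d" "op_invertible (op_poly d A)" for d
    proof -
      obtain k where k: "q = d * k" using \<open>d dvd q\<close> by blast
      have "d \<noteq> 0" "k \<noteq> 0" using k less.prems by auto
      then have "degree k < degree q" using k that by (simp add: degree_mult_eq)
      then have "op_invertible (op_poly k A)"
        using less.hyps[of k] less.prems k \<open>k \<noteq> 0\<close> by auto
      then show ?thesis using that by (simp add: k op_poly_mult op_invertible_compose)
    qed
    consider r where "[:- r, 1:] dvd q" | a b where "b \<noteq> 0" "[:a\<^sup>2 + b\<^sup>2, - 2 * a, 1:] dvd q"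
      using real_poly_linear_or_quadratic_factor[of q] False by auto
    then show ?thesis
    proof cases
      case 1
      then have "poly q r = 0" by (simp add: poly_eq_0_iff_dvd)
      then have "op_invertible (A - r *\<^sub>R id_blinfun)"
        using less.prems by (auto simp: real_spectrum_def)
      then show ?thesis using 1 by (intro step[of "[:- r, 1:]"]) (auto simp: op_poly_pCons)
    next
      case 2
      define D where "D = A - a *\<^sub>R id_blinfun"
      have D: "D \<in> sa_ops" using A by (auto simp: D_def)
      have eq: "op_poly [:a\<^sup>2 + b\<^sup>2, - 2 * a, 1:] A = (D o\<^sub>L D) + b\<^sup>2 *\<^sub>R id_blinfun"
        by (rule blinfun_eqI)
          (simp add: op_poly_pCons D_def blinfun.bilinear_simps algebra_simps power2_eq_square scaleR_2[symmetric])
      have "op_invertible ((D o\<^sub>L D) + b\<^sup>2 *\<^sub>R id_blinfun)"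
        using positive_inv_add[of "D o\<^sub>L D" "b\<^sup>2"] D \<open>b \<noteq> 0\<close> by (intro positive_inv_opsD) auto
      then show ?thesis using 2 eq by (intro step[of "[:a\<^sup>2 + b\<^sup>2, - 2 * a, 1:]"]) auto
    qed
  qed
qed

text \<open>If invertible, this positive operator would be coercive, and the coercivity constant
  would improve the bound \<open>norm S\<close>.\<close>

lemma norm_square_minus_square_not_invertible:
  assumes S: "S \<in> sa_ops" "S \<noteq> 0"
  shows "\<not> op_invertible ((norm S)\<^sup>2 *\<^sub>R id_blinfun - (S o\<^sub>L S))" (is "\<not> op_invertible ?R")
proof
  assume inv: "op_invertible ?R"
  have R: "?R x \<bullet> x = (norm S)\<^sup>2 * (norm x)\<^sup>2 - (norm (S x))\<^sup>2" for x
    unfolding power2_norm_eq_inner sa_ops_sym[OF S(1), of x "S x"]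
    by (simp add: blinfun.bilinear_simps inner_simps inner_commute)
  have nS: "(norm (S x))\<^sup>2 \<le> (norm S)\<^sup>2 * (norm x)\<^sup>2" for x
    using power_mono[OF norm_blinfun[of S x], of 2] by (simp add: power_mult_distrib)
  have "?R \<in> positive_ops"
    using S(1) sa_ops_compose[of S S] nS R by (intro positive_opsI) auto
  then have "?R \<in> positive_inv_ops" using inv by (rule positive_inv_opsI)
  then obtain c where c: "0 < c" "\<And>x. c * (norm x)\<^sup>2 \<le> ?R x \<bullet> x"
    by (rule positive_inv_coercive) blast
  have le: "(norm (S x))\<^sup>2 \<le> ((norm S)\<^sup>2 - c) * (norm x)\<^sup>2" for x
    using c(2)[of x] by (simp add: R algebra_simps)
  obtain x where x: "S x \<noteq> 0" using S(2) by (metis blinfun_eqI zero_blinfun.rep_eq)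
  then have "x \<noteq> 0" by auto
  have "0 < (norm (S x))\<^sup>2" using x by simp
  then have "0 < ((norm S)\<^sup>2 - c) * (norm x)\<^sup>2" using le[of x] by linarith
  then have pos: "0 < (norm S)\<^sup>2 - c" using \<open>x \<noteq> 0\<close> by (simp add: zero_less_mult_iff)
  have "norm (S x) \<le> sqrt ((norm S)\<^sup>2 - c) * norm x" for x
    using real_sqrt_le_mono[OF le[of x]] unfolding real_sqrt_mult by simp
  then have "norm S \<le> sqrt ((norm S)\<^sup>2 - c)" using pos by (intro norm_blinfun_bound) auto
  from power_mono[OF this, of 2] have "(norm S)\<^sup>2 \<le> (norm S)\<^sup>2 - c" using pos by simp
  then show False using c(1) by simp
qed

text \<open>The nonzero \<open>S\<close> witnesses that the space is not trivial. Were the spectrum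
  empty, \<open>q\<close> would have no root on it and \<open>op_poly q A\<close> would be
  invertible.\<close>

lemma real_spectrum_nonempty:
  assumes A: "A \<in> sa_ops" and S: "(S :: 'a::complex_hilbert \<Rightarrow>\<^sub>L 'a) \<noteq> 0"
  shows "real_spectrum (A :: 'a \<Rightarrow>\<^sub>L 'a) \<noteq> {}"
proof (cases "A = 0")
  case True
  have "\<not> op_invertible (0 :: 'a \<Rightarrow>\<^sub>L 'a)"
  proof
    assume "op_invertible (0 :: 'a \<Rightarrow>\<^sub>L 'a)"
    then have "(0 :: 'a \<Rightarrow>\<^sub>L 'a) = id_blinfun" unfolding op_invertible_def by auto
    then show False using S by (metis blinfun_compose_id(1) blinfun_compose_zero(1))
  qed
  then have "0 \<in> real_spectrum A" using True by (simp add: real_spectrum_def)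
  then show ?thesis by blast
next
  case False
  define q where "q = [:(norm A)\<^sup>2:] - [:0, 1:] * [:0, 1:]"
  have "op_poly q A = (norm A)\<^sup>2 *\<^sub>R id_blinfun - (A o\<^sub>L A)"
    unfolding q_def op_poly_diff op_poly_mult by simp
  moreover have "q \<noteq> 0" by (simp add: q_def)
  ultimately show ?thesis
    using op_poly_invertible[OF A, of q] norm_square_minus_square_not_invertible[OF A False] by auto
qed

text \<open>With \<open>S = op_poly p A\<close>, the polynomial \<open>q\<close> evaluates at
  \<open>A\<close> to a non-invertible operator, so \<open>q\<close> vanishes at a spectral point
  and \<open>norm S\<close> is a value of \<open>\<bar>poly p t\<bar>\<close>. That
  \<open>cfc\<close> is well defined rests on this bound.\<close>

lemma op_poly_norm_le:
  assumes A: "A \<in> sa_ops" and c: "0 \<le> c" and le: "\<And>t. t \<in> real_spectrum A \<Longrightarrow> \<bar>poly p t\<bar> \<le> c"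
  shows "norm (op_poly p A) \<le> c"
proof (cases "op_poly p A = 0")
  case False
  define S where "S = op_poly p A"
  have S: "S \<in> sa_ops" "S \<noteq> 0" using A False by (auto simp: S_def)
  define q where "q = [:(norm S)\<^sup>2:] - p * p"
  have "op_poly q A = (norm S)\<^sup>2 *\<^sub>R id_blinfun - (S o\<^sub>L S)"
    unfolding q_def op_poly_diff op_poly_mult by (simp add: S_def)
  then have ninv: "\<not> op_invertible (op_poly q A)"
    using norm_square_minus_square_not_invertible[OF S] by simp
  obtain t where t: "t \<in> real_spectrum A" "poly q t = 0"
  \<comment> \<open>A zero \<open>q\<close> vanishes everywhere, so any spectral point will do; one
    exists because \<open>S\<close> is not zero.\<close>
  proof (cases "q = 0")
    case True
    then show ?thesis using that real_spectrum_nonempty[OF A S(2)] by auto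
  next
    case False
    then show ?thesis using that op_poly_invertible[OF A False] ninv by auto
  qed
  have "(norm S)\<^sup>2 = (poly p t)\<^sup>2" using t(2) by (simp add: q_def power2_eq_square)
  then have "norm S = \<bar>poly p t\<bar>" by (metis abs_norm_cancel power2_eq_iff abs_minus_cancel)
  then show ?thesis using le[OF t(1)] by (simp add: S_def)
qed (use c in simp)


subsection \<open>Continuous functional calculus\<close>

text \<open>An order interval stands in for the spectrum: functions are taken continuous on all of
  \<open>{a..b}\<close>, where Weierstrass approximation applies.\<close>

definition op_between :: "real \<Rightarrow> ('a::complex_hilbert \<Rightarrow>\<^sub>L 'a) \<Rightarrow> real \<Rightarrow> bool" where
  "op_between a A b \<longleftrightarrow> A \<in> sa_ops \<and> a *\<^sub>R id_blinfun \<sqsubseteq> A \<and> A \<sqsubseteq> b *\<^sub>R id_blinfun"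

lemma op_between_sa: "op_between a A b \<Longrightarrow> A \<in> sa_ops"
  by (simp add: op_between_def)

lemma op_between_norm: "A \<in> sa_ops \<Longrightarrow> op_between (- norm A) A (norm A)"
  using op_le_norm[of A "norm A"] op_le_norm[of "- A" "norm A"]
  by (auto simp: op_between_def op_le_def add.commute)

lemma op_between_positive: "A \<in> positive_ops \<Longrightarrow> op_between 0 A (norm A)"
  using op_le_norm[of A "norm A"] by (auto simp: op_between_def op_le_def)

lemma op_between_weaken:
  assumes "op_between a A b" "a' \<le> a" "b \<le> b'" shows "op_between a' A b'"
proof -
  have "a' *\<^sub>R id_blinfun \<sqsubseteq> a *\<^sub>R id_blinfun" "b *\<^sub>R id_blinfun \<sqsubseteq> b' *\<^sub>R id_blinfun"
    using assms by (auto intro: op_le_scaleR_left)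
  then show ?thesis using assms(1) unfolding op_between_def by (meson op_le_trans)
qed

lemma positive_inv_op_between:
  assumes "A \<in> positive_inv_ops" obtains c M where "0 < c" "c \<le> M" "op_between c A M"
proof -
  obtain c where c: "0 < c" "c *\<^sub>R id_blinfun \<sqsubseteq> A" using assms positive_inv_iff by blast
  have "op_between c A (max c (norm A))"
    using c assms op_le_norm[of A "max c (norm A)"] by (auto simp: op_between_def)
  then show ?thesis using that[of c "max c (norm A)"] c by auto
qed

text \<open>For \<open>t\<close> outside the interval, \<open>A - t\<close> or \<open>t - A\<close>
  is coercive, the constant being the distance to the interval.\<close>

lemma real_spectrum_subset:
  assumes "op_between a A b" shows "real_spectrum A \<subseteq> {a..b}"
proof
  fix t assume t: "t \<in> real_spectrum A"
  have A: "A \<in> sa_ops" "a *\<^sub>R id_blinfun \<sqsubseteq> A" "A \<sqsubseteq> b *\<^sub>R id_blinfun" using assms by (auto simp: op_between_def)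
  have q: "a * (norm x)\<^sup>2 \<le> A x \<bullet> x" "A x \<bullet> x \<le> b * (norm x)\<^sup>2" for x
    using op_leD[OF A(2), of x] op_leD[OF A(3), of x] by (auto simp: blinfun.bilinear_simps power2_norm_eq_inner)
  show "t \<in> {a..b}"
  proof (rule ccontr)
    assume "t \<notin> {a..b}"
    then consider "t < a" | "b < t" by force
    then show False
    proof cases
      case 1
      then have "op_invertible (A - t *\<^sub>R id_blinfun)"
        using q(1) A by (intro coercive_imp_invertible[of _ "a - t"])
          (auto simp: blinfun.bilinear_simps inner_simps power2_norm_eq_inner algebra_simps)
      then show False using t by (simp add: real_spectrum_def)
    next
      case 2
      then have "op_invertible (t *\<^sub>R id_blinfun - A)"
        using q(2) A by (intro coercive_imp_invertible[of _ "t - b"])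
          (auto simp: blinfun.bilinear_simps inner_simps power2_norm_eq_inner algebra_simps)
      from op_invertible_scaleR[OF this, of "- 1"] show False using t by (simp add: real_spectrum_def)
    qed
  qed
qed

lemma uniform_poly_approximation:
  fixes f :: "real \<Rightarrow> real"
  assumes "continuous_on {a..b} f"
  obtains p :: "nat \<Rightarrow> real poly" where "uniform_limit {a..b} (\<lambda>n t. poly (p n) t) f sequentially"
proof -
  have ex: "\<exists>p. \<forall>x\<in>{a..b}. \<bar>f x - poly p x\<bar> < e" if e: "0 < e" for e
  proof -
    obtain g where g: "real_polynomial_function g" "\<And>x. x \<in> {a..b} \<Longrightarrow> \<bar>f x - g x\<bar> < e"
      using Stone_Weierstrass_real_polynomial_function[OF compact_Icc assms e] by blast
    obtain c n where "g = (\<lambda>x. \<Sum>i\<le>n. c i * x ^ i)" using g(1) real_polynomial_function_iff_sum by blast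
    then have "poly (\<Sum>i\<le>n. monom (c i) i) x = g x" for x by (simp add: poly_sum poly_monom)
    then show ?thesis using g(2) by (intro exI[of _ "\<Sum>i\<le>n. monom (c i) i"]) auto
  qed
  have "\<forall>n. \<exists>p. \<forall>x\<in>{a..b}. \<bar>f x - poly p x\<bar> < 1 / real (Suc n)" by (intro allI ex) simp
  then obtain p where p: "\<And>n x. x \<in> {a..b} \<Longrightarrow> \<bar>f x - poly (p n) x\<bar> < 1 / real (Suc n)" by metis
  have "uniform_limit {a..b} (\<lambda>n t. poly (p n) t) f sequentially"
  proof (rule uniform_limitI)
    fix e :: real assume "0 < e"
    then have "\<forall>\<^sub>F n in sequentially. 1 / real (Suc n) < e"
      using order_tendstoD(2)[OF LIMSEQ_Suc[OF lim_1_over_n]] by auto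
    then show "\<forall>\<^sub>F n in sequentially. \<forall>x\<in>{a..b}. dist (poly (p n) x) (f x) < e"
    proof eventually_elim
      case (elim n)
      show ?case
      proof
        fix x assume "x \<in> {a..b}"
        from p[OF this, of n] elim show "dist (poly (p n) x) (f x) < e"
          unfolding dist_real_def abs_minus_commute[of _ "f x"] by (rule less_trans)
      qed
    qed
  qed
  then show ?thesis by (rule that)
qed

text \<open>With \<open>p = q\<close> this gives the Cauchy property, with different sequences the
  equality of their limits.\<close>

lemma op_poly_uniform_close:
  assumes A: "A \<in> sa_ops" and "uniform_limit (real_spectrum A) (\<lambda>n t. poly (p n) t) f sequentially"
    and "uniform_limit (real_spectrum A) (\<lambda>n t. poly (q n) t) f sequentially" and e: "0 < e"
  shows "\<exists>N. \<forall>m\<ge>N. \<forall>n\<ge>N. norm (op_poly (p m) A - op_poly (q n) A) < e"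
proof -
  have "\<forall>\<^sub>F n in sequentially. \<forall>t\<in>real_spectrum A. dist (poly (p n) t) (f t) < e / 4"
    "\<forall>\<^sub>F n in sequentially. \<forall>t\<in>real_spectrum A. dist (poly (q n) t) (f t) < e / 4"
    using uniform_limitD[OF assms(2), of "e / 4"] uniform_limitD[OF assms(3), of "e / 4"] e by simp_all
  then have "\<forall>\<^sub>F n in sequentially. (\<forall>t\<in>real_spectrum A. dist (poly (p n) t) (f t) < e / 4) \<and>
      (\<forall>t\<in>real_spectrum A. dist (poly (q n) t) (f t) < e / 4)" by (rule eventually_conj)
  then obtain N where N: "\<And>n t. N \<le> n \<Longrightarrow> t \<in> real_spectrum A \<Longrightarrow>
      dist (poly (p n) t) (f t) < e / 4 \<and> dist (poly (q n) t) (f t) < e / 4"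
    unfolding eventually_sequentially by blast
  have "norm (op_poly (p m) A - op_poly (q n) A) < e" if mn: "N \<le> m" "N \<le> n" for m n
  proof -
    have "norm (op_poly (p m - q n) A) \<le> e / 2"
    proof (rule op_poly_norm_le[OF A])
      fix t assume t: "t \<in> real_spectrum A"
      have "dist (poly (p m) t) (f t) < e / 4" "dist (poly (q n) t) (f t) < e / 4" using N t mn by auto
      then show "\<bar>poly (p m - q n) t\<bar> \<le> e / 2"
        unfolding dist_real_def poly_diff by linarith
    qed (use e in simp)
    then show ?thesis using e by (simp add: op_poly_diff)
  qed
  then show ?thesis by blast
qed

text \<open>The description in \<open>cfc\<close> quantifies over all approximating sequences, so
  uniqueness requires at least one; Weierstrass approximation on \<open>{a..b}\<close> provides
  it.\<close>

lemma cfc_tendsto_spectrum: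
  assumes A: "op_between a A b" and f: "continuous_on {a..b} f"
    and p: "uniform_limit (real_spectrum A) (\<lambda>n t. poly (p n) t) f sequentially"
  shows "(\<lambda>n. op_poly (p n) A) \<longlonglongrightarrow> cfc f A"
proof -
  have sa: "A \<in> sa_ops" using A by (rule op_between_sa)
  obtain q :: "nat \<Rightarrow> real poly" where "uniform_limit {a..b} (\<lambda>n t. poly (q n) t) f sequentially"
    using uniform_poly_approximation[OF f] .
  then have q: "uniform_limit (real_spectrum A) (\<lambda>n t. poly (q n) t) f sequentially"
    by (rule uniform_limit_on_subset[OF _ real_spectrum_subset[OF A]])
  have "Cauchy (\<lambda>n. op_poly (q n) A)"
    unfolding Cauchy_def dist_norm using op_poly_uniform_close[OF sa q q] by blast
  then obtain T where T: "(\<lambda>n. op_poly (q n) A) \<longlonglongrightarrow> T" using Cauchy_convergent convergent_def by blast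
  have all: "(\<lambda>n. op_poly (r n) A) \<longlonglongrightarrow> T"
    if r: "uniform_limit (real_spectrum A) (\<lambda>n t. poly (r n) t) f sequentially" for r
  proof -
    have "(\<lambda>n. op_poly (r n) A - op_poly (q n) A) \<longlonglongrightarrow> 0"
      by (rule LIMSEQ_I) (use op_poly_uniform_close[OF sa r q] in force)
    from tendsto_add[OF this T] show ?thesis by simp
  qed
  have "cfc f A = T" unfolding cfc_def
  proof (rule the_equality)
    fix T' assume "\<forall>p. uniform_limit (real_spectrum A) (\<lambda>n t. poly (p n) t) f sequentially \<longrightarrow>
      (\<lambda>n. op_poly (p n) A) \<longlonglongrightarrow> T'"
    then show "T' = T" using q T LIMSEQ_unique by blast
  qed (use all in blast)
  then show ?thesis using all[OF p] by simp
qed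

lemma cfc_tendsto:
  assumes "op_between a A b" "continuous_on {a..b} f"
    and "uniform_limit {a..b} (\<lambda>n t. poly (p n) t) f sequentially"
  shows "(\<lambda>n. op_poly (p n) A) \<longlonglongrightarrow> cfc f A"
  by (rule cfc_tendsto_spectrum[OF assms(1,2)])
    (rule uniform_limit_on_subset[OF assms(3) real_spectrum_subset[OF assms(1)]])

lemma cfc_eqI:
  assumes "op_between a A b" "continuous_on {a..b} f"
    and "uniform_limit {a..b} (\<lambda>n t. poly (p n) t) f sequentially" "(\<lambda>n. op_poly (p n) A) \<longlonglongrightarrow> T"
  shows "cfc f A = T"
  using cfc_tendsto[OF assms(1-3)] assms(4) LIMSEQ_unique by blast

lemma cfc_cong:
  assumes A: "op_between a A b" and f: "continuous_on {a..b} f" and eq: "\<And>t. t \<in> {a..b} \<Longrightarrow> f t = g t"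
  shows "cfc f A = cfc g A"
proof -
  obtain p :: "nat \<Rightarrow> real poly" where p: "uniform_limit {a..b} (\<lambda>n t. poly (p n) t) f sequentially"
    using uniform_poly_approximation[OF f] .
  have g: "continuous_on {a..b} g" using continuous_on_eq[OF f eq] .
  have "uniform_limit {a..b} (\<lambda>n t. poly (p n) t) g sequentially"
    using p uniform_limit_cong'[of "{a..b}" "\<lambda>n t. poly (p n) t" "\<lambda>n t. poly (p n) t" f g] eq by simp
  then show ?thesis using cfc_eqI[OF A f p] cfc_tendsto[OF A g] by blast
qed

lemma cfc_sa:
  assumes A: "op_between a A b" and f: "continuous_on {a..b} f"
  shows "cfc f A \<in> sa_ops"
proof -
  obtain p :: "nat \<Rightarrow> real poly" where p: "uniform_limit {a..b} (\<lambda>n t. poly (p n) t) f sequentially"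
    using uniform_poly_approximation[OF f] .
  show ?thesis
    by (rule sot_limit_sa[OF trivial_limit_sequentially norm_tendsto_imp_sot[OF cfc_tendsto[OF A f p]]])
      (use op_between_sa[OF A] in simp)
qed

lemma cfc_commute:
  assumes A: "op_between a A b" and f: "continuous_on {a..b} f" and B: "B o\<^sub>L A = A o\<^sub>L B"
  shows "B o\<^sub>L cfc f A = cfc f A o\<^sub>L B"
proof -
  obtain p :: "nat \<Rightarrow> real poly" where p: "uniform_limit {a..b} (\<lambda>n t. poly (p n) t) f sequentially"
    using uniform_poly_approximation[OF f] .
  note lim = cfc_tendsto[OF A f p]
  have "(\<lambda>n. B o\<^sub>L op_poly (p n) A) \<longlonglongrightarrow> (B o\<^sub>L cfc f A)" "(\<lambda>n. op_poly (p n) A o\<^sub>L B) \<longlonglongrightarrow> (cfc f A o\<^sub>L B)"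
    by (intro bounded_bilinear.tendsto[OF bounded_bilinear_blinfun_compose] tendsto_const lim)+
  then show ?thesis using op_poly_commute[OF B] LIMSEQ_unique by auto
qed

lemma cfc_compose_cong:
  assumes "op_between a B b" "op_between a B' b" and f: "continuous_on {a..b} f"
    and P: "P o\<^sub>L B = B o\<^sub>L P" "B o\<^sub>L P = B' o\<^sub>L P"
  shows "cfc f B o\<^sub>L P = cfc f B' o\<^sub>L P"
proof -
  obtain p :: "nat \<Rightarrow> real poly" where p: "uniform_limit {a..b} (\<lambda>n t. poly (p n) t) f sequentially"
    using uniform_poly_approximation[OF f] .
  have "(\<lambda>n. op_poly (p n) B o\<^sub>L P) \<longlonglongrightarrow> (cfc f B o\<^sub>L P)" "(\<lambda>n. op_poly (p n) B' o\<^sub>L P) \<longlonglongrightarrow> (cfc f B' o\<^sub>L P)"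
    by (intro bounded_bilinear.tendsto[OF bounded_bilinear_blinfun_compose] tendsto_const cfc_tendsto[OF _ f p] assms)+
  then show ?thesis using op_poly_compose_cong[OF P] LIMSEQ_unique by auto
qed

lemma cfc_poly: "op_between a A b \<Longrightarrow> cfc (poly p) A = op_poly p A"
  by (rule cfc_eqI[where p = "\<lambda>_. p"]) (auto intro!: continuous_intros uniform_limit_const)

lemma cfc_const: "op_between a A b \<Longrightarrow> cfc (\<lambda>_. c) A = c *\<^sub>R id_blinfun"
  using cfc_poly[of a A b "[:c:]"] by (simp add: fun_eq_iff[symmetric] cong: cfc_cong)

lemma cfc_id: "op_between a A b \<Longrightarrow> cfc (\<lambda>t. t) A = A"
proof -
  assume "op_between a A b"
  moreover have "poly [:0, 1:] = (\<lambda>t :: real. t)" by (simp add: fun_eq_iff)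
  ultimately show ?thesis using cfc_poly[of a A b "[:0, 1:]"] by simp
qed

lemma cfc_diff:
  assumes A: "op_between a A b" and f: "continuous_on {a..b} f" and g: "continuous_on {a..b} g"
  shows "cfc (\<lambda>t. f t - g t) A = cfc f A - cfc g A"
proof -
  obtain p :: "nat \<Rightarrow> real poly" where p: "uniform_limit {a..b} (\<lambda>n t. poly (p n) t) f sequentially"
    using uniform_poly_approximation[OF f] .
  obtain q :: "nat \<Rightarrow> real poly" where q: "uniform_limit {a..b} (\<lambda>n t. poly (q n) t) g sequentially"
    using uniform_poly_approximation[OF g] .
  show ?thesis
  proof (rule cfc_eqI[OF A, where p = "\<lambda>n. p n - q n"])
    show "(\<lambda>n. op_poly (p n - q n) A) \<longlonglongrightarrow> cfc f A - cfc g A"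
      unfolding op_poly_diff by (intro tendsto_intros cfc_tendsto[OF A] f g p q)
    show "uniform_limit {a..b} (\<lambda>n t. poly (p n - q n) t) (\<lambda>t. f t - g t) sequentially"
      unfolding poly_diff by (intro uniform_limit_intros p q)
  qed (intro continuous_intros f g)
qed

lemma cfc_mult:
  assumes A: "op_between a A b" and f: "continuous_on {a..b} f" and g: "continuous_on {a..b} g"
  shows "cfc (\<lambda>t. f t * g t) A = cfc f A o\<^sub>L cfc g A"
proof -
  obtain p :: "nat \<Rightarrow> real poly" where p: "uniform_limit {a..b} (\<lambda>n t. poly (p n) t) f sequentially"
    using uniform_poly_approximation[OF f] .
  obtain q :: "nat \<Rightarrow> real poly" where q: "uniform_limit {a..b} (\<lambda>n t. poly (q n) t) g sequentially"
    using uniform_poly_approximation[OF g] .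
  show ?thesis
  proof (rule cfc_eqI[OF A, where p = "\<lambda>n. p n * q n"])
    show "(\<lambda>n. op_poly (p n * q n) A) \<longlonglongrightarrow> (cfc f A o\<^sub>L cfc g A)"
      unfolding op_poly_mult
      by (intro bounded_bilinear.tendsto[OF bounded_bilinear_blinfun_compose] cfc_tendsto[OF A] f g p q)
    show "uniform_limit {a..b} (\<lambda>n t. poly (p n * q n) t) (\<lambda>t. f t * g t) sequentially"
      unfolding poly_mult
      by (intro uniform_lim_mult p q compact_imp_bounded compact_continuous_image f g compact_Icc)
  qed (intro continuous_intros f g)
qed

lemma cfc_scaleR:
  assumes A: "op_between a A b" and f: "continuous_on {a..b} f"
  shows "cfc (\<lambda>t. c * f t) A = c *\<^sub>R cfc f A"
  using cfc_mult[OF A continuous_on_const f, of c] by (simp add: cfc_const[OF A] blinfun_compose_bilinear)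

text \<open>The square root of \<open>f\<close> is continuous too, so \<open>cfc f A\<close> is the
  square of a self-adjoint operator.\<close>

lemma cfc_nonneg:
  assumes A: "op_between a A b" and f: "continuous_on {a..b} f" and pos: "\<And>t. t \<in> {a..b} \<Longrightarrow> 0 \<le> f t"
  shows "cfc f A \<in> positive_ops"
proof -
  have s: "continuous_on {a..b} (\<lambda>t. sqrt (f t))" by (intro continuous_intros f)
  have "cfc f A = cfc (\<lambda>t. sqrt (f t) * sqrt (f t)) A"
    by (rule cfc_cong[OF A f]) (use pos in simp)
  also have "\<dots> = cfc (\<lambda>t. sqrt (f t)) A o\<^sub>L cfc (\<lambda>t. sqrt (f t)) A" by (rule cfc_mult[OF A s s])
  finally show ?thesis using cfc_sa[OF A s] by simp
qed

lemma cfc_mono: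
  assumes "op_between a A b" "continuous_on {a..b} f" "continuous_on {a..b} g"
    and "\<And>t. t \<in> {a..b} \<Longrightarrow> f t \<le> g t"
  shows "cfc f A \<sqsubseteq> cfc g A"
  using cfc_nonneg[OF assms(1) continuous_on_diff[OF assms(3,2)]] assms
  by (simp add: op_le_def cfc_diff)

lemma op_between_scaleR: "op_between a A b \<Longrightarrow> 0 \<le> c \<Longrightarrow> op_between (c * a) (c *\<^sub>R A) (c * b)"
  unfolding op_between_def using op_le_scaleR[of _ _ c] by (metis sa_ops_closed(6) scaleR_scaleR)

lemma cfc_scaleR_arg:
  assumes A: "op_between a A b" and c: "0 < c" and f: "continuous_on {c * a..c * b} f"
  shows "cfc f (c *\<^sub>R A) = cfc (\<lambda>t. f (c * t)) A"
proof -
  obtain p :: "nat \<Rightarrow> real poly" where p: "uniform_limit {c * a..c * b} (\<lambda>n t. poly (p n) t) f sequentially"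
    using uniform_poly_approximation[OF f] .
  have img: "(\<lambda>t. c * t) ` {a..b} \<subseteq> {c * a..c * b}" using c by (auto intro: mult_left_mono)
  have "continuous_on {a..b} (\<lambda>t. f (c * t))"
    by (rule continuous_on_compose2[OF f _ img]) (intro continuous_intros)
  moreover have "uniform_limit {a..b} (\<lambda>n t. poly (pcompose (p n) [:0, c:]) t) (\<lambda>t. f (c * t)) sequentially"
    using uniform_limit_compose'[OF p, of "\<lambda>t. c * t" "{a..b}"] img
    by (auto simp: poly_pcompose mult.commute image_subset_iff)
  moreover have "(\<lambda>n. op_poly (pcompose (p n) [:0, c:]) A) \<longlonglongrightarrow> cfc f (c *\<^sub>R A)"
    unfolding op_poly_pcompose_scale using cfc_tendsto[OF op_between_scaleR[OF A] f p] c by simp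
  ultimately show ?thesis using cfc_eqI[OF A] by metis
qed


lemma op_between_scaled_id: "op_between t (t *\<^sub>R id_blinfun) t"
  by (simp add: op_between_def)

text \<open>The enclosing interval shrinks to the point \<open>t\<close>, on which every
  \<open>g\<close> is constant.\<close>

lemma cfc_scaled_id: "cfc g (t *\<^sub>R (id_blinfun :: 'a::complex_hilbert \<Rightarrow>\<^sub>L 'a)) = g t *\<^sub>R id_blinfun"
proof -
  have bt: "op_between t (t *\<^sub>R (id_blinfun :: 'a \<Rightarrow>\<^sub>L 'a)) t" by (rule op_between_scaled_id)
  have "cfc g (t *\<^sub>R (id_blinfun :: 'a \<Rightarrow>\<^sub>L 'a)) = cfc (\<lambda>_. g t) (t *\<^sub>R id_blinfun)"
    by (rule cfc_cong[OF bt]) (auto simp: continuous_on_sing)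
  then show ?thesis using cfc_const[OF bt] by simp
qed


subsection \<open>Square roots and spectral projections\<close>

lemma op_powr_id: "op_powr id_blinfun r = id_blinfun"
  using cfc_scaled_id[of "\<lambda>t. t powr r" 1] by (simp add: op_powr_def)

text \<open>Invertibility puts the spectrum into an interval \<open>{c..M}\<close> with
  \<open>0 < c\<close>, where all powers are continuous and bounded away from 0.\<close>

lemma op_powr_half:
  assumes "A \<in> positive_inv_ops"
  shows "op_powr A (1/2) \<in> positive_inv_ops" "op_powr A (-1/2) \<in> positive_inv_ops"
    "op_powr A (1/2) o\<^sub>L op_powr A (1/2) = A"
    "op_powr A (1/2) o\<^sub>L op_powr A (-1/2) = id_blinfun"
    "op_powr A (-1/2) o\<^sub>L op_powr A (1/2) = id_blinfun"
proof -
  obtain c M where c: "0 < c" "c \<le> M" and A: "op_between c A M" using positive_inv_op_between[OF assms] .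
  have cont: "continuous_on {c..M} (\<lambda>t. t powr r)" for r
    using c by (intro continuous_intros) auto
  have mult: "op_powr A r o\<^sub>L op_powr A s = cfc (\<lambda>t. t powr (r + s)) A" for r s
    unfolding op_powr_def using cfc_mult[OF A cont cont, of r s] by (simp add: powr_add)
  have one: "cfc (\<lambda>t. t powr 0) A = id_blinfun"
    using cfc_cong[OF A cont, of 0 "\<lambda>_. 1"] c cfc_const[OF A, of 1] by auto
  have "cfc (\<lambda>t. t powr 1) A = A"
    using cfc_cong[OF A cont, of 1 "\<lambda>t. t"] c cfc_id[OF A] by auto
  then show "op_powr A (1/2) o\<^sub>L op_powr A (1/2) = A" using mult by simp
  show "op_powr A (1/2) o\<^sub>L op_powr A (-1/2) = id_blinfun" "op_powr A (-1/2) o\<^sub>L op_powr A (1/2) = id_blinfun"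
    using mult[of "1/2" "-1/2"] mult[of "-1/2" "1/2"] one by simp_all
  have "op_powr A r \<in> positive_inv_ops" if d: "0 < d" "\<And>t. t \<in> {c..M} \<Longrightarrow> d \<le> t powr r" for r d
    unfolding positive_inv_iff
  proof (intro conjI exI[of _ d])
    show "op_powr A r \<in> sa_ops" unfolding op_powr_def by (rule cfc_sa[OF A cont])
    show "d *\<^sub>R id_blinfun \<sqsubseteq> op_powr A r"
      using cfc_mono[OF A continuous_on_const cont, of d r] d cfc_const[OF A, of d] by (simp add: op_powr_def)
  qed (use d in auto)
  note bounded_below = this
  show "op_powr A (1/2) \<in> positive_inv_ops"
    using c by (intro bounded_below[of "c powr (1/2)"] powr_mono2) auto
  show "op_powr A (-1/2) \<in> positive_inv_ops"
    using c by (intro bounded_below[of "M powr (-1/2)"] powr_mono2') auto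
qed

lemma positive_inv_inverse:
  assumes "A \<in> positive_inv_ops"
  obtains D where "D \<in> positive_inv_ops" "A o\<^sub>L D = id_blinfun" "D o\<^sub>L A = id_blinfun"
proof -
  define S R where "S = op_powr A (1/2)" and "R = op_powr A (-1/2)"
  note SR = op_powr_half[OF assms, folded S_def R_def]
  have "R o\<^sub>L R \<in> positive_ops" using SR(2) by simp
  moreover have AD: "A o\<^sub>L (R o\<^sub>L R) = id_blinfun" "(R o\<^sub>L R) o\<^sub>L A = id_blinfun"
    using SR(3-5) by (metis blinfun_compose_assoc blinfun_compose_id(2))+
  moreover have "op_invertible (R o\<^sub>L R)"
    using positive_inv_opsD[OF SR(2)] by (simp add: op_invertible_compose)
  ultimately show ?thesis using that positive_inv_opsI by blast
qed

text \<open>The projection is the strong limit of \<open>(1 - C)\<^sup>n\<close> with \<open>C\<close> a multiple of \<open>(B - t)\<^sub>+\<close>.\<close>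

lemma spectral_projection:
  assumes B: "B \<in> sa_ops"
  obtains P where "P \<in> positive_ops" "P o\<^sub>L P = P"
    "\<forall>D. D o\<^sub>L B = B o\<^sub>L D \<longrightarrow> D o\<^sub>L P = P o\<^sub>L D"
    "\<forall>x. B (P x) \<bullet> P x \<le> t * (norm (P x))\<^sup>2"
    "\<forall>x. t * (norm (x - P x))\<^sup>2 \<le> B (x - P x) \<bullet> (x - P x)"
proof -
  define b where "b = norm B"
  have A: "op_between (- b) B b" unfolding b_def by (rule op_between_norm[OF B])
  \<comment> \<open>This scaling puts \<open>\<phi>\<close>, a multiple of the positive part of
    \<open>s - t\<close>, into [0, 1] on the interval; the maximum with 1 covers
    \<open>t \<ge> b\<close>.\<close>
  define M where "M = max 1 (b - t)"
  have M: "0 < M" "b - t \<le> M" by (auto simp: M_def)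
  define \<phi> where "\<phi> s = max 0 (s - t) / M" for s
  define \<psi> where "\<psi> s = max 0 (t - s)" for s
  define F where "F n = cfc (\<lambda>s. (1 - \<phi> s) ^ n) B" for n
  have cont: "continuous_on {-b..b} \<phi>" "continuous_on {-b..b} \<psi>" "\<And>n. continuous_on {-b..b} (\<lambda>s. (1 - \<phi> s) ^ n)"
    unfolding \<phi>_def \<psi>_def using M by (auto intro!: continuous_intros)
  have \<phi>: "0 \<le> \<phi> s" "\<phi> s \<le> 1" if "s \<in> {-b..b}" for s
    using that M by (auto simp: \<phi>_def)
  have pos: "F n \<in> positive_ops" for n
    unfolding F_def by (rule cfc_nonneg[OF A cont(3)]) (use \<phi> in simp)
  have dec: "F (Suc n) \<sqsubseteq> F n" for n
    unfolding F_def by (rule cfc_mono[OF A cont(3) cont(3)]) (use \<phi> in \<open>simp add: mult_left_le_one_le\<close>)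
  obtain P where P: "P \<in> positive_ops" and "decreases_to F P" using decreasing_convergent[of F, OF pos dec] .
  then have lim: "sot_tendsto F P sequentially" by (simp add: decreases_to_def)
  have unique: "S = T" if "sot_tendsto G S sequentially" "sot_tendsto G T sequentially" for G S T
    using sot_tendsto_unique[OF trivial_limit_sequentially that] .
  have FF: "F m o\<^sub>L F n = F (m + n)" for m n
    unfolding F_def using cfc_mult[OF A cont(3) cont(3), of m n] by (simp add: power_add)
  \<comment> \<open>Shifting the index does not change the limit, so \<open>P\<close> absorbs every
    \<open>F n\<close> and is idempotent in the limit.\<close>
  have PF: "P o\<^sub>L F n = P" for n
  proof (rule unique)
    show "sot_tendsto (\<lambda>m. F m o\<^sub>L F n) (P o\<^sub>L F n) sequentially" by (intro sot_tendsto_intros lim)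
    show "sot_tendsto (\<lambda>m. F m o\<^sub>L F n) P sequentially"
      using lim unfolding FF sot_tendsto_def by (auto intro: LIMSEQ_ignore_initial_segment)
  qed
  have PP: "P o\<^sub>L P = P"
    using unique[OF sot_tendsto_intros(4)[OF lim, of P]] sot_tendsto_intros(1) unfolding PF by blast
  have comm: "D o\<^sub>L P = P o\<^sub>L D" if D: "D o\<^sub>L B = B o\<^sub>L D" for D
  proof (rule unique)
    have "D o\<^sub>L F n = F n o\<^sub>L D" for n unfolding F_def by (rule cfc_commute[OF A cont(3) D])
    then show "sot_tendsto (\<lambda>n. D o\<^sub>L F n) (P o\<^sub>L D) sequentially"
      using sot_tendsto_intros(5)[OF lim, of D] by simp
    show "sot_tendsto (\<lambda>n. D o\<^sub>L F n) (D o\<^sub>L P) sequentially" by (rule sot_tendsto_intros(4)[OF lim])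
  qed
  define C where "C = cfc \<phi> B"
  define N where "N = cfc \<psi> B"
  have C: "C \<in> positive_ops" unfolding C_def by (rule cfc_nonneg[OF A cont(1)]) (use \<phi> in simp)
  have N: "N \<in> positive_ops" unfolding N_def by (rule cfc_nonneg[OF A cont(2)]) (simp add: \<psi>_def)
  \<comment> \<open>\<open>C o\<^sub>L F n\<close> equals \<open>F n - F (Suc n)\<close>, whose
    strong limit is 0. Hence no positive part of \<open>B - t\<close> is left on the range of
    \<open>P\<close>.\<close>
  have "C o\<^sub>L P = 0"
  proof (rule unique)
    have "C o\<^sub>L F n = F n - F (Suc n)" for n
      unfolding C_def F_def cfc_mult[OF A cont(1,3), symmetric] cfc_diff[OF A cont(3,3), symmetric]
      by (simp add: algebra_simps)
    then show "sot_tendsto (\<lambda>n. F n - F (Suc n)) (C o\<^sub>L P) sequentially"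
      using sot_tendsto_intros(4)[OF lim, of C] by simp
    have "sot_tendsto (\<lambda>n. F (Suc n)) P sequentially"
      using lim unfolding sot_tendsto_def by (auto intro: LIMSEQ_Suc)
    from sot_tendsto_intros(3)[OF lim this] show "sot_tendsto (\<lambda>n. F n - F (Suc n)) 0 sequentially" by simp
  qed
  \<comment> \<open>Where \<open>\<psi>\<close> is nonzero \<open>\<phi>\<close> vanishes, so every
    \<open>F n\<close> leaves \<open>N\<close> unchanged. Hence no negative part is left on the
    complement of \<open>P\<close>.\<close>
  have "N o\<^sub>L P = N"
  proof (rule unique)
    have "(\<lambda>s. \<psi> s * (1 - \<phi> s) ^ n) = \<psi>" for n
    proof
      show "\<psi> s * (1 - \<phi> s) ^ n = \<psi> s" for s by (cases "s \<le> t") (auto simp: \<phi>_def \<psi>_def)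
    qed
    then have "N o\<^sub>L F n = N" for n
      unfolding N_def F_def cfc_mult[OF A cont(2,3), symmetric] by simp
    then show "sot_tendsto (\<lambda>n. N) (N o\<^sub>L P) sequentially"
      using sot_tendsto_intros(4)[OF lim, of N] by simp
  qed (rule sot_tendsto_intros)
  have dec_eq: "B - t *\<^sub>R id_blinfun = M *\<^sub>R C - N"
  proof -
    have "B - t *\<^sub>R id_blinfun = cfc (\<lambda>s. s - t) B"
      using cfc_diff[OF A continuous_on_id continuous_on_const, of t] cfc_id[OF A] cfc_const[OF A, of t] by simp
    also have "(\<lambda>s. s - t) = (\<lambda>s. M * \<phi> s - \<psi> s)" using M by (auto simp: \<phi>_def \<psi>_def fun_eq_iff max_def)
    also have "cfc (\<lambda>s. M * \<phi> s - \<psi> s) B = M *\<^sub>R C - N"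
      unfolding C_def N_def using cfc_diff[OF A continuous_on_mult_left[OF cont(1)] cont(2), of M]
      by (simp add: cfc_scaleR[OF A cont(1)])
    finally show ?thesis .
  qed
  have Beq: "B y \<bullet> y = t * (norm y)\<^sup>2 + M * (C y \<bullet> y) - N y \<bullet> y" for y
  proof -
    have "(B - t *\<^sub>R id_blinfun) y \<bullet> y = (M *\<^sub>R C - N) y \<bullet> y" by (simp only: dec_eq)
    then show ?thesis by (simp add: blinfun.bilinear_simps inner_simps power2_norm_eq_inner)
  qed
  have "C (P x) = 0" for x using \<open>C o\<^sub>L P = 0\<close> by (metis blinfun_apply_blinfun_compose blinfun.zero_left)
  then have 1: "B (P x) \<bullet> P x \<le> t * (norm (P x))\<^sup>2" for x using N by (simp add: Beq)
  have "N (x - P x) = 0" for x using \<open>N o\<^sub>L P = N\<close>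
    by (metis blinfun_apply_blinfun_compose blinfun.diff_right right_minus_eq)
  then have 2: "t * (norm (x - P x))\<^sup>2 \<le> B (x - P x) \<bullet> (x - P x)" for x using C M by (simp add: Beq)
  show ?thesis using that[OF P PP] comm 1 2 by simp
qed


subsection \<open>Orthogonal projections\<close>

definition op_projection :: "('a::complex_hilbert \<Rightarrow>\<^sub>L 'a) \<Rightarrow> bool" where
  "op_projection P \<longleftrightarrow> P \<in> sa_ops \<and> P o\<^sub>L P = P"

lemma op_projection_sa [simp]: "op_projection P \<Longrightarrow> P \<in> sa_ops"
  and op_projection_idem: "op_projection P \<Longrightarrow> P o\<^sub>L P = P"
  by (auto simp: op_projection_def)

lemma op_projection_idem_apply [simp]: "op_projection P \<Longrightarrow> P (P x) = P x"
  using op_projection_idem[of P] by (metis blinfun_apply_blinfun_compose)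

lemma op_projection_inner: "op_projection P \<Longrightarrow> P x \<bullet> x = (norm (P x))\<^sup>2"
  using sa_ops_sym[of P "P x" x] by (simp add: power2_norm_eq_inner)

lemma op_projection_positive [simp]: "op_projection P \<Longrightarrow> P \<in> positive_ops"
  by (rule positive_opsI) (auto simp: op_projection_inner)

lemma op_projection_id [simp]: "op_projection id_blinfun"
  unfolding op_projection_def by simp

lemma op_projection_complement: "op_projection P \<Longrightarrow> op_projection (id_blinfun - P)"
  unfolding op_projection_def by (auto simp: blinfun_compose_bilinear)

lemma op_projection_compose:
  assumes "op_projection P" "op_projection Q" "P o\<^sub>L Q = Q o\<^sub>L P"
  shows "op_projection (P o\<^sub>L Q)"
proof -
  have "(P o\<^sub>L Q) o\<^sub>L (P o\<^sub>L Q) = P o\<^sub>L ((Q o\<^sub>L P) o\<^sub>L Q)" by (simp only: blinfun_compose_assoc)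
  also have "\<dots> = (P o\<^sub>L P) o\<^sub>L (Q o\<^sub>L Q)" by (simp only: assms(3)[symmetric] blinfun_compose_assoc)
  finally show ?thesis
    using assms sa_ops_compose[of P Q] unfolding op_projection_def by simp
qed

lemma op_projection_norm_le: "op_projection P \<Longrightarrow> norm (P x) \<le> norm x"
proof -
  assume P: "op_projection P"
  have "(norm (P x))\<^sup>2 = P x \<bullet> x" by (simp add: op_projection_inner P)
  also have "\<dots> \<le> norm (P x) * norm x" by (rule norm_cauchy_schwarz)
  finally show ?thesis by (cases "P x = 0") (simp_all add: power2_eq_square)
qed

text \<open>The difference is the compression of \<open>A\<close> by the complement of
  \<open>P\<close>; commutation removes the mixed terms.\<close>

lemma op_projection_compress_le:
  assumes P: "op_projection P" and A: "A \<in> positive_ops" and PA: "P o\<^sub>L A = A o\<^sub>L P"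
  shows "P o\<^sub>L A o\<^sub>L P \<sqsubseteq> A"
proof -
  define Q where "Q = id_blinfun - P"
  have Q: "Q \<in> sa_ops" using P by (simp add: Q_def)
  have PAP: "P o\<^sub>L (A o\<^sub>L P) = A o\<^sub>L P"
    using PA op_projection_idem[OF P] by (metis blinfun_compose_assoc)
  have "Q o\<^sub>L A o\<^sub>L Q = A - (P o\<^sub>L A o\<^sub>L P)"
    by (simp add: Q_def blinfun_compose_bilinear blinfun_compose_assoc PA PAP op_projection_idem[OF P])
  then show ?thesis unfolding op_le_def using positive_ops_sandwich[OF A Q] by simp
qed

text \<open>For a unit vector \<open>u\<close> this is the orthogonal projection onto the complex
  line through \<open>u\<close>, a real plane with orthonormal basis \<open>u\<close> and
  \<open>\<i> *\<^sub>C u\<close>.\<close>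

definition rank_one_proj :: "'a::complex_hilbert \<Rightarrow> ('a \<Rightarrow>\<^sub>L 'a)" where
  "rank_one_proj u = Blinfun (\<lambda>x. (x \<bullet> u) *\<^sub>R u + (x \<bullet> (\<i> *\<^sub>C u)) *\<^sub>R \<i> *\<^sub>C u)"

lemma rank_one_proj_apply:
  fixes u x :: "'a::complex_hilbert"
  shows "rank_one_proj u x = (x \<bullet> u) *\<^sub>R u + (x \<bullet> (\<i> *\<^sub>C u)) *\<^sub>R \<i> *\<^sub>C u"
  unfolding rank_one_proj_def
  unfolding rank_one_proj_def
  by (rule fun_cong[OF bounded_linear_Blinfun_apply]) (intro bounded_linear_intros)

lemma rank_one_proj_inner:
  "rank_one_proj u x \<bullet> y = (x \<bullet> u) * (y \<bullet> u) + (x \<bullet> (\<i> *\<^sub>C u)) * (y \<bullet> (\<i> *\<^sub>C u))"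
  by (simp add: rank_one_proj_apply inner_simps inner_commute)

lemma rank_one_proj_projection:
  assumes "norm u = 1" shows "op_projection (rank_one_proj u)"
proof -
  have uu: "u \<bullet> u = 1" "(\<i> *\<^sub>C u) \<bullet> (\<i> *\<^sub>C u) = 1"
    using assms norm_eq_1[of u] norm_eq_1[of "\<i> *\<^sub>C u"] by simp_all
  have "rank_one_proj u \<in> bops" unfolding bops_iff
    by (simp add: rank_one_proj_apply imaginary_unit_linear scaleC_imaginary_unit_twice inner_imaginary_unit algebra_simps)
  moreover have "rank_one_proj u x \<bullet> y = x \<bullet> rank_one_proj u y" for x y
    by (subst (2) inner_commute) (simp add: rank_one_proj_inner mult.commute)
  moreover have "rank_one_proj u o\<^sub>L rank_one_proj u = rank_one_proj u"
    by (rule blinfun_eqI) (simp add: rank_one_proj_apply inner_simps uu)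
  ultimately show ?thesis unfolding op_projection_def sa_ops_def by blast
qed

lemma rank_one_proj_self: "norm u = 1 \<Longrightarrow> rank_one_proj u u = u"
  by (simp add: rank_one_proj_apply norm_eq_1)

text \<open>Each of the two real directions contributes a difference of squares, bounded with factor
  2 because unit vectors have a sum of norm at most 2.\<close>

lemma rank_one_proj_diff_le:
  assumes "norm u = 1" "norm w = 1"
  shows "\<bar>rank_one_proj u x \<bullet> x - rank_one_proj w x \<bullet> x\<bar> \<le> 4 * norm (u - w) * (norm x)\<^sup>2"
proof -
  have sq: "\<bar>(x \<bullet> a)\<^sup>2 - (x \<bullet> b)\<^sup>2\<bar> \<le> 2 * norm (a - b) * (norm x)\<^sup>2" if "norm a = 1" "norm b = 1" for a b :: 'a
  proof -
    have "\<bar>(x \<bullet> a)\<^sup>2 - (x \<bullet> b)\<^sup>2\<bar> = \<bar>x \<bullet> (a - b)\<bar> * \<bar>x \<bullet> (a + b)\<bar>"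
      by (simp add: abs_mult[symmetric] inner_simps power2_eq_square algebra_simps)
    also have "\<dots> \<le> (norm x * norm (a - b)) * (norm x * norm (a + b))"
      by (intro mult_mono Cauchy_Schwarz_ineq2) auto
    also have "\<dots> \<le> (norm x * norm (a - b)) * (norm x * 2)"
      using norm_triangle_ineq[of a b] that by (intro mult_left_mono) auto
    finally show ?thesis by (simp add: power2_eq_square mult_ac)
  qed
  have "norm (\<i> *\<^sub>C u - \<i> *\<^sub>C w) = norm (u - w)"
    by (simp add: imaginary_unit_linear[symmetric])
  then show ?thesis
    using sq[of u w] sq[of "\<i> *\<^sub>C u" "\<i> *\<^sub>C w"] assms
    unfolding rank_one_proj_inner power2_eq_square[symmetric] by simp
qed

text \<open>Commutation makes every vector an eigenvector with real eigenvalue. Eigenvectors for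
  distinct eigenvalues are orthogonal, and their sum could not be an eigenvector.\<close>

lemma commutes_rank_one_imp_scalar:
  assumes T: "T \<in> sa_ops"
    and comm: "\<And>u. norm u = 1 \<Longrightarrow> rank_one_proj u o\<^sub>L T = T o\<^sub>L rank_one_proj u"
  obtains r where "T = r *\<^sub>R id_blinfun"
proof -
  have unit: "\<exists>r. T u = r *\<^sub>R u" if u: "norm u = 1" for u
  proof -
    have "T u = rank_one_proj u (T u)"
      using comm[OF u] rank_one_proj_self[OF u] by (metis blinfun_apply_blinfun_compose)
    \<comment> \<open>Symmetry removes the imaginary part of the eigenvalue.\<close>
    moreover have "T u \<bullet> (\<i> *\<^sub>C u) = 0"
      using sa_ops_sym[OF T, of u "\<i> *\<^sub>C u"] sa_ops_bops[OF T] inner_imaginary_unit[of u "T u"]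
      by (simp add: bops_iff inner_commute)
    ultimately show ?thesis by (metis add.right_neutral rank_one_proj_apply scale_zero_left)
  qed
  have eig: "\<exists>r. T x = r *\<^sub>R x" for x
  proof (cases "x = 0")
    case False
    then obtain r where "T ((1 / norm x) *\<^sub>R x) = r *\<^sub>R ((1 / norm x) *\<^sub>R x)"
      using unit[of "(1 / norm x) *\<^sub>R x"] by auto
    then have "(1 / norm x) *\<^sub>R T x = (1 / norm x) *\<^sub>R (r *\<^sub>R x)" by (simp add: blinfun.bilinear_simps)
    then show ?thesis using False by (metis divide_eq_0_iff norm_eq_zero scaleR_cancel_left zero_neq_one)
  qed simp
  then obtain l where l: "\<And>x. T x = l x *\<^sub>R x" by metis
  have same: "l x = l y" if "x \<noteq> 0" "y \<noteq> 0" for x y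
  proof (rule ccontr)
    assume ne: "l x \<noteq> l y"
    have "l x * (x \<bullet> y) = l y * (x \<bullet> y)" using sa_ops_sym[OF T, of x y] by (simp add: l)
    then have o: "x \<bullet> y = 0" using ne by simp
    have "l (x + y) *\<^sub>R (x + y) = l x *\<^sub>R x + l y *\<^sub>R y"
      using l[of "x + y"] by (simp add: blinfun.bilinear_simps l)
    then have "(l (x + y) *\<^sub>R (x + y)) \<bullet> x = (l x *\<^sub>R x + l y *\<^sub>R y) \<bullet> x"
      "(l (x + y) *\<^sub>R (x + y)) \<bullet> y = (l x *\<^sub>R x + l y *\<^sub>R y) \<bullet> y" by simp_all
    then show False using o that ne by (simp add: inner_simps inner_commute)
  qed
  obtain r where r: "\<And>x. x \<noteq> 0 \<Longrightarrow> l x = r" using same by metis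
  have "T = r *\<^sub>R id_blinfun"
    by (rule blinfun_eqI) (metis blinfun.zero_right blinfun_apply_id_blinfun id_apply l r scaleR_blinfun.rep_eq scaleR_zero_right)
  then show ?thesis by (rule that)
qed


subsection \<open>The representing function of an operator mean\<close>

lemma decreases_to_add_scaled_id:
  "A \<in> positive_ops \<Longrightarrow> decreases_to (\<lambda>n. A + (1 / real (Suc n)) *\<^sub>R id_blinfun) A"
  unfolding decreases_to_def
proof
  show "\<forall>k. A + (1 / real (Suc (Suc k))) *\<^sub>R id_blinfun \<sqsubseteq> A + (1 / real (Suc k)) *\<^sub>R id_blinfun"
    by (intro allI op_le_add op_le_refl op_le_scaleR_left divide_left_mono) auto
  have "(\<lambda>n. A + (1 / real (Suc n)) *\<^sub>R id_blinfun) \<longlonglongrightarrow> A + 0 *\<^sub>R id_blinfun"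
    by (intro tendsto_intros LIMSEQ_Suc[OF lim_1_over_n])
  then show "sot_tendsto (\<lambda>n. A + (1 / real (Suc n)) *\<^sub>R id_blinfun) A sequentially"
    by (intro norm_tendsto_imp_sot) simp
qed

locale op_mean =
  fixes m :: "'a::complex_hilbert binop"
  assumes mean: "operator_mean m" and infdim: "infinite_dimensional TYPE('a)"
begin

lemma mean_positive [simp, intro]: "A \<in> positive_ops \<Longrightarrow> B \<in> positive_ops \<Longrightarrow> m A B \<in> positive_ops"
  using mean by (simp add: operator_mean_def)

lemma mean_mono:
  "A \<in> positive_ops \<Longrightarrow> B \<in> positive_ops \<Longrightarrow> A \<sqsubseteq> A' \<Longrightarrow> B \<sqsubseteq> B' \<Longrightarrow> m A B \<sqsubseteq> m A' B'"
  using mean positive_le_imp_positive[of A A'] positive_le_imp_positive[of B B']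
  by (simp add: operator_mean_def)

lemma mean_transformer:
  "A \<in> positive_ops \<Longrightarrow> B \<in> positive_ops \<Longrightarrow> C \<in> positive_ops \<Longrightarrow>
    C o\<^sub>L m A B o\<^sub>L C \<sqsubseteq> m (C o\<^sub>L A o\<^sub>L C) (C o\<^sub>L B o\<^sub>L C)"
  using mean by (simp add: operator_mean_def)

lemma mean_continuous:
  assumes "\<And>n. F n \<in> positive_ops" "\<And>n. G n \<in> positive_ops" "A \<in> positive_ops" "B \<in> positive_ops"
    and "decreases_to F A" "decreases_to G B"
  shows "decreases_to (\<lambda>k. m (F k) (G k)) (m A B)"
proof -
  have "range F \<subseteq> positive_ops" "range G \<subseteq> positive_ops" using assms by auto
  then show ?thesis using mean assms(3-) unfolding operator_mean_def by blast
qed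

lemma mean_id [simp]: "m id_blinfun id_blinfun = id_blinfun"
  using mean by (simp add: operator_mean_def)

text \<open>The reverse of axiom (II) is (II) for the transformed operators and the inverse of
  \<open>C\<close>, conjugated back.\<close>

lemma mean_congruence:
  assumes A: "A \<in> positive_ops" and B: "B \<in> positive_ops" and C: "C \<in> positive_inv_ops"
  shows "m (C o\<^sub>L A o\<^sub>L C) (C o\<^sub>L B o\<^sub>L C) = C o\<^sub>L m A B o\<^sub>L C"
proof (rule op_le_antisym)
  show "C o\<^sub>L m A B o\<^sub>L C \<sqsubseteq> m (C o\<^sub>L A o\<^sub>L C) (C o\<^sub>L B o\<^sub>L C)"
    using A B C by (intro mean_transformer) auto
  obtain D where D: "D \<in> positive_inv_ops" "C o\<^sub>L D = id_blinfun" "D o\<^sub>L C = id_blinfun"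
    using positive_inv_inverse[OF C] .
  have DC: "D o\<^sub>L (C o\<^sub>L X o\<^sub>L C) o\<^sub>L D = X" "C o\<^sub>L (D o\<^sub>L X o\<^sub>L D) o\<^sub>L C = X" for X
    using D(2,3) by (metis blinfun_compose_assoc blinfun_compose_id)+
  have "D o\<^sub>L m (C o\<^sub>L A o\<^sub>L C) (C o\<^sub>L B o\<^sub>L C) o\<^sub>L D \<sqsubseteq> m A B"
    using mean_transformer[of "C o\<^sub>L A o\<^sub>L C" "C o\<^sub>L B o\<^sub>L C" D] A B C D(1) by (simp add: DC)
  from op_le_sandwich[OF this, of C]
  show "m (C o\<^sub>L A o\<^sub>L C) (C o\<^sub>L B o\<^sub>L C) \<sqsubseteq> C o\<^sub>L m A B o\<^sub>L C" using C by (simp add: DC)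
qed

lemma mean_scaleR:
  assumes "A \<in> positive_ops" "B \<in> positive_ops" "0 < c"
  shows "m (c *\<^sub>R A) (c *\<^sub>R B) = c *\<^sub>R m A B"
  using mean_congruence[OF assms(1,2), of "sqrt c *\<^sub>R id_blinfun"] assms(3)
  by (simp add: blinfun_compose_bilinear)

text \<open>Axioms (II) and (I) make \<open>?R\<close> positive. Its form vanishes on the range of
  \<open>P\<close>, so it kills that range and \<open>T\<close> maps the range into itself; symmetry
  turns this into commutation.\<close>

lemma mean_commutes_projection:
  assumes A: "A \<in> positive_ops" and B: "B \<in> positive_ops" and P: "op_projection P"
    and PA: "P o\<^sub>L A = A o\<^sub>L P" and PB: "P o\<^sub>L B = B o\<^sub>L P"
  shows "P o\<^sub>L m A B = m A B o\<^sub>L P"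
proof -
  define T where "T = m A B"
  have T: "T \<in> positive_ops" using A B by (simp add: T_def)
  have "P o\<^sub>L T o\<^sub>L P \<sqsubseteq> m (P o\<^sub>L A o\<^sub>L P) (P o\<^sub>L B o\<^sub>L P)"
    unfolding T_def using A B P by (intro mean_transformer) auto
  also have "\<dots> \<sqsubseteq> T" unfolding T_def
    using A B P by (intro mean_mono op_projection_compress_le PA PB) auto
  finally have R: "T - (P o\<^sub>L T o\<^sub>L P) \<in> positive_ops" (is "?R \<in> _") by (simp add: op_le_def)
  have TP: "T (P x) = P (T (P x))" for x
  proof -
    have "P x \<bullet> P (T (P x)) = P (P x) \<bullet> T (P x)" using P by (metis op_projection_sa sa_ops_sym)
    then have "?R (P x) \<bullet> P x = 0"
      using P by (simp add: blinfun.bilinear_simps inner_simps inner_commute)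
    moreover have "(norm (?R (P x)))\<^sup>2 \<le> norm ?R * (?R (P x) \<bullet> P x)"
      by (rule positive_norm_square_le[OF R]) (use inner_le_norm[of ?R] abs_le_D1 in blast)
    ultimately have "?R (P x) = 0" by simp
    then show ?thesis using P by (simp add: blinfun.bilinear_simps)
  qed
  have "P (T x) \<bullet> y = T (P x) \<bullet> y" for x y
  proof -
    have "P (T x) \<bullet> y = x \<bullet> T (P y)" using P T by (simp add: sa_ops_sym)
    also have "\<dots> = x \<bullet> P (T (P y))" using TP by simp
    also have "\<dots> = P (T (P x)) \<bullet> y" using P T by (simp add: sa_ops_sym)
    finally show ?thesis using TP by simp
  qed
  then have "P (T x) = T (P x)" for x by (metis vector_eq_rdot)
  then show ?thesis unfolding T_def[symmetric] by (intro blinfun_eqI) simp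
qed

section \<open>Values on multiples of the identity: the representing function\<close>

lemma mean_scaled_id_scalar:
  assumes "0 \<le> t" obtains r where "m id_blinfun (t *\<^sub>R id_blinfun) = r *\<^sub>R id_blinfun"
proof (rule commutes_rank_one_imp_scalar[of "m id_blinfun (t *\<^sub>R id_blinfun)"])
  show "m id_blinfun (t *\<^sub>R id_blinfun) \<in> sa_ops" using assms by simp
  fix u :: 'a assume "norm u = 1"
  then show "rank_one_proj u o\<^sub>L m id_blinfun (t *\<^sub>R id_blinfun) = m id_blinfun (t *\<^sub>R id_blinfun) o\<^sub>L rank_one_proj u"
    using assms by (intro mean_commutes_projection rank_one_proj_projection) (auto simp: blinfun_compose_bilinear)
qed (use that in blast)

text \<open>Gram-Schmidt over the complex numbers, started from the fact that neither the empty set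
  nor one vector spans the space. The last conclusion makes the two complex lines
  orthogonal.\<close>

lemma orthonormal_pair:
  obtains u v :: 'a where "norm u = 1" "norm v = 1" "u \<bullet> v = 0" "u \<bullet> (\<i> *\<^sub>C v) = 0"
proof -
  interpret module "scaleC :: complex \<Rightarrow> 'a \<Rightarrow> 'a"
    by unfold_locales (auto simp: scaleC_add_right scaleC_add_left scaleC_scaleC scaleC_of_real[of 1, simplified])
  have nspan: "span S \<noteq> UNIV" if "finite S" for S :: "'a set"
    using infdim that unfolding infinite_dimensional_def by blast
  obtain w0 :: 'a where "w0 \<notin> span {}" using nspan[of "{}"] by blast
  then have w0: "w0 \<noteq> 0" by (auto simp: span_empty)
  define u where "u = (1 / norm w0) *\<^sub>R w0"
  have u: "norm u = 1" using w0 by (simp add: u_def)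
  obtain w where w: "w \<notin> span {u}" using nspan[of "{u}"] by blast
  define v0 where "v0 = w - rank_one_proj u w"
  have "rank_one_proj u w = Complex (w \<bullet> u) (w \<bullet> (\<i> *\<^sub>C u)) *\<^sub>C u"
    by (subst scaleC_eq) (simp add: rank_one_proj_apply)
  then have "rank_one_proj u w \<in> span {u}" by (simp add: span_scale span_base)
  then have v0: "v0 \<noteq> 0" using w by (auto simp: v0_def)
  have uu: "u \<bullet> u = 1" "(\<i> *\<^sub>C u) \<bullet> (\<i> *\<^sub>C u) = 1"
    using u norm_eq_1[of u] norm_eq_1[of "\<i> *\<^sub>C u"] by simp_all
  have "v0 \<bullet> u = 0" "v0 \<bullet> (\<i> *\<^sub>C u) = 0"
    by (simp_all add: v0_def rank_one_proj_apply inner_simps uu)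
  then have o: "u \<bullet> v0 = 0" "u \<bullet> (\<i> *\<^sub>C v0) = 0"
    using inner_imaginary_unit[of u v0] by (simp_all add: inner_commute)
  show ?thesis
    by (rule that[of u "(1 / norm v0) *\<^sub>R v0"]) (use u v0 o in \<open>auto simp: imaginary_unit_linear\<close>)
qed

lemma id_blinfun_nonzero [simp]: "(id_blinfun :: 'a \<Rightarrow>\<^sub>L 'a) \<noteq> 0"
proof
  assume eq: "(id_blinfun :: 'a \<Rightarrow>\<^sub>L 'a) = 0"
  obtain u :: 'a where "norm u = 1" using orthonormal_pair by metis
  moreover have "u = 0" using eq by (metis blinfun_apply_id_blinfun id_apply blinfun.zero_left)
  ultimately show False by simp
qed

lemma scaled_id_le_iff [simp]: "a *\<^sub>R (id_blinfun :: 'a \<Rightarrow>\<^sub>L 'a) \<sqsubseteq> b *\<^sub>R id_blinfun \<longleftrightarrow> a \<le> b"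
proof
  assume le: "a *\<^sub>R (id_blinfun :: 'a \<Rightarrow>\<^sub>L 'a) \<sqsubseteq> b *\<^sub>R id_blinfun"
  obtain u :: 'a where "norm u = 1" using orthonormal_pair by metis
  then show "a \<le> b" using op_leD[OF le, of u] by (simp add: blinfun.bilinear_simps norm_eq_1)
qed (rule op_le_scaleR_left, simp)

text \<open>The restriction to \<open>{0..}\<close> matches the extensionality demanded by
  \<open>rep_fun\<close>, so that the two can be equal as HOL functions.\<close>

definition rf :: "real \<Rightarrow> real" where
  "rf = restrict (\<lambda>t. THE r. m id_blinfun (t *\<^sub>R id_blinfun) = r *\<^sub>R id_blinfun) {0..}"

lemma mean_scaled_id: "0 \<le> t \<Longrightarrow> m id_blinfun (t *\<^sub>R id_blinfun) = rf t *\<^sub>R id_blinfun"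
proof -
  assume t: "0 \<le> t"
  then obtain r where r: "m id_blinfun (t *\<^sub>R id_blinfun) = r *\<^sub>R id_blinfun" using mean_scaled_id_scalar by blast
  then have "rf t = r" using t by (simp add: rf_def)
  then show ?thesis using r by simp
qed

lemma mean_scaled_ids:
  assumes "0 < a" "0 \<le> b" shows "m (a *\<^sub>R id_blinfun) (b *\<^sub>R id_blinfun) = (a * rf (b / a)) *\<^sub>R id_blinfun"
  using mean_scaleR[of id_blinfun "(b / a) *\<^sub>R id_blinfun" a] assms by (simp add: mean_scaled_id)

lemma rf_1 [simp]: "rf 1 = 1"
  using mean_scaled_id[of 1] scaleR_cancel_right[of 1 "id_blinfun :: 'a \<Rightarrow>\<^sub>L 'a" "rf 1"] by simp

lemma rf_mono: "0 \<le> s \<Longrightarrow> s \<le> t \<Longrightarrow> rf s \<le> rf t"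
  using mean_mono[of id_blinfun "s *\<^sub>R id_blinfun" id_blinfun "t *\<^sub>R id_blinfun"]
  by (simp add: mean_scaled_id)

lemma rf_nonneg: "0 \<le> t \<Longrightarrow> 0 \<le> rf t"
  using mean_positive[of id_blinfun "t *\<^sub>R id_blinfun"] scaled_id_le_iff[of 0 "rf t"]
  by (simp add: mean_scaled_id op_le_def)

text \<open>Monotonicity in the first argument, with the common second argument \<open>s * t\<close>
  chosen so that homogeneity produces exactly these two products.\<close>

lemma rf_antimono_ratio: "0 < s \<Longrightarrow> s \<le> t \<Longrightarrow> s * rf t \<le> t * rf s"
  using mean_mono[of "s *\<^sub>R id_blinfun" "(s * t) *\<^sub>R id_blinfun" "t *\<^sub>R id_blinfun" "(s * t) *\<^sub>R id_blinfun"]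
  by (simp add: mean_scaled_ids)

lemma rf_pos: "0 < t \<Longrightarrow> 0 < rf t"
  using rf_mono[of 1 t] rf_antimono_ratio[of t 1] by (cases "1 \<le> t") auto

lemma rf_tendsto_0: "(\<lambda>n. rf (1 / real (Suc n))) \<longlonglongrightarrow> rf 0"
proof -
  have "decreases_to (\<lambda>n. m id_blinfun (0 + (1 / real (Suc n)) *\<^sub>R id_blinfun)) (m id_blinfun 0)"
    by (intro mean_continuous decreases_to_const decreases_to_add_scaled_id) auto
  then have *: "sot_tendsto (\<lambda>n. rf (1 / real (Suc n)) *\<^sub>R id_blinfun) (rf 0 *\<^sub>R (id_blinfun :: 'a \<Rightarrow>\<^sub>L 'a)) sequentially"
    using mean_scaled_id[of 0] by (simp add: decreases_to_def mean_scaled_id)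
  obtain u :: 'a where "norm u = 1" using orthonormal_pair by metis
  then show ?thesis
    using sot_tendsto_inner[OF *, of u u] by (simp add: blinfun.bilinear_simps norm_eq_1)
qed

text \<open>At 0 the continuity axiom gives a sequence of values, and monotonicity spreads it to a
  neighbourhood. Elsewhere \<open>rf_mono\<close> and \<open>rf_antimono_ratio\<close> make
  \<open>rf\<close> locally Lipschitz.\<close>

lemma continuous_on_rf: "continuous_on {0..} rf"
  unfolding continuous_on_iff
proof (intro ballI allI impI)
  fix x e :: real assume x: "x \<in> {0..}" and e: "0 < e"
  show "\<exists>d>0. \<forall>y\<in>{0..}. dist y x < d \<longrightarrow> dist (rf y) (rf x) < e"
  proof (cases "x = 0")
    case True
    have "\<forall>\<^sub>F n in sequentially. rf (1 / real (Suc n)) < rf 0 + e"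
      using order_tendstoD(2)[OF rf_tendsto_0] e by simp
    then obtain n where n: "rf (1 / real (Suc n)) < rf 0 + e" by (auto dest: eventually_happens)
    show ?thesis
    proof (intro exI[of _ "1 / real (Suc n)"] conjI ballI impI)
      fix y assume y: "y \<in> {0..}" "dist y x < 1 / real (Suc n)"
      then have "rf y \<le> rf (1 / real (Suc n))" "rf 0 \<le> rf y"
        using True by (auto simp: dist_real_def intro!: rf_mono)
      then show "dist (rf y) (rf x) < e" using n True by (simp add: dist_real_def)
    qed simp
  next
    case False
    then have x0: "0 < x" using x by simp
    have est: "rf t - rf s \<le> (t - s) * rf (2 * x) / (x / 2)" if "x / 2 \<le> s" "s \<le> t" "t \<le> 2 * x" for s t
    proof -
      have s: "0 < s" using that x0 by linarith
      have "s * (rf t - rf s) \<le> (t - s) * rf s" using rf_antimono_ratio[OF s that(2)] by (simp add: algebra_simps)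
      then have "rf t - rf s \<le> (t - s) * rf s / s" using s by (simp add: field_simps)
      also have "\<dots> \<le> (t - s) * rf (2 * x) / (x / 2)"
        using that s x0 rf_mono[of s "2 * x"] rf_nonneg[of s] by (intro frac_le mult_left_mono) auto
      finally show ?thesis .
    qed
    define K where "K = rf (2 * x) / (x / 2)"
    have K: "0 < K" using x0 rf_pos[of "2 * x"] by (simp add: K_def)
    define d where "d = min (x / 2) (e / K)"
    have "0 < d" using x0 e K by (simp add: d_def)
    moreover have "dist (rf y) (rf x) < e" if y: "dist y x < d" for y
    proof -
      have y': "x / 2 \<le> y" "y \<le> 2 * x" "\<bar>y - x\<bar> < e / K"
        using y x0 unfolding d_def dist_real_def min_less_iff_conj by linarith+
      have "\<bar>rf y - rf x\<bar> \<le> \<bar>y - x\<bar> * K"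
        using est[of x y] est[of y x] rf_mono[of x y] rf_mono[of y x] y' x0 by (cases "x \<le> y") (auto simp: K_def)
      also have "\<dots> < e" using y'(3) K by (simp add: pos_less_divide_eq)
      finally show ?thesis by (simp add: dist_real_def)
    qed
    ultimately show ?thesis by blast
  qed
qed

lemma continuous_on_rf_subset: "0 \<le> a \<Longrightarrow> continuous_on {a..b} rf"
  by (rule continuous_on_subset[OF continuous_on_rf]) auto

text \<open>On the range of \<open>P\<close> axioms (I) and (II) confine the mean, and monotonicity
  of the calculus confines \<open>cfc rf B\<close>, to the same interval from \<open>rf a\<close> to
  \<open>rf b\<close>.\<close>

lemma compression_estimate:
  assumes B: "B \<in> positive_ops" and P: "op_projection P" and PB: "P o\<^sub>L B = B o\<^sub>L P"
    and a: "0 \<le> a" "a \<le> b"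
    and low: "\<And>x. a * (norm (P x))\<^sup>2 \<le> B (P x) \<bullet> P x" and up: "\<And>x. B (P x) \<bullet> P x \<le> b * (norm (P x))\<^sup>2"
  shows "norm ((m id_blinfun B - cfc rf B) (P x)) \<le> (rf b - rf a) * norm (P x)"
proof -
  define T where "T = m id_blinfun B"
  have T: "T \<in> positive_ops" using B by (simp add: T_def)
  have PBP: "P o\<^sub>L B o\<^sub>L P = B o\<^sub>L P" using PB op_projection_idem[OF P] by (metis blinfun_compose_assoc)
  have PBP_q: "(P o\<^sub>L B o\<^sub>L P) x \<bullet> x = B (P x) \<bullet> P x" for x using P by (simp add: sa_ops_sym)
  have sa: "P o\<^sub>L B o\<^sub>L P \<in> sa_ops" using B P by (simp add: sa_ops_sandwich)
  have T_up: "P o\<^sub>L T o\<^sub>L P \<sqsubseteq> rf b *\<^sub>R id_blinfun"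
  proof -
    have "P o\<^sub>L T o\<^sub>L P \<sqsubseteq> m (P o\<^sub>L id_blinfun o\<^sub>L P) (P o\<^sub>L B o\<^sub>L P)"
      unfolding T_def using B P by (intro mean_transformer) auto
    also have "\<dots> \<sqsubseteq> m id_blinfun (b *\<^sub>R id_blinfun)"
    proof (rule mean_mono)
      show "P o\<^sub>L id_blinfun o\<^sub>L P \<sqsubseteq> id_blinfun" using P by (intro op_projection_compress_le) auto
      show "P o\<^sub>L B o\<^sub>L P \<sqsubseteq> b *\<^sub>R id_blinfun"
      proof (rule op_leI[OF sa])
        fix x
        have "B (P x) \<bullet> P x \<le> b * (norm (P x))\<^sup>2" by (rule up)
        also have "\<dots> \<le> b * (norm x)\<^sup>2" using a op_projection_norm_le[OF P, of x] by (intro mult_left_mono power_mono) auto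
        finally show "(P o\<^sub>L B o\<^sub>L P) x \<bullet> x \<le> (b *\<^sub>R id_blinfun) x \<bullet> x"
          unfolding PBP_q by (simp add: blinfun.bilinear_simps power2_norm_eq_inner)
      qed simp
    qed (use B P in auto)
    finally show ?thesis using a by (simp add: mean_scaled_id)
  qed
  have T_low: "rf a *\<^sub>R P \<sqsubseteq> T"
  proof -
    have "P o\<^sub>L m id_blinfun (a *\<^sub>R id_blinfun) o\<^sub>L P \<sqsubseteq> m (P o\<^sub>L id_blinfun o\<^sub>L P) (P o\<^sub>L (a *\<^sub>R id_blinfun) o\<^sub>L P)"
      using a P by (intro mean_transformer) auto
    also have "\<dots> \<sqsubseteq> T" unfolding T_def
    proof (rule mean_mono)
      show "P o\<^sub>L id_blinfun o\<^sub>L P \<sqsubseteq> id_blinfun" using P by (intro op_projection_compress_le) auto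
      have "(P o\<^sub>L (a *\<^sub>R id_blinfun) o\<^sub>L P) x \<bullet> x = a * (norm (P x))\<^sup>2" for x
        using P by (simp add: blinfun.bilinear_simps op_projection_inner)
      then have "P o\<^sub>L (a *\<^sub>R id_blinfun) o\<^sub>L P \<sqsubseteq> P o\<^sub>L B o\<^sub>L P"
        using low P sa unfolding PBP_q[symmetric]
        by (intro op_leI) (auto simp: sa_ops_sandwich simp del: blinfun_apply_blinfun_compose)
      also have "\<dots> \<sqsubseteq> B" by (rule op_projection_compress_le[OF P B PB])
      finally show "P o\<^sub>L (a *\<^sub>R id_blinfun) o\<^sub>L P \<sqsubseteq> B" .
    qed (use a P in auto)
    finally show ?thesis using a op_projection_idem[OF P] by (simp add: mean_scaled_id blinfun_compose_bilinear)
  qed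
  \<comment> \<open>Off the range of \<open>P\<close> the operator \<open>B\<close> is replaced by
    \<open>a\<close>, so the result lies between \<open>a\<close> and \<open>b\<close> everywhere
    and \<open>cfc_mono\<close> applies on \<open>{a..b}\<close>.\<close>
  define B' where "B' = (P o\<^sub>L B o\<^sub>L P) + a *\<^sub>R (id_blinfun - P)"
  have B'_q: "B' x \<bullet> x = B (P x) \<bullet> P x + a * ((norm x)\<^sup>2 - (norm (P x))\<^sup>2)" for x
    using PBP_q[of x] P
    by (simp add: B'_def blinfun.bilinear_simps inner_simps power2_norm_eq_inner[of x] op_projection_inner del: blinfun_apply_blinfun_compose)
  have le: "(norm (P x))\<^sup>2 \<le> (norm x)\<^sup>2" for x using op_projection_norm_le[OF P, of x] by (intro power_mono) auto
  have B'ab: "op_between a B' b"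
    unfolding op_between_def
  proof (intro conjI op_leI)
    fix x
    have "a * ((norm x)\<^sup>2 - (norm (P x))\<^sup>2) \<le> b * ((norm x)\<^sup>2 - (norm (P x))\<^sup>2)"
      using a le[of x] by (intro mult_right_mono) auto
    then show "(a *\<^sub>R id_blinfun) x \<bullet> x \<le> B' x \<bullet> x" "B' x \<bullet> x \<le> (b *\<^sub>R id_blinfun) x \<bullet> x"
      using low[of x] up[of x] unfolding B'_q
      by (simp_all add: blinfun.bilinear_simps power2_norm_eq_inner[symmetric] algebra_simps)
  qed (use sa P in \<open>auto simp: B'_def\<close>)
  define M where "M = max b (norm B)"
  have "op_between 0 B M" "op_between 0 B' M"
    using op_between_weaken[OF op_between_positive[OF B]] op_between_weaken[OF B'ab] a by (auto simp: M_def)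
  moreover have "B o\<^sub>L P = B' o\<^sub>L P"
    using op_projection_idem[OF P] PBP by (simp add: B'_def blinfun_compose_bilinear) (metis blinfun_compose_assoc)
  ultimately have cong: "cfc rf B o\<^sub>L P = cfc rf B' o\<^sub>L P"
    using continuous_on_rf_subset[of 0 M] PB by (intro cfc_compose_cong) auto
  have cont: "continuous_on {a..b} rf" using a by (intro continuous_on_rf_subset) auto
  have f_low: "rf a *\<^sub>R id_blinfun \<sqsubseteq> cfc rf B'" and f_up: "cfc rf B' \<sqsubseteq> rf b *\<^sub>R id_blinfun"
    using cfc_mono[OF B'ab continuous_on_const cont, of "rf a"] cfc_mono[OF B'ab cont continuous_on_const, of "rf b"]
      a rf_mono[of a] rf_mono[of _ b] by (auto simp: cfc_const[OF B'ab])
  define D where "D = T - cfc rf B"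
  have Dsa: "D \<in> sa_ops" using T cfc_sa[OF op_between_positive[OF B] continuous_on_rf_subset] by (auto simp: D_def)
  have PD: "P o\<^sub>L D = D o\<^sub>L P"
    using mean_commutes_projection[OF _ B P _ PB, of id_blinfun]
      cfc_commute[OF op_between_positive[OF B] continuous_on_rf_subset PB]
    by (simp add: D_def T_def blinfun_compose_bilinear)
  have T_q: "rf a * (norm (P x))\<^sup>2 \<le> T (P x) \<bullet> P x" "T (P x) \<bullet> P x \<le> rf b * (norm (P x))\<^sup>2" for x
    using op_leD[OF T_low, of "P x"] op_leD[OF T_up, of "P x"] P
    by (simp_all add: blinfun.bilinear_simps power2_norm_eq_inner sa_ops_sym)
  have f_q: "rf a * (norm (P x))\<^sup>2 \<le> cfc rf B (P x) \<bullet> P x" "cfc rf B (P x) \<bullet> P x \<le> rf b * (norm (P x))\<^sup>2" for x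
    using op_leD[OF f_low, of "P x"] op_leD[OF f_up, of "P x"] cong
    by (simp_all add: blinfun.bilinear_simps power2_norm_eq_inner) (metis blinfun_apply_blinfun_compose)+
  have "norm (P o\<^sub>L D o\<^sub>L P) \<le> rf b - rf a"
  proof (rule sa_ops_norm_le)
    fix x
    have "(P o\<^sub>L D o\<^sub>L P) x \<bullet> x = D (P x) \<bullet> P x" using P by (simp add: sa_ops_sym)
    then have "\<bar>(P o\<^sub>L D o\<^sub>L P) x \<bullet> x\<bar> \<le> (rf b - rf a) * (norm (P x))\<^sup>2"
      using T_q[of x] f_q[of x] by (simp add: D_def blinfun.bilinear_simps inner_simps algebra_simps)
    also have "\<dots> \<le> (rf b - rf a) * (norm x)\<^sup>2" using le[of x] rf_mono[OF a] by (intro mult_left_mono) auto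
    finally show "\<bar>(P o\<^sub>L D o\<^sub>L P) x \<bullet> x\<bar> \<le> (rf b - rf a) * (norm x)\<^sup>2" .
  qed (use Dsa P rf_mono[OF a] in \<open>auto simp: sa_ops_sandwich\<close>)
  then have "norm ((P o\<^sub>L D o\<^sub>L P) (P x)) \<le> (rf b - rf a) * norm (P x)"
    by (meson mult_right_mono norm_blinfun norm_ge_zero order_trans)
  moreover have "(P o\<^sub>L D o\<^sub>L P) (P x) = D (P x)"
    using PD P by (metis blinfun_apply_blinfun_compose op_projection_idem_apply)
  ultimately show ?thesis by (simp add: D_def T_def)
qed

text \<open>
  Splitting along spectral projections reduces the identity to spectral subspaces of \<open>B\<close> on which
  the representing function varies little.
\<close>

lemma mean_id_eq_cfc:
  assumes B: "B \<in> positive_ops" shows "m id_blinfun B = cfc rf B"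
proof -
  define D where "D = m id_blinfun B - cfc rf B"
  have comm: "P o\<^sub>L D = D o\<^sub>L P" if P: "op_projection P" and PB: "P o\<^sub>L B = B o\<^sub>L P" for P
    using mean_commutes_projection[OF _ B P _ PB, of id_blinfun]
      cfc_commute[OF op_between_positive[OF B] continuous_on_rf_subset PB]
    by (simp add: D_def blinfun_compose_bilinear)
  \<comment> \<open>The guard \<open>0 \<le> a\<close> makes the predicate vacuous on intervals
    reaching below 0, over which the interval induction also quantifies.\<close>
  define good where "good e a b \<longleftrightarrow> (0 \<le> a \<longrightarrow> (\<forall>P. op_projection P \<longrightarrow> P o\<^sub>L B = B o\<^sub>L P \<longrightarrow>
      (\<forall>x. a * (norm (P x))\<^sup>2 \<le> B (P x) \<bullet> P x \<and> B (P x) \<bullet> P x \<le> b * (norm (P x))\<^sup>2) \<longrightarrow>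
      (\<forall>x. norm (D (P x)) \<le> e * norm (P x))))" for e a b :: real
  have good: "good e 0 (norm B)" if e: "0 < e" for e
    using norm_ge_zero[of B]
  proof (induction rule: Bolzano)
    case (trans a b c)
    show ?case unfolding good_def
    proof (intro allI impI)
      fix P x
      assume a: "0 \<le> a" and P: "op_projection P" and PB: "P o\<^sub>L B = B o\<^sub>L P"
        and bnd: "\<forall>x. a * (norm (P x))\<^sup>2 \<le> B (P x) \<bullet> P x \<and> B (P x) \<bullet> P x \<le> c * (norm (P x))\<^sup>2"
      \<comment> \<open>\<open>E\<close> cuts the subspace at the common end point \<open>b\<close>,
        so that \<open>P o\<^sub>L E\<close> and \<open>P o\<^sub>L Q\<close> satisfy the bounds of
        the two halves.\<close>
      obtain E where E0: "E \<in> positive_ops" "E o\<^sub>L E = E"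
        and Ecomm: "\<forall>D. D o\<^sub>L B = B o\<^sub>L D \<longrightarrow> D o\<^sub>L E = E o\<^sub>L D"
        and E_up: "\<forall>x. B (E x) \<bullet> E x \<le> b * (norm (E x))\<^sup>2"
        and E_low: "\<forall>x. b * (norm (x - E x))\<^sup>2 \<le> B (x - E x) \<bullet> (x - E x)"
        using spectral_projection[OF positive_ops_sa[OF B], of b] .
      have E: "op_projection E" using E0 unfolding op_projection_def by simp
      have EB: "E o\<^sub>L B = B o\<^sub>L E" using Ecomm[rule_format, of B] by simp
      have PE: "P o\<^sub>L E = E o\<^sub>L P" by (rule Ecomm[rule_format, OF PB])
      define Q where "Q = id_blinfun - E"
      have Q: "op_projection Q" using E by (simp add: Q_def op_projection_complement)
      have QB: "Q o\<^sub>L B = B o\<^sub>L Q" using EB by (simp add: Q_def blinfun_compose_bilinear)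
      have PQ: "P o\<^sub>L Q = Q o\<^sub>L P" using PE by (simp add: Q_def blinfun_compose_bilinear)
      have Qx: "Q y = y - E y" for y by (simp add: Q_def blinfun.bilinear_simps)
      have P1: "op_projection (P o\<^sub>L E)" "(P o\<^sub>L E) o\<^sub>L B = B o\<^sub>L (P o\<^sub>L E)"
        and P2: "op_projection (P o\<^sub>L Q)" "(P o\<^sub>L Q) o\<^sub>L B = B o\<^sub>L (P o\<^sub>L Q)"
      proof -
        show "op_projection (P o\<^sub>L E)" "op_projection (P o\<^sub>L Q)"
          by (intro op_projection_compose P E Q PE PQ)+
        show "(P o\<^sub>L E) o\<^sub>L B = B o\<^sub>L (P o\<^sub>L E)" using EB PB by (metis blinfun_compose_assoc)
        show "(P o\<^sub>L Q) o\<^sub>L B = B o\<^sub>L (P o\<^sub>L Q)" using QB PB by (metis blinfun_compose_assoc)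
      qed
      have PEx: "P (E y) = E (P y)" "P (Q y) = Q (P y)" for y
        using PE PQ by (metis blinfun_apply_blinfun_compose)+
      have "norm (D ((P o\<^sub>L E) x)) \<le> e * norm ((P o\<^sub>L E) x)" for x
      proof -
        have "a * (norm ((P o\<^sub>L E) x))\<^sup>2 \<le> B ((P o\<^sub>L E) x) \<bullet> (P o\<^sub>L E) x" for x
          using bnd by simp
        moreover have "B ((P o\<^sub>L E) x) \<bullet> (P o\<^sub>L E) x \<le> b * (norm ((P o\<^sub>L E) x))\<^sup>2" for x
          using E_up by (simp add: PEx)
        ultimately show ?thesis using trans(1) a P1 unfolding good_def by blast
      qed
      then have D1: "norm (D (E (P x))) \<le> e * norm (E (P x))" by (simp add: PEx)
      have "norm (D ((P o\<^sub>L Q) x)) \<le> e * norm ((P o\<^sub>L Q) x)" for x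
      proof -
        have "B ((P o\<^sub>L Q) x) \<bullet> (P o\<^sub>L Q) x \<le> c * (norm ((P o\<^sub>L Q) x))\<^sup>2" for x
          using bnd by simp
        moreover have "b * (norm ((P o\<^sub>L Q) x))\<^sup>2 \<le> B ((P o\<^sub>L Q) x) \<bullet> (P o\<^sub>L Q) x" for x
        proof -
          have "(P o\<^sub>L Q) x = P x - E (P x)" by (simp add: Qx blinfun.diff_right PEx(1))
          then show ?thesis using E_low by simp
        qed
        ultimately show ?thesis using trans(2) a trans(3) P2 unfolding good_def by (meson order_trans)
      qed
      then have D2: "norm (D (Q (P x))) \<le> e * norm (Q (P x))" by (simp add: PEx)
      \<comment> \<open>\<open>D\<close> commutes with \<open>E\<close> and \<open>Q\<close>, so
        squared norms of the two parts add and the same \<open>e\<close> survives the gluing; a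
        triangle inequality would lose a factor at each cut.\<close>
      have split: "(norm y)\<^sup>2 = (norm (E y))\<^sup>2 + (norm (Q y))\<^sup>2" for y
        using E sa_ops_sym[of E y y]
        by (simp add: Qx power2_norm_eq_inner inner_simps sa_ops_sym inner_commute)
      have "(norm (D (P x)))\<^sup>2 = (norm (D (E (P x))))\<^sup>2 + (norm (D (Q (P x))))\<^sup>2"
        using split[of "D (P x)"] comm[OF E EB] comm[OF Q QB] by (metis blinfun_apply_blinfun_compose)
      also have "\<dots> \<le> (e * norm (E (P x)))\<^sup>2 + (e * norm (Q (P x)))\<^sup>2"
        using D1 D2 by (intro add_mono power_mono) auto
      also have "\<dots> = (e * norm (P x))\<^sup>2"
        using split[of "P x"] by (simp add: power_mult_distrib distrib_left)
      finally show "norm (D (P x)) \<le> e * norm (P x)"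
        by (rule power2_le_imp_le) (use e in simp)
    qed
  next
    case (local x)
    obtain d where d: "0 < d" "\<And>y. 0 \<le> y \<Longrightarrow> dist y x < d \<Longrightarrow> dist (rf y) (rf x) < e / 2"
      using continuous_on_rf local(1) e unfolding continuous_on_iff by (metis atLeast_iff half_gt_zero)
    show ?case
    proof (intro exI[of _ d] conjI allI impI)
      fix a b assume ab: "a \<le> x \<and> x \<le> b \<and> b - a < d"
      show "good e a b" unfolding good_def
      proof (intro allI impI)
        fix P y
        assume a: "0 \<le> a" and P: "op_projection P" and PB: "P o\<^sub>L B = B o\<^sub>L P"
          and bnd: "\<forall>x. a * (norm (P x))\<^sup>2 \<le> B (P x) \<bullet> P x \<and> B (P x) \<bullet> P x \<le> b * (norm (P x))\<^sup>2"
        have "dist (rf a) (rf x) < e / 2" "dist (rf b) (rf x) < e / 2"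
          by (rule d(2); use ab a in \<open>auto simp: dist_real_def\<close>)+
        then have "rf b - rf a \<le> e" unfolding dist_real_def by linarith
        then have "(rf b - rf a) * norm (P y) \<le> e * norm (P y)" by (intro mult_right_mono) auto
        moreover have "norm (D (P y)) \<le> (rf b - rf a) * norm (P y)"
          unfolding D_def using ab a bnd by (intro compression_estimate[OF B P PB]) auto
        ultimately show "norm (D (P y)) \<le> e * norm (P y)" by linarith
      qed
    qed (rule d)
  qed
  have "norm (D x) \<le> e * norm x" if "0 < e" for e x
  proof -
    have "B x \<bullet> x \<le> norm B * (norm x)\<^sup>2" for x using inner_le_norm[of B x] by simp
    then have "norm (D (id_blinfun x)) \<le> e * norm (id_blinfun x)"
      by (intro good[OF that, unfolded good_def, rule_format]) (use B in auto)
    then show ?thesis by simp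
  qed
  then have "norm D \<le> 0 + e" if "0 < e" for e using that by (intro norm_blinfun_bound) auto
  then have "norm D \<le> 0" by (rule field_le_epsilon)
  then show ?thesis by (simp add: D_def)
qed


section \<open>The Kubo-Ando formula and uniqueness of the representing function\<close>

lemma mean_formula:
  assumes A: "A \<in> positive_inv_ops" and B: "B \<in> positive_inv_ops"
  shows "m A B = op_powr A (1/2) o\<^sub>L cfc rf (op_powr A (-1/2) o\<^sub>L B o\<^sub>L op_powr A (-1/2)) o\<^sub>L op_powr A (1/2)"
proof -
  define S R where "S = op_powr A (1/2)" and "R = op_powr A (-1/2)"
  note SR = op_powr_half[OF A, folded S_def R_def]
  have "S o\<^sub>L (R o\<^sub>L B o\<^sub>L R) o\<^sub>L S = B" using SR(4,5) by (metis blinfun_compose_assoc blinfun_compose_id)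
  moreover have "S o\<^sub>L id_blinfun o\<^sub>L S = A" using SR(3) by simp
  moreover have pos: "R o\<^sub>L B o\<^sub>L R \<in> positive_ops" using SR(2) B by simp
  ultimately have "m A B = S o\<^sub>L m id_blinfun (R o\<^sub>L B o\<^sub>L R) o\<^sub>L S"
    using mean_congruence[OF _ pos SR(1), of id_blinfun] by simp
  then show ?thesis using mean_id_eq_cfc[OF pos] by (simp add: S_def R_def)
qed

lemma mean_sot_limit:
  assumes A: "A \<in> positive_ops" and B: "B \<in> positive_ops"
  shows "sot_tendsto (\<lambda>\<epsilon>. m (A + \<epsilon> *\<^sub>R id_blinfun) (B + \<epsilon> *\<^sub>R id_blinfun)) (m A B) (at_right 0)"
proof (rule sot_tendsto_at_rightI)
  fix s t :: real assume "0 < s" "s \<le> t"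
  then show "m (A + s *\<^sub>R id_blinfun) (B + s *\<^sub>R id_blinfun) \<sqsubseteq> m (A + t *\<^sub>R id_blinfun) (B + t *\<^sub>R id_blinfun)"
    using A B by (intro mean_mono op_le_add op_le_refl op_le_scaleR_left) auto
next
  have "decreases_to (\<lambda>n. m (A + (1 / real (Suc n)) *\<^sub>R id_blinfun) (B + (1 / real (Suc n)) *\<^sub>R id_blinfun)) (m A B)"
    using A B by (intro mean_continuous decreases_to_add_scaled_id) auto
  then show "sot_tendsto (\<lambda>n. m (A + (1 / real (Suc n)) *\<^sub>R id_blinfun) (B + (1 / real (Suc n)) *\<^sub>R id_blinfun)) (m A B) sequentially"
    by (simp add: decreases_to_def)
qed (use A B in auto)

lemma represents_rf: "represents rf m"
  unfolding represents_def operator_monotone_def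
proof (intro conjI ballI impI allI)
  fix A B :: "'a \<Rightarrow>\<^sub>L 'a" assume "A \<in> positive_ops" "B \<in> positive_ops" "A \<sqsubseteq> B"
  then show "cfc rf A \<sqsubseteq> cfc rf B"
    using mean_mono[of id_blinfun A id_blinfun B] by (simp add: mean_id_eq_cfc)
qed (use rf_nonneg continuous_on_rf mean_formula mean_sot_limit in auto)

text \<open>At positive arguments the formula is evaluated at the identity and a multiple of it; at
  0 both functions are limits of these values.\<close>

lemma represents_unique:
  assumes g: "represents g m" and t: "0 \<le> t"
  shows "g t = rf t"
proof -
  have pos: "g s = rf s" if s: "0 < s" for s
  proof -
    have "m id_blinfun (s *\<^sub>R id_blinfun) = cfc g (s *\<^sub>R id_blinfun)"
      using g positive_inv_scaled_id[OF s, where 'a = 'a] positive_inv_id[where 'a = 'a]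
      unfolding represents_def by (simp add: op_powr_id)
    also have "\<dots> = g s *\<^sub>R id_blinfun" by (rule cfc_scaled_id)
    finally have "rf s *\<^sub>R (id_blinfun :: 'a \<Rightarrow>\<^sub>L 'a) = g s *\<^sub>R id_blinfun" using s by (simp add: mean_scaled_id)
    then show ?thesis by simp
  qed
  show ?thesis
  proof (cases "t = 0")
    case True
    have cont: "continuous_on {0..} g" using g by (simp add: represents_def operator_monotone_def)
    have lim: "(\<lambda>n. 1 / real (Suc n)) \<longlonglongrightarrow> 0" by (rule LIMSEQ_Suc[OF lim_1_over_n])
    have "(\<lambda>n. g (1 / real (Suc n))) \<longlonglongrightarrow> g 0"
      by (rule continuous_on_tendsto_compose[OF cont lim]) auto
    then have "(\<lambda>n. rf (1 / real (Suc n))) \<longlonglongrightarrow> g 0" using pos by simp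
    then show ?thesis using rf_tendsto_0 LIMSEQ_unique True by blast
  qed (use pos t in auto)
qed

lemma rep_fun_eq: "rep_fun m = rf"
  unfolding rep_fun_def
proof (rule the_equality)
  have ext: "rf \<in> extensional {0..}" by (simp add: rf_def)
  then show "rf \<in> extensional {0..} \<and> represents rf m" using represents_rf by simp
  fix g assume "g \<in> extensional {0..} \<and> represents g m"
  then show "g = rf" using ext represents_unique by (intro extensionalityI[of g "{0..}" rf]) auto
qed

lemma scalar_mean_eq: "scalar_mean m a b = a * rf (b / a)"
  by (simp add: scalar_mean_def rep_fun_eq)

lemma mean_le_scaled_id:
  assumes "A \<in> positive_ops" "B \<in> positive_ops" "A \<sqsubseteq> c *\<^sub>R id_blinfun" "B \<sqsubseteq> c *\<^sub>R id_blinfun" "0 < c"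
  shows "m A B \<sqsubseteq> c *\<^sub>R id_blinfun"
  using mean_mono[OF assms(1-4)] mean_scaleR[of id_blinfun id_blinfun c] assms(5) by simp

lemma mean_ge_scaled_id:
  assumes "c *\<^sub>R id_blinfun \<sqsubseteq> A" "c *\<^sub>R id_blinfun \<sqsubseteq> B" "0 < c"
  shows "c *\<^sub>R id_blinfun \<sqsubseteq> m A B"
  using mean_mono[OF _ _ assms(1,2)] mean_scaleR[of id_blinfun id_blinfun c] assms(3) by simp

lemma mean_positive_inv [simp, intro]:
  assumes "A \<in> positive_inv_ops" "B \<in> positive_inv_ops" shows "m A B \<in> positive_inv_ops"
proof -
  obtain c d where cd: "0 < c" "c *\<^sub>R id_blinfun \<sqsubseteq> A" "0 < d" "d *\<^sub>R id_blinfun \<sqsubseteq> B"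
    using assms positive_inv_iff by blast
  have "min c d *\<^sub>R id_blinfun \<sqsubseteq> A" "min c d *\<^sub>R id_blinfun \<sqsubseteq> B"
    using cd op_le_scaleR_left[of id_blinfun "min c d" c] op_le_scaleR_left[of id_blinfun "min c d" d]
    by (auto intro: op_le_trans)
  then have "min c d *\<^sub>R id_blinfun \<sqsubseteq> m A B" using cd by (intro mean_ge_scaled_id) auto
  moreover have "min c d *\<^sub>R id_blinfun \<in> positive_inv_ops" using cd by simp
  ultimately show ?thesis using positive_inv_ge by blast
qed


subsection \<open>Strict monotonicity of the representing function\<close>

lemma mean_two_valued:
  assumes P: "op_projection P" and z: "0 \<le> z" and s: "0 \<le> s"
  shows "m id_blinfun (z *\<^sub>R P + s *\<^sub>R (id_blinfun - P)) = rf z *\<^sub>R P + rf s *\<^sub>R (id_blinfun - P)"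
proof -
  define Q where "Q = id_blinfun - P"
  have Q: "op_projection Q" using P by (simp add: Q_def op_projection_complement)
  define B where "B = z *\<^sub>R P + s *\<^sub>R Q"
  have B: "B \<in> positive_ops" using P Q z s by (auto simp: B_def)
  define M where "M = max (norm B) (max z s)"
  have BM: "op_between 0 B M" using op_between_weaken[OF op_between_positive[OF B], of 0 M] by (simp add: M_def)
  have iM: "op_between 0 (r *\<^sub>R id_blinfun) M" if "0 \<le> r" "r \<le> M" for r
    using op_between_weaken[OF op_between_scaled_id[of r], of 0 M] that by simp
  have PQ: "P o\<^sub>L Q = 0" "Q o\<^sub>L P = 0" using op_projection_idem[OF P] by (simp_all add: Q_def blinfun_compose_bilinear)
  have cont: "continuous_on {0..M} rf" by (rule continuous_on_rf_subset) simp
  have "cfc rf B o\<^sub>L P = cfc rf (z *\<^sub>R id_blinfun) o\<^sub>L P"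
    using z PQ op_projection_idem[OF P]
    by (intro cfc_compose_cong[OF BM iM cont]) (auto simp: B_def M_def blinfun_compose_bilinear)
  moreover have "cfc rf B o\<^sub>L Q = cfc rf (s *\<^sub>R id_blinfun) o\<^sub>L Q"
    using s PQ op_projection_idem[OF Q]
    by (intro cfc_compose_cong[OF BM iM cont]) (auto simp: B_def M_def blinfun_compose_bilinear)
  moreover have "cfc rf B = (cfc rf B o\<^sub>L P) + (cfc rf B o\<^sub>L Q)"
    by (simp add: Q_def blinfun_compose_bilinear)
  ultimately have "cfc rf B = rf z *\<^sub>R P + rf s *\<^sub>R Q"
    using z s by (simp add: cfc_scaled_id blinfun_compose_bilinear)
  then show ?thesis using mean_id_eq_cfc[OF B] by (simp add: B_def Q_def)
qed

text \<open>By \<open>close\<close> the gaps absorb the tilt between the two lines, so the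
  two-valued operators are ordered. After applying the mean, both equal \<open>rf s\<close> off
  their lines because of \<open>flat\<close>; these identity parts cancel and only rank-one forms
  remain.\<close>

lemma two_valued_comparison:
  fixes p q :: 'a
  assumes pq: "norm p = 1" "norm q = 1" and z: "0 \<le> z1" and s: "0 \<le> s"
    and close: "4 * norm (p - q) * \<bar>z1 - s\<bar> \<le> min (z2 - z1) (t - s)" and lt: "z1 < z2" "s < t"
    and flat: "rf s = rf t"
  shows "(rf z1 - rf s) * (rank_one_proj q x \<bullet> x) \<le> (rf z2 - rf s) * (rank_one_proj p x \<bullet> x)"
proof -
  define P P' where "P = rank_one_proj p" and "P' = rank_one_proj q"
  have P: "op_projection P" "op_projection P'" using pq by (auto simp: P_def P'_def rank_one_proj_projection)
  have q: "(a *\<^sub>R E + b *\<^sub>R (id_blinfun - E)) y \<bullet> y = a * (E y \<bullet> y) + b * ((norm y)\<^sup>2 - E y \<bullet> y)" for a b E and y :: 'a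
    by (simp add: blinfun.bilinear_simps inner_simps power2_norm_eq_inner algebra_simps)
  have "z1 *\<^sub>R P' + s *\<^sub>R (id_blinfun - P') \<sqsubseteq> z2 *\<^sub>R P + t *\<^sub>R (id_blinfun - P)"
  proof (rule op_leI)
    fix y :: 'a
    define n where "n = (norm y)\<^sup>2"
    have n: "0 \<le> P y \<bullet> y" "P y \<bullet> y \<le> n"
      using P(1) op_projection_norm_le[OF P(1), of y] by (auto simp: n_def op_projection_inner intro: power_mono)
    have "\<bar>(z1 - s) * (P y \<bullet> y - P' y \<bullet> y)\<bar> \<le> \<bar>z1 - s\<bar> * (4 * norm (p - q) * n)"
      unfolding abs_mult P_def P'_def n_def by (intro mult_left_mono rank_one_proj_diff_le pq) auto
    also have "\<dots> = (4 * norm (p - q) * \<bar>z1 - s\<bar>) * n" by simp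
    also have "\<dots> \<le> min (z2 - z1) (t - s) * n" using close by (intro mult_right_mono) (auto simp: n_def)
    also have "\<dots> = min (z2 - z1) (t - s) * (P y \<bullet> y) + min (z2 - z1) (t - s) * (n - P y \<bullet> y)"
      by (simp add: algebra_simps)
    also have "\<dots> \<le> (z2 - z1) * (P y \<bullet> y) + (t - s) * (n - P y \<bullet> y)"
      using n by (intro add_mono mult_right_mono) auto
    finally have "- ((z1 - s) * (P y \<bullet> y - P' y \<bullet> y)) \<le> (z2 - z1) * (P y \<bullet> y) + (t - s) * (n - P y \<bullet> y)"
      by linarith
    then show "(z1 *\<^sub>R P' + s *\<^sub>R (id_blinfun - P')) y \<bullet> y \<le> (z2 *\<^sub>R P + t *\<^sub>R (id_blinfun - P)) y \<bullet> y"
      unfolding q n_def[symmetric] by (simp add: algebra_simps)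
  qed (use P in auto)
  moreover have "z1 *\<^sub>R P' + s *\<^sub>R (id_blinfun - P') \<in> positive_ops"
    using P z s op_projection_complement[of P'] by auto
  ultimately have "m id_blinfun (z1 *\<^sub>R P' + s *\<^sub>R (id_blinfun - P')) \<sqsubseteq> m id_blinfun (z2 *\<^sub>R P + t *\<^sub>R (id_blinfun - P))"
    by (intro mean_mono) auto
  then have "rf z1 *\<^sub>R P' + rf s *\<^sub>R (id_blinfun - P') \<sqsubseteq> rf z2 *\<^sub>R P + rf s *\<^sub>R (id_blinfun - P)"
    using z s lt flat by (simp add: mean_two_valued P)
  from op_leD[OF this, of x] show ?thesis
    unfolding q P_def P'_def by (simp add: algebra_simps)
qed

text \<open>\<open>q\<close> is \<open>u\<close> rotated by a small angle towards \<open>v\<close>;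
  the test vector \<open>v\<close> is orthogonal to the line of \<open>u\<close> but not to that of
  \<open>q\<close>.\<close>

lemma close_rank_one_pair:
  assumes "0 < \<eta>"
  obtains p q x :: 'a where "norm p = 1" "norm q = 1" "norm (p - q) < \<eta>"
    "rank_one_proj p x \<bullet> x = 0" "0 < rank_one_proj q x \<bullet> x"
proof -
  obtain u v :: 'a where uv: "norm u = 1" "norm v = 1" "u \<bullet> v = 0" "u \<bullet> (\<i> *\<^sub>C v) = 0"
    using orthonormal_pair .
  have "((\<lambda>\<theta>. \<bar>1 - cos \<theta>\<bar> + \<bar>sin \<theta>\<bar>) \<longlongrightarrow> \<bar>1 - cos 0\<bar> + \<bar>sin 0\<bar>) (at_right (0::real))"
    by (intro tendsto_intros)
  then have "\<forall>\<^sub>F \<theta> in at_right 0. \<bar>1 - cos \<theta>\<bar> + \<bar>sin \<theta>\<bar> < \<eta>"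
    using assms by (intro order_tendstoD(2)) auto
  moreover have "\<forall>\<^sub>F \<theta> in at_right (0::real). 0 < \<theta> \<and> \<theta> < 1"
    by (auto simp: eventually_at_right_field intro: exI[of _ 1])
  ultimately have "\<forall>\<^sub>F \<theta> in at_right 0. \<bar>1 - cos \<theta>\<bar> + \<bar>sin \<theta>\<bar> < \<eta> \<and> 0 < \<theta> \<and> \<theta> < 1"
    by (rule eventually_conj)
  then obtain \<theta> where \<theta>: "\<bar>1 - cos \<theta>\<bar> + \<bar>sin \<theta>\<bar> < \<eta>" "0 < \<theta>" "\<theta> < 1"
    using eventually_happens'[OF trivial_limit_at_right_real] by blast
  define q where "q = cos \<theta> *\<^sub>R u + sin \<theta> *\<^sub>R v"
  have sin: "0 < sin \<theta>" using \<theta> pi_gt3 by (intro sin_gt_zero) auto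
  have "q \<bullet> q = 1"
    using uv sin_cos_squared_add2[of \<theta>] by (simp add: q_def inner_simps inner_commute norm_eq_1 power2_eq_square)
  moreover have "norm (u - q) < \<eta>"
  proof -
    have "u - q = (1 - cos \<theta>) *\<^sub>R u - sin \<theta> *\<^sub>R v" by (simp add: q_def algebra_simps)
    then have "norm (u - q) \<le> \<bar>1 - cos \<theta>\<bar> + \<bar>sin \<theta>\<bar>"
      using norm_triangle_ineq4[of "(1 - cos \<theta>) *\<^sub>R u" "sin \<theta> *\<^sub>R v"] uv by simp
    then show ?thesis using \<theta>(1) by linarith
  qed
  moreover have "rank_one_proj u v \<bullet> v = 0"
    unfolding rank_one_proj_inner using uv inner_imaginary_unit[of u v] by (simp add: inner_commute)
  moreover have "0 < rank_one_proj q v \<bullet> v"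
  proof -
    have "v \<bullet> q = sin \<theta>" using uv by (simp add: q_def inner_simps inner_commute norm_eq_1)
    then show ?thesis using sin unfolding rank_one_proj_inner by (simp add: add_pos_nonneg)
  qed
  ultimately show ?thesis using that[of u q v] uv by (simp add: norm_eq_1)
qed

text \<open>
  If the representing function were constant on an interval but not everywhere, rotating the
  eigenprojections of two-valued operators slightly would violate operator monotonicity.
\<close>

lemma rf_flat_imp_constant:
  assumes s: "0 \<le> s" "s < t" and flat: "rf s = rf t" and z: "0 < z"
  shows "rf z = rf s"
proof -
  have pair: "\<exists>p q x :: 'a. norm p = 1 \<and> norm q = 1 \<and> 4 * norm (p - q) * K \<le> d \<and>
      rank_one_proj p x \<bullet> x = 0 \<and> 0 < rank_one_proj q x \<bullet> x" if Kd: "0 \<le> K" "0 < d" for K d :: real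
  proof -
    have "0 < d / (4 * (K + 1))" using Kd by simp
    then obtain p q x :: 'a where *: "norm p = 1" "norm q = 1" "norm (p - q) < d / (4 * (K + 1))"
      "rank_one_proj p x \<bullet> x = 0" "0 < rank_one_proj q x \<bullet> x" by (rule close_rank_one_pair)
    have "4 * norm (p - q) * K \<le> 4 * norm (p - q) * (K + 1)" by (simp add: mult_left_mono)
    also have "\<dots> \<le> d" using *(3) Kd by (simp add: field_simps)
    finally show ?thesis using * by blast
  qed
  consider "z < s" | "s \<le> z" "z \<le> t" | "t < z" by linarith
  then show ?thesis
  proof cases
    case 1
    \<comment> \<open>\<open>z / 2\<close> is just some smaller nonnegative point. The roles of
      \<open>p\<close> and \<open>q\<close> are swapped below, so that the test vector kills the
      term of the smaller operator.\<close>
    obtain p q x :: 'a where pq: "norm p = 1" "norm q = 1" "4 * norm (p - q) * \<bar>z / 2 - s\<bar> \<le> min (z - z / 2) (t - s)"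
      and x: "rank_one_proj p x \<bullet> x = 0" "0 < rank_one_proj q x \<bullet> x"
      using pair[of "\<bar>z / 2 - s\<bar>" "min (z - z / 2) (t - s)"] s z by auto
    have "0 \<le> (rf z - rf s) * (rank_one_proj q x \<bullet> x)"
      using two_valued_comparison[of q p "z / 2" s z t x] pq s z flat x by (simp add: norm_minus_commute)
    then have "rf s \<le> rf z" using x(2) by (simp add: zero_le_mult_iff)
    then show ?thesis using rf_mono[of z s] 1 z by auto
  next
    case 2
    then show ?thesis using rf_mono[of s z] rf_mono[of z t] s flat by auto
  next
    case 3
    \<comment> \<open>\<open>z + 1\<close> is just some larger point; the test vector kills its
      term.\<close>
    obtain p q x :: 'a where pq: "norm p = 1" "norm q = 1" "4 * norm (p - q) * \<bar>z - s\<bar> \<le> min ((z + 1) - z) (t - s)"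
      and x: "rank_one_proj p x \<bullet> x = 0" "0 < rank_one_proj q x \<bullet> x"
      using pair[of "\<bar>z - s\<bar>" "min ((z + 1) - z) (t - s)"] s z by auto
    have "(rf z - rf s) * (rank_one_proj q x \<bullet> x) \<le> 0"
      using two_valued_comparison[of p q z s "z + 1" t x] pq s z flat x by simp
    then have "rf z \<le> rf s" using x(2) by (simp add: mult_le_0_iff)
    then show ?thesis using rf_mono[of t z] 3 s flat by auto
  qed
qed

text \<open>A flat piece makes \<open>rf\<close> equal to \<open>rf 1 = 1\<close> at all positive
  points. The formula then yields \<open>m A B = A\<close> on invertible operators, and the strong
  limit extends this to all positive ones.\<close>

lemma rf_strict_mono:
  assumes nontriv: "\<not> same_mean m left_trivial_mean" and st: "0 \<le> s" "s < t"
  shows "rf s < rf t"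
proof (rule ccontr)
  assume "\<not> rf s < rf t"
  then have "rf s = rf t" using rf_mono[of s t] st by simp
  then have "rf z = rf s" if "0 < z" for z using rf_flat_imp_constant[OF st] that by blast
  then have one: "rf z = 1" if "0 < z" for z using that rf_1 by (metis zero_less_one)
  have inv: "m A B = A" if A: "A \<in> positive_inv_ops" and B: "B \<in> positive_inv_ops" for A B
  proof -
    define S R where "S = op_powr A (1/2)" and "R = op_powr A (-1/2)"
    note SR = op_powr_half[OF A, folded S_def R_def]
    have "R o\<^sub>L B o\<^sub>L R \<in> positive_inv_ops" using positive_inv_sandwich B SR(2) by blast
    then obtain c M where c: "0 < c" and bt: "op_between c (R o\<^sub>L B o\<^sub>L R) M"
      using positive_inv_op_between by metis
    have "cfc rf (R o\<^sub>L B o\<^sub>L R) = id_blinfun"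
      using cfc_cong[OF bt continuous_on_rf_subset, of "\<lambda>_. 1"] cfc_const[OF bt, of 1] c one by simp
    then show ?thesis using mean_formula[OF A B] SR(3) by (simp add: S_def R_def)
  qed
  have "m A B = A" if A: "A \<in> positive_ops" and B: "B \<in> positive_ops" for A B
  proof (rule sot_tendsto_unique[OF _ mean_sot_limit[OF A B]])
    have "((\<lambda>\<epsilon>. A + \<epsilon> *\<^sub>R id_blinfun) \<longlongrightarrow> A + 0 *\<^sub>R id_blinfun) (at_right 0)" by (intro tendsto_intros)
    then have lim: "sot_tendsto (\<lambda>\<epsilon>. A + \<epsilon> *\<^sub>R id_blinfun) A (at_right 0)" by (intro norm_tendsto_imp_sot) simp
    have ev: "\<forall>\<^sub>F \<epsilon> in at_right 0. m (A + \<epsilon> *\<^sub>R id_blinfun) (B + \<epsilon> *\<^sub>R id_blinfun) = A + \<epsilon> *\<^sub>R id_blinfun"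
      using eventually_at_right_less[of 0] by eventually_elim (use A B inv positive_inv_add in blast)
    show "sot_tendsto (\<lambda>\<epsilon>. m (A + \<epsilon> *\<^sub>R id_blinfun) (B + \<epsilon> *\<^sub>R id_blinfun)) A (at_right 0)"
      using lim unfolding sot_tendsto_cong[OF ev] .
  qed simp
  then show False using nontriv by (simp add: same_mean_def left_trivial_mean_def)
qed

text \<open>Homogeneity moves the scaling of \<open>X\<close> to \<open>A\<close>, with factor
  \<open>k = 1 / \<alpha>\<close>. The quotient of \<open>rf (k * s)\<close> by \<open>rf s\<close>
  exceeds 1, and its minimum over \<open>{a..b}\<close> is the gain \<open>1 + d\<close>.\<close>

lemma mean_strict_scaling:
  assumes nontriv: "\<not> same_mean m left_trivial_mean" and X: "X \<in> positive_inv_ops" and A: "A \<in> positive_inv_ops"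
    and \<alpha>: "0 < \<alpha>" "\<alpha> < 1"
  obtains d where "0 < d" "(\<alpha> * (1 + d)) *\<^sub>R m X A \<sqsubseteq> m (\<alpha> *\<^sub>R X) A"
proof -
  define S R where "S = op_powr X (1/2)" and "R = op_powr X (-1/2)"
  note SR = op_powr_half[OF X, folded S_def R_def]
  define B where "B = R o\<^sub>L A o\<^sub>L R"
  define k where "k = 1 / \<alpha>"
  have k: "1 < k" using \<alpha> by (simp add: k_def)
  have B: "B \<in> positive_inv_ops" unfolding B_def using positive_inv_sandwich A SR(2) by blast
  then obtain a b where a: "0 < a" "a \<le> b" and bt: "op_between a B b" using positive_inv_op_between by metis
  have cont: "continuous_on {a..b} rf" using a by (intro continuous_on_rf_subset) auto
  have contk: "continuous_on {a..b} (\<lambda>s. rf (k * s))"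
    using a k by (intro continuous_on_compose2[OF continuous_on_rf]) (auto intro!: continuous_intros)
  have pos: "0 < rf s" if "s \<in> {a..b}" for s using that a by (intro rf_pos) auto
  have "continuous_on {a..b} (\<lambda>s. rf (k * s) / rf s)"
    by (rule continuous_on_divide[OF contk cont]) (use pos in force)
  then obtain s0 where s0: "s0 \<in> {a..b}" "\<And>s. s \<in> {a..b} \<Longrightarrow> rf (k * s0) / rf s0 \<le> rf (k * s) / rf s"
    using continuous_attains_inf[OF compact_Icc, of a b] a by fastforce
  define d where "d = rf (k * s0) / rf s0 - 1"
  have "rf s0 < rf (k * s0)" using s0(1) a k by (intro rf_strict_mono[OF nontriv]) auto
  then have d: "0 < d" using pos[OF s0(1)] by (simp add: d_def)
  have le: "(1 + d) * rf s \<le> rf (k * s)" if "s \<in> {a..b}" for s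
    using s0(2)[OF that] pos[OF that] by (simp add: d_def field_simps)
  have "(1 + d) *\<^sub>R cfc rf B = cfc (\<lambda>s. (1 + d) * rf s) B" by (rule cfc_scaleR[OF bt cont, symmetric])
  also have "\<dots> \<sqsubseteq> cfc (\<lambda>s. rf (k * s)) B"
    by (rule cfc_mono[OF bt _ contk le]) (intro continuous_intros cont)
  also have "\<dots> = cfc rf (k *\<^sub>R B)"
    using a k by (intro cfc_scaleR_arg[OF bt, symmetric] continuous_on_rf_subset) auto
  finally have "S o\<^sub>L ((1 + d) *\<^sub>R cfc rf B) o\<^sub>L S \<sqsubseteq> S o\<^sub>L cfc rf (k *\<^sub>R B) o\<^sub>L S"
    using SR(1) by (intro op_le_sandwich) auto
  moreover have "m X A = S o\<^sub>L cfc rf B o\<^sub>L S" using mean_formula[OF X A] by (simp add: S_def R_def B_def)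
  moreover have "m X (k *\<^sub>R A) = S o\<^sub>L cfc rf (k *\<^sub>R B) o\<^sub>L S"
    using mean_formula[OF X positive_inv_scaleR[OF A, of k]] k
    by (simp add: S_def R_def B_def blinfun_compose_bilinear)
  ultimately have "\<alpha> *\<^sub>R ((1 + d) *\<^sub>R m X A) \<sqsubseteq> \<alpha> *\<^sub>R m X (k *\<^sub>R A)"
    using \<alpha> by (intro op_le_scaleR) (auto simp: blinfun_compose_bilinear)
  moreover have "m (\<alpha> *\<^sub>R X) A = \<alpha> *\<^sub>R m X (k *\<^sub>R A)"
    using mean_scaleR[of X "k *\<^sub>R A" \<alpha>] X A \<alpha> k by (simp add: k_def)
  ultimately show ?thesis using that[OF d] by simp
qed

end


subsection \<open>The fixed point equation\<close>

lemma positive_inv_scale_le: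
  assumes X: "X \<in> positive_ops" and Y: "Y \<in> positive_inv_ops"
  obtains \<alpha> where "0 < \<alpha>" "\<alpha> *\<^sub>R X \<sqsubseteq> Y"
proof -
  obtain c where c: "0 < c" "c *\<^sub>R id_blinfun \<sqsubseteq> Y" using Y positive_inv_iff by blast
  define M where "M = norm X + 1"
  have M: "0 < M" by (simp add: M_def add_nonneg_pos)
  have "X \<sqsubseteq> M *\<^sub>R id_blinfun" using X by (intro op_le_norm) (auto simp: M_def)
  then have "(c / M) *\<^sub>R X \<sqsubseteq> (c / M) *\<^sub>R (M *\<^sub>R id_blinfun)" using c M by (intro op_le_scaleR) auto
  also have "\<dots> \<sqsubseteq> Y" using c M by simp
  finally show ?thesis using that[of "c / M"] c M by simp
qed

text \<open>Ensures that the largest factor in the comparison is attained. The claim is one about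
  reals for each vector, the vanishing form being the case in which division fails.\<close>

lemma Sup_scale_le:
  assumes X: "X \<in> positive_ops" and Y: "Y \<in> sa_ops" and L: "L \<noteq> {}" and le: "\<And>\<alpha>. \<alpha> \<in> L \<Longrightarrow> \<alpha> *\<^sub>R X \<sqsubseteq> Y"
  shows "Sup L *\<^sub>R X \<sqsubseteq> Y"
proof (rule op_leI)
  fix x
  have *: "\<alpha> * (X x \<bullet> x) \<le> Y x \<bullet> x" if "\<alpha> \<in> L" for \<alpha>
    using op_leD[OF le[OF that], of x] by (simp add: blinfun.bilinear_simps)
  have "Sup L * (X x \<bullet> x) \<le> Y x \<bullet> x"
  proof (cases "X x \<bullet> x = 0")
    case True
    then show ?thesis using * L by force
  next
    case False
    then have pos: "0 < X x \<bullet> x" using positive_ops_nonneg[OF X, of x] by linarith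
    then have "Sup L \<le> (Y x \<bullet> x) / (X x \<bullet> x)" using * by (intro cSup_least L) (simp add: pos_le_divide_eq)
    then show ?thesis using pos by (simp add: pos_le_divide_eq)
  qed
  then show "(Sup L *\<^sub>R X) x \<bullet> x \<le> Y x \<bullet> x" by (simp add: blinfun.bilinear_simps)
qed (use X Y in auto)

locale mean_deformation = T: op_mean \<tau> + S: op_mean \<sigma> for \<tau> \<sigma> :: "'a::complex_hilbert binop" +
  assumes nontrivial: "\<not> same_mean \<sigma> left_trivial_mean"
begin

abbreviation \<Phi> :: "('a \<Rightarrow>\<^sub>L 'a) \<Rightarrow> ('a \<Rightarrow>\<^sub>L 'a) \<Rightarrow> ('a \<Rightarrow>\<^sub>L 'a) \<Rightarrow> ('a \<Rightarrow>\<^sub>L 'a)" where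
  "\<Phi> A B X \<equiv> \<tau> (\<sigma> X A) (\<sigma> X B)"

lemma \<Phi>_mono:
  assumes "A \<in> positive_ops" "B \<in> positive_ops" "X \<in> positive_ops" "A \<sqsubseteq> A'" "B \<sqsubseteq> B'" "X \<sqsubseteq> X'"
  shows "\<Phi> A B X \<sqsubseteq> \<Phi> A' B' X'"
  using assms by (intro T.mean_mono S.mean_mono) auto

text \<open>
  If \<open>\<alpha> < 1\<close> is maximal with \<open>\<alpha> X \<sqsubseteq> Y\<close>, strict monotonicity of the representing function of
  \<open>\<sigma>\<close> yields \<open>\<alpha> (1 + d) X \<sqsubseteq> Y\<close> for some \<open>d > 0\<close>.
\<close>

lemma subsolution_le_supersolution:
  assumes A: "A \<in> positive_inv_ops" and B: "B \<in> positive_inv_ops"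
    and X: "X \<in> positive_inv_ops" and Y: "Y \<in> positive_inv_ops"
    and sub: "X \<sqsubseteq> \<Phi> A B X" and super: "\<Phi> A B Y \<sqsubseteq> Y"
  shows "X \<sqsubseteq> Y"
proof (rule ccontr)
  assume not_le: "\<not> X \<sqsubseteq> Y"
  define L where "L = {\<alpha>. 0 < \<alpha> \<and> \<alpha> *\<^sub>R X \<sqsubseteq> Y}"
  have lt1: "\<alpha> < 1" if "\<alpha> \<in> L" for \<alpha>
  proof (rule ccontr)
    assume "\<not> \<alpha> < 1"
    then have "1 *\<^sub>R X \<sqsubseteq> \<alpha> *\<^sub>R X" using X by (intro op_le_scaleR_left) auto
    then show False using that not_le op_le_trans by (auto simp: L_def)
  qed
  have ne: "L \<noteq> {}" using positive_inv_scale_le[of X Y] X Y by (auto simp: L_def)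
  have bdd: "bdd_above L" using lt1 by (intro bdd_aboveI[of _ 1]) (auto intro: less_imp_le)
  define \<alpha> where "\<alpha> = Sup L"
  have "\<alpha> *\<^sub>R X \<sqsubseteq> Y" unfolding \<alpha>_def using X Y by (intro Sup_scale_le ne) (auto simp: L_def)
  moreover have "0 < \<alpha>"
  proof -
    obtain \<beta> where "\<beta> \<in> L" using ne by blast
    then show ?thesis using cSup_upper[OF _ bdd, of \<beta>] by (auto simp: L_def \<alpha>_def)
  qed
  ultimately have \<alpha>L: "\<alpha> \<in> L" by (simp add: L_def)
  then have \<alpha>: "0 < \<alpha>" "\<alpha> < 1" "\<alpha> *\<^sub>R X \<sqsubseteq> Y" using lt1 by (auto simp: L_def)
  obtain d1 where d1: "0 < d1" "(\<alpha> * (1 + d1)) *\<^sub>R \<sigma> X A \<sqsubseteq> \<sigma> (\<alpha> *\<^sub>R X) A"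
    using S.mean_strict_scaling[OF nontrivial X A \<alpha>(1,2)] .
  obtain d2 where d2: "0 < d2" "(\<alpha> * (1 + d2)) *\<^sub>R \<sigma> X B \<sqsubseteq> \<sigma> (\<alpha> *\<^sub>R X) B"
    using S.mean_strict_scaling[OF nontrivial X B \<alpha>(1,2)] .
  \<comment> \<open>The smaller gain serves both arguments of \<open>\<tau>\<close>, whose
    homogeneity needs a common factor.\<close>
  define \<beta> where "\<beta> = \<alpha> * (1 + min d1 d2)"
  have \<beta>: "\<alpha> < \<beta>" "\<beta> \<le> \<alpha> * (1 + d1)" "\<beta> \<le> \<alpha> * (1 + d2)"
    using \<alpha> d1 d2 by (auto simp: \<beta>_def)
  have le: "\<beta> *\<^sub>R \<sigma> X A \<sqsubseteq> \<sigma> (\<alpha> *\<^sub>R X) A" "\<beta> *\<^sub>R \<sigma> X B \<sqsubseteq> \<sigma> (\<alpha> *\<^sub>R X) B"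
    using op_le_trans[OF op_le_scaleR_left[OF _ \<beta>(2), of "\<sigma> X A"] d1(2)]
      op_le_trans[OF op_le_scaleR_left[OF _ \<beta>(3), of "\<sigma> X B"] d2(2)] X A B by auto
  have "\<beta> *\<^sub>R X \<sqsubseteq> \<beta> *\<^sub>R \<Phi> A B X" using sub \<alpha> \<beta> by (intro op_le_scaleR) auto
  also have "\<dots> = \<tau> (\<beta> *\<^sub>R \<sigma> X A) (\<beta> *\<^sub>R \<sigma> X B)"
    using T.mean_scaleR[of "\<sigma> X A" "\<sigma> X B" \<beta>] X A B \<alpha> \<beta> by simp
  also have "\<dots> \<sqsubseteq> \<Phi> A B (\<alpha> *\<^sub>R X)" using X A B \<alpha> \<beta> by (intro T.mean_mono le) auto
  also have "\<dots> \<sqsubseteq> \<Phi> A B Y" using X A B \<alpha> by (intro \<Phi>_mono) auto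
  also have "\<dots> \<sqsubseteq> Y" by (rule super)
  finally have "\<beta> \<in> L" using \<alpha> \<beta> by (simp add: L_def)
  then have "\<beta> \<le> \<alpha>" unfolding \<alpha>_def by (rule cSup_upper[OF _ bdd])
  then show False using \<beta> by simp
qed

lemma solution_unique:
  assumes "A \<in> positive_inv_ops" "B \<in> positive_inv_ops" "X \<in> positive_inv_ops" "Y \<in> positive_inv_ops"
    and "X = \<Phi> A B X" "Y = \<Phi> A B Y"
  shows "X = Y"
  using assms subsolution_le_supersolution[of A B X Y] subsolution_le_supersolution[of A B Y X]
  by (metis op_le_antisym op_le_refl)

text \<open>The iteration descends because the continuity axiom speaks of decreasing sequences. The
  common lower bound \<open>a\<close> of both operators persists under \<open>\<Phi>\<close> and
  keeps the limit invertible.\<close>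

lemma solution_exists:
  assumes A: "A \<in> positive_inv_ops" and B: "B \<in> positive_inv_ops"
  shows "\<exists>X \<in> positive_inv_ops. X = \<Phi> A B X"
proof -
  obtain a1 a2 where a12: "0 < a1" "a1 *\<^sub>R id_blinfun \<sqsubseteq> A" "0 < a2" "a2 *\<^sub>R id_blinfun \<sqsubseteq> B"
    using A B positive_inv_iff by blast
  define a where "a = min a1 a2"
  have a: "0 < a" "a *\<^sub>R id_blinfun \<sqsubseteq> A" "a *\<^sub>R id_blinfun \<sqsubseteq> B"
    using a12 op_le_trans[OF op_le_scaleR_left[of id_blinfun a a1]] op_le_trans[OF op_le_scaleR_left[of id_blinfun a a2]]
    by (auto simp: a_def)
  \<comment> \<open>Dominating both norms makes \<open>b\<close> times the identity a supersolution;
    the summand \<open>a\<close> gives \<open>a \<le> b\<close> directly.\<close>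
  define b where "b = max (norm A) (norm B) + 1 + a"
  have b: "0 < b" "a \<le> b" "norm A \<le> b" "norm B \<le> b"
  proof -
    have "0 \<le> max (norm A) (norm B)" "norm A \<le> max (norm A) (norm B)" "norm B \<le> max (norm A) (norm B)"
      by (auto simp: le_max_iff_disj)
    then show "0 < b" "a \<le> b" "norm A \<le> b" "norm B \<le> b" using a(1) unfolding b_def by linarith+
  qed
  have Ab: "A \<sqsubseteq> b *\<^sub>R id_blinfun" "B \<sqsubseteq> b *\<^sub>R id_blinfun" using A B b by (auto intro: op_le_norm)
  define F where "F n = ((\<Phi> A B) ^^ n) (b *\<^sub>R id_blinfun)" for n
  have F0: "F 0 = b *\<^sub>R id_blinfun" and FS: "F (Suc n) = \<Phi> A B (F n)" for n by (simp_all add: F_def)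
  have ge: "a *\<^sub>R id_blinfun \<sqsubseteq> F n" for n
  proof (induction n)
    case 0
    show ?case using b by (simp add: F0)
  next
    case (Suc n)
    show ?case unfolding FS using a Suc by (intro T.mean_ge_scaled_id S.mean_ge_scaled_id) auto
  qed
  have inv: "F n \<in> positive_inv_ops" for n using positive_inv_ge[OF positive_inv_scaled_id[OF a(1)] ge] .
  have dec: "F (Suc n) \<sqsubseteq> F n" for n
  proof (induction n)
    case 0
    show ?case unfolding FS F0 using A B b Ab by (intro T.mean_le_scaled_id S.mean_le_scaled_id) auto
  next
    case (Suc n)
    show ?case unfolding FS[of "Suc n"] FS[of n] using A B Suc inv[of "Suc n"] FS[of n] by (intro \<Phi>_mono) auto
  qed
  obtain X where X: "X \<in> positive_ops" "decreases_to F X"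
    using decreasing_convergent[of F] dec inv positive_inv_positive by metis
  have "a *\<^sub>R id_blinfun \<sqsubseteq> X"
    using X ge by (intro sot_limit_le[of sequentially "\<lambda>_. a *\<^sub>R id_blinfun" _ F])
      (auto simp: decreases_to_def intro: sot_tendsto_intros)
  then have Xinv: "X \<in> positive_inv_ops" using positive_inv_ge[OF positive_inv_scaled_id[OF a(1)]] by blast
  have "decreases_to (\<lambda>n. \<Phi> A B (F n)) (\<Phi> A B X)"
    using X A B inv by (intro T.mean_continuous S.mean_continuous decreases_to_const) auto
  moreover have "decreases_to (\<lambda>n. F (Suc n)) X"
    using X(2) unfolding decreases_to_def sot_tendsto_def by (auto intro: LIMSEQ_Suc)
  ultimately have "X = \<Phi> A B X" using decreases_to_unique unfolding FS by blast
  then show ?thesis using Xinv by blast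
qed

section \<open>The solution operation on invertible operators\<close>

lemma deformed_inv_eqI:
  assumes "A \<in> positive_inv_ops" "B \<in> positive_inv_ops" "X \<in> positive_inv_ops" "X = \<Phi> A B X"
  shows "deformed_inv \<tau> \<sigma> A B = X"
  unfolding deformed_inv_def
  by (rule the_equality) (use assms solution_unique[OF assms(1,2)] in auto)

lemma deformed_inv_solution:
  assumes "A \<in> positive_inv_ops" "B \<in> positive_inv_ops"
  shows "deformed_inv \<tau> \<sigma> A B \<in> positive_inv_ops"
    and "deformed_inv \<tau> \<sigma> A B = \<Phi> A B (deformed_inv \<tau> \<sigma> A B)"
  using solution_exists[OF assms] deformed_inv_eqI[OF assms] by metis+

lemma deformed_inv_positive [simp]:
  "A \<in> positive_inv_ops \<Longrightarrow> B \<in> positive_inv_ops \<Longrightarrow> deformed_inv \<tau> \<sigma> A B \<in> positive_ops"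
  using deformed_inv_solution(1) by simp

text \<open>The solution for the larger pair is a supersolution for the smaller one.\<close>

lemma deformed_inv_mono:
  assumes A: "A \<in> positive_inv_ops" and B: "B \<in> positive_inv_ops" and le: "A \<sqsubseteq> A'" "B \<sqsubseteq> B'"
  shows "deformed_inv \<tau> \<sigma> A B \<sqsubseteq> deformed_inv \<tau> \<sigma> A' B'" (is "?X \<sqsubseteq> ?Y")
proof -
  have A': "A' \<in> positive_inv_ops" and B': "B' \<in> positive_inv_ops" using A B le positive_inv_ge by blast+
  note X = deformed_inv_solution[OF A B] and Y = deformed_inv_solution[OF A' B']
  have "\<Phi> A B ?Y \<sqsubseteq> \<Phi> A' B' ?Y" using A B le Y(1) by (intro \<Phi>_mono) auto
  also have "\<dots> = ?Y" using Y(2) by simp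
  finally have "\<Phi> A B ?Y \<sqsubseteq> ?Y" .
  moreover have "?X \<sqsubseteq> \<Phi> A B ?X" using X(2) by simp
  ultimately show ?thesis using subsolution_le_supersolution[OF A B X(1) Y(1)] by blast
qed

text \<open>Both means respect congruence by \<open>C\<close>, so the conjugated solution solves the
  conjugated equation, and uniqueness identifies it.\<close>

lemma deformed_inv_congruence:
  assumes A: "A \<in> positive_inv_ops" and B: "B \<in> positive_inv_ops" and C: "C \<in> positive_inv_ops"
  shows "deformed_inv \<tau> \<sigma> (C o\<^sub>L A o\<^sub>L C) (C o\<^sub>L B o\<^sub>L C) = C o\<^sub>L deformed_inv \<tau> \<sigma> A B o\<^sub>L C"
proof (rule deformed_inv_eqI)
  note X = deformed_inv_solution[OF A B]
  have "\<Phi> (C o\<^sub>L A o\<^sub>L C) (C o\<^sub>L B o\<^sub>L C) (C o\<^sub>L deformed_inv \<tau> \<sigma> A B o\<^sub>L C)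
      = C o\<^sub>L \<Phi> A B (deformed_inv \<tau> \<sigma> A B) o\<^sub>L C"
    using A B C X(1) by (simp add: S.mean_congruence T.mean_congruence)
  then show "C o\<^sub>L deformed_inv \<tau> \<sigma> A B o\<^sub>L C
      = \<Phi> (C o\<^sub>L A o\<^sub>L C) (C o\<^sub>L B o\<^sub>L C) (C o\<^sub>L deformed_inv \<tau> \<sigma> A B o\<^sub>L C)"
    using X(2) by simp
qed (use A B C deformed_inv_solution(1) positive_inv_sandwich in auto)

text \<open>The solution for the limits lies below all the others, so the decreasing limit
  \<open>Z\<close> stays invertible. The equation passes to the limit by the continuity axiom of
  both means, and uniqueness identifies \<open>Z\<close>.\<close>

lemma deformed_inv_continuous:
  assumes F: "\<And>n. F n \<in> positive_inv_ops" "decreases_to F A" and G: "\<And>n. G n \<in> positive_inv_ops" "decreases_to G B"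
    and A: "A \<in> positive_inv_ops" and B: "B \<in> positive_inv_ops"
  shows "decreases_to (\<lambda>n. deformed_inv \<tau> \<sigma> (F n) (G n)) (deformed_inv \<tau> \<sigma> A B)"
proof -
  define X where "X n = deformed_inv \<tau> \<sigma> (F n) (G n)" for n
  have X: "X n \<in> positive_inv_ops" "X n = \<Phi> (F n) (G n) (X n)" for n
    unfolding X_def using deformed_inv_solution[OF F(1) G(1)] by auto
  have dec: "X (Suc n) \<sqsubseteq> X n" for n
    unfolding X_def using F G by (intro deformed_inv_mono) (auto simp: decreases_to_def)
  obtain Z where Z: "Z \<in> positive_ops" "decreases_to X Z"
    using decreasing_convergent[of X] dec X(1) positive_inv_positive by metis
  have low: "deformed_inv \<tau> \<sigma> A B \<sqsubseteq> X n" for n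
    unfolding X_def using F G A B decreases_to_lower[of F A n] decreases_to_lower[of G B n]
    by (intro deformed_inv_mono) auto
  have "deformed_inv \<tau> \<sigma> A B \<sqsubseteq> Z"
    using Z low A B by (intro sot_limit_le[of sequentially "\<lambda>_. deformed_inv \<tau> \<sigma> A B" _ X])
      (auto simp: decreases_to_def intro: sot_tendsto_intros)
  then have Zinv: "Z \<in> positive_inv_ops" using positive_inv_ge deformed_inv_solution(1)[OF A B] by blast
  have "decreases_to (\<lambda>n. \<Phi> (F n) (G n) (X n)) (\<Phi> A B Z)"
    using Z A B F G X(1) by (intro T.mean_continuous S.mean_continuous) auto
  moreover have "(\<lambda>n. \<Phi> (F n) (G n) (X n)) = X" by (intro ext X(2)[symmetric])
  ultimately have "Z = \<Phi> A B Z" using decreases_to_unique[OF Z(2)] by metis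
  then show ?thesis using deformed_inv_eqI[OF A B Zinv] Z(2) by (simp add: X_def[abs_def])
qed

section \<open>Extension to all positive operators\<close>

abbreviation \<rho> :: "('a \<Rightarrow>\<^sub>L 'a) \<Rightarrow> ('a \<Rightarrow>\<^sub>L 'a) \<Rightarrow> ('a \<Rightarrow>\<^sub>L 'a)" where
  "\<rho> \<equiv> deformed_mean \<tau> \<sigma>"

abbreviation \<rho>' :: "real \<Rightarrow> ('a \<Rightarrow>\<^sub>L 'a) \<Rightarrow> ('a \<Rightarrow>\<^sub>L 'a) \<Rightarrow> ('a \<Rightarrow>\<^sub>L 'a)" where
  "\<rho>' \<epsilon> A B \<equiv> deformed_inv \<tau> \<sigma> (A + \<epsilon> *\<^sub>R id_blinfun) (B + \<epsilon> *\<^sub>R id_blinfun)"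

lemma regularized_mono:
  assumes "A \<in> positive_ops" "B \<in> positive_ops" "A \<sqsubseteq> A'" "B \<sqsubseteq> B'" "0 < s" "s \<le> t"
  shows "\<rho>' s A B \<sqsubseteq> \<rho>' t A' B'"
  using assms by (intro deformed_inv_mono op_le_add op_le_scaleR_left positive_inv_add) auto

text \<open>Unifies the two branches of \<open>deformed_mean\<close>: continuity of the solution
  operation settles invertible pairs, and elsewhere monotonicity produces the limit that the
  definition describes.\<close>

lemma deformed_mean_decreases:
  assumes A: "A \<in> positive_ops" and B: "B \<in> positive_ops"
  shows "decreases_to (\<lambda>n. \<rho>' (1 / real (Suc n)) A B) (\<rho> A B)"
proof (cases "A \<in> positive_inv_ops \<and> B \<in> positive_inv_ops")
  case True
  then show ?thesis
    unfolding deformed_mean_def using A B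
    by (simp del: of_nat_Suc add: deformed_inv_continuous positive_inv_add decreases_to_add_scaled_id)
next
  case False
  have pos: "\<rho>' s A B \<in> positive_ops" if "0 < s" for s using A B that by (simp add: positive_inv_add)
  have "\<rho>' (1 / real (Suc (Suc n))) A B \<sqsubseteq> \<rho>' (1 / real (Suc n)) A B" for n
    using A B by (intro regularized_mono divide_left_mono) auto
  then obtain Z where Z: "decreases_to (\<lambda>n. \<rho>' (1 / real (Suc n)) A B) Z"
    using decreasing_convergent[of "\<lambda>n. \<rho>' (1 / real (Suc n)) A B"] pos by (metis of_nat_0_less_iff zero_less_Suc zero_less_divide_1_iff)
  have "sot_tendsto (\<lambda>\<epsilon>. \<rho>' \<epsilon> A B) Z (at_right 0)"
    using Z A B pos by (intro sot_tendsto_at_rightI regularized_mono) (auto simp: decreases_to_def)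
  then have "(THE T. sot_tendsto (\<lambda>\<epsilon>. \<rho>' \<epsilon> A B) T (at_right 0)) = Z"
    using sot_tendsto_unique[OF trivial_limit_at_right_real] by blast
  then have "\<rho> A B = Z" using False unfolding deformed_mean_def by auto
  then show ?thesis using Z by simp
qed

lemma deformed_mean_inv: "A \<in> positive_inv_ops \<Longrightarrow> B \<in> positive_inv_ops \<Longrightarrow> \<rho> A B = deformed_inv \<tau> \<sigma> A B"
  by (simp add: deformed_mean_def)

lemma deformed_mean_positive:
  assumes "A \<in> positive_ops" "B \<in> positive_ops" shows "\<rho> A B \<in> positive_ops"
proof (rule sot_limit_positive[OF trivial_limit_sequentially])
  show "sot_tendsto (\<lambda>n. \<rho>' (1 / real (Suc n)) A B) (\<rho> A B) sequentially"
    using deformed_mean_decreases[OF assms] unfolding decreases_to_def by blast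
  show "\<rho>' (1 / real (Suc n)) A B \<in> positive_ops" for n
    by (intro deformed_inv_positive positive_inv_add assms) simp_all
qed

lemma deformed_mean_le_regularized:
  assumes A: "A \<in> positive_ops" and B: "B \<in> positive_ops" and s: "0 < s"
  shows "\<rho> A B \<sqsubseteq> \<rho>' s A B"
proof -
  obtain n where n: "1 / real (Suc n) < s" using nat_approx_posE[OF s] by blast
  have "\<rho> A B \<sqsubseteq> \<rho>' (1 / real (Suc n)) A B"
    by (rule decreases_to_lower[OF deformed_mean_decreases[OF A B]]) (use A B in \<open>simp add: positive_inv_add\<close>)
  also have "\<dots> \<sqsubseteq> \<rho>' s A B" using A B n by (intro regularized_mono) auto
  finally show ?thesis .
qed

text \<open>Together with \<open>deformed_mean_le_regularized\<close> this makes
  \<open>\<rho> A B\<close> the greatest self-adjoint lower bound of the regularized solutions, the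
  form in which the axioms are verified.\<close>

lemma deformed_mean_greatest:
  assumes A: "A \<in> positive_ops" and B: "B \<in> positive_ops" and Z: "Z \<in> sa_ops"
    and le: "\<And>s. 0 < s \<Longrightarrow> Z \<sqsubseteq> \<rho>' s A B"
  shows "Z \<sqsubseteq> \<rho> A B"
proof (rule sot_limit_le[of sequentially "\<lambda>_. Z" Z])
  show "sot_tendsto (\<lambda>n. \<rho>' (1 / real (Suc n)) A B) (\<rho> A B) sequentially"
    using deformed_mean_decreases[OF A B] by (simp add: decreases_to_def)
qed (use Z le deformed_mean_positive[OF A B] in \<open>auto intro: sot_tendsto_intros\<close>)

lemma deformed_mean_mono:
  assumes "A \<in> positive_ops" "B \<in> positive_ops" "A \<sqsubseteq> A'" "B \<sqsubseteq> B'"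
  shows "\<rho> A B \<sqsubseteq> \<rho> A' B'"
proof (rule deformed_mean_greatest)
  fix s :: real assume s: "0 < s"
  have "\<rho> A B \<sqsubseteq> \<rho>' s A B" using assms s by (intro deformed_mean_le_regularized)
  also have "\<dots> \<sqsubseteq> \<rho>' s A' B'" using assms s by (intro regularized_mono) auto
  finally show "\<rho> A B \<sqsubseteq> \<rho>' s A' B'" .
qed (use assms deformed_mean_positive positive_le_imp_positive in auto)

text \<open>Two decreasing limits are exchanged through lower bounds: continuity of the regularized
  solutions for fixed \<open>s\<close> puts \<open>Z\<close> below every
  \<open>\<rho>' s A B\<close>.\<close>

lemma deformed_mean_continuous:
  assumes F: "\<And>n. F n \<in> positive_ops" "decreases_to F A" and G: "\<And>n. G n \<in> positive_ops" "decreases_to G B"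
    and A: "A \<in> positive_ops" and B: "B \<in> positive_ops"
  shows "decreases_to (\<lambda>n. \<rho> (F n) (G n)) (\<rho> A B)"
proof -
  have pos: "\<rho> (F n) (G n) \<in> positive_ops" for n using F G by (simp add: deformed_mean_positive)
  have "\<rho> (F (Suc n)) (G (Suc n)) \<sqsubseteq> \<rho> (F n) (G n)" for n
    using F G by (intro deformed_mean_mono) (auto simp: decreases_to_def)
  then obtain Z where Z: "Z \<in> positive_ops" "decreases_to (\<lambda>n. \<rho> (F n) (G n)) Z"
    using decreasing_convergent[of "\<lambda>n. \<rho> (F n) (G n)"] pos by metis
  have "Z \<sqsubseteq> \<rho> A B"
  proof (rule deformed_mean_greatest[OF A B])
    fix s :: real assume s: "0 < s"
    have lim: "decreases_to (\<lambda>n. \<rho>' s (F n) (G n)) (\<rho>' s A B)"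
      using F G A B s by (intro deformed_inv_continuous positive_inv_add decreases_to_add_const) auto
    have "\<rho> (F n) (G n) \<sqsubseteq> \<rho>' s (F n) (G n)" for n
      using F G s by (intro deformed_mean_le_regularized)
    then show "Z \<sqsubseteq> \<rho>' s A B"
      using Z lim A B s
      by (intro sot_limit_le[of sequentially "\<lambda>n. \<rho> (F n) (G n)" Z "\<lambda>n. \<rho>' s (F n) (G n)"])
        (auto simp: decreases_to_def positive_inv_add)
  qed (use Z in simp)
  moreover have "\<rho> A B \<sqsubseteq> Z"
  proof -
    have "\<rho> A B \<sqsubseteq> \<rho> (F n) (G n)" for n
      using F G A B decreases_to_lower[of F A n] decreases_to_lower[of G B n] by (intro deformed_mean_mono) auto
    then show ?thesis
      using Z deformed_mean_positive[OF A B]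
      by (intro sot_limit_le[of sequentially "\<lambda>_. \<rho> A B" _ "\<lambda>n. \<rho> (F n) (G n)"])
        (auto simp: decreases_to_def intro: sot_tendsto_intros)
  qed
  ultimately have "\<rho> A B = Z" by (intro op_le_antisym)
  then show ?thesis using Z(2) by simp
qed

text \<open>
  Regularizing \<open>C\<close> together with \<open>A\<close> and \<open>B\<close> does not give monotone approximations of \<open>C A C\<close>;
  norm convergence suffices because \<open>\<rho>'\<close> leaves room for a multiple of the identity.
\<close>

lemma deformed_mean_transformer:
  assumes A: "A \<in> positive_ops" and B: "B \<in> positive_ops" and C: "C \<in> positive_ops"
  shows "C o\<^sub>L \<rho> A B o\<^sub>L C \<sqsubseteq> \<rho> (C o\<^sub>L A o\<^sub>L C) (C o\<^sub>L B o\<^sub>L C)"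
proof (rule deformed_mean_greatest)
  fix s :: real assume s: "0 < s"
  define e where "e n = 1 / real (Suc n)" for n
  have e: "0 < e n" for n by (simp add: e_def)
  have e0: "e \<longlonglongrightarrow> 0" unfolding e_def by (rule LIMSEQ_Suc[OF lim_1_over_n])
  \<comment> \<open>\<open>D n\<close> is invertible, so the exact congruence rule for solutions
    applies to it; the inequality for a singular \<open>C\<close> is its limit.\<close>
  define D where "D n = C + e n *\<^sub>R id_blinfun" for n
  have D: "D n \<in> positive_inv_ops" for n unfolding D_def by (rule positive_inv_add[OF C e])
  have D0: "D \<longlonglongrightarrow> C + 0 *\<^sub>R id_blinfun" unfolding D_def by (intro tendsto_intros e0)
  have bound: "\<forall>\<^sub>F n in sequentially. D n o\<^sub>L (X + e n *\<^sub>R id_blinfun) o\<^sub>L D n \<sqsubseteq> (C o\<^sub>L X o\<^sub>L C) + s *\<^sub>R id_blinfun"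
    if X: "X \<in> positive_ops" for X
  proof -
    have "(\<lambda>n. D n o\<^sub>L (X + e n *\<^sub>R id_blinfun) o\<^sub>L D n)
        \<longlonglongrightarrow> ((C + 0 *\<^sub>R id_blinfun) o\<^sub>L (X + 0 *\<^sub>R id_blinfun) o\<^sub>L (C + 0 *\<^sub>R id_blinfun))"
      by (intro bounded_bilinear.tendsto[OF bounded_bilinear_blinfun_compose] tendsto_intros D0 e0)
    then have "\<forall>\<^sub>F n in sequentially. dist (D n o\<^sub>L (X + e n *\<^sub>R id_blinfun) o\<^sub>L D n) (C o\<^sub>L X o\<^sub>L C) < s"
      using tendstoD[OF _ s] by fastforce
    then show ?thesis
    proof eventually_elim
      case (elim n)
      have "(D n o\<^sub>L (X + e n *\<^sub>R id_blinfun) o\<^sub>L D n) - (C o\<^sub>L X o\<^sub>L C) \<sqsubseteq> s *\<^sub>R id_blinfun"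
        using elim X C D[of n] e[of n] less_imp_le[OF e[of n]]
        by (intro op_le_norm sa_ops_closed sa_ops_sandwich) (auto simp: dist_norm)
      then show ?case by (simp add: op_le_def algebra_simps)
    qed
  qed
  have "\<forall>\<^sub>F n in sequentially. D n o\<^sub>L \<rho> A B o\<^sub>L D n \<sqsubseteq> \<rho>' s (C o\<^sub>L A o\<^sub>L C) (C o\<^sub>L B o\<^sub>L C)"
    using bound[OF A] bound[OF B]
  proof eventually_elim
    case (elim n)
    have "D n o\<^sub>L \<rho> A B o\<^sub>L D n \<sqsubseteq> D n o\<^sub>L \<rho>' (e n) A B o\<^sub>L D n"
      using D[of n] A B e by (intro op_le_sandwich deformed_mean_le_regularized) auto
    also have "\<dots> = deformed_inv \<tau> \<sigma> (D n o\<^sub>L (A + e n *\<^sub>R id_blinfun) o\<^sub>L D n) (D n o\<^sub>L (B + e n *\<^sub>R id_blinfun) o\<^sub>L D n)"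
      using A B e D by (intro deformed_inv_congruence[symmetric] positive_inv_add)
    also have "\<dots> \<sqsubseteq> \<rho>' s (C o\<^sub>L A o\<^sub>L C) (C o\<^sub>L B o\<^sub>L C)"
      using A B e D by (intro deformed_inv_mono elim positive_inv_sandwich positive_inv_add)
    finally show ?case .
  qed
  moreover have "sot_tendsto (\<lambda>n. D n o\<^sub>L \<rho> A B o\<^sub>L D n) (C o\<^sub>L \<rho> A B o\<^sub>L C) sequentially"
  proof (rule norm_tendsto_imp_sot)
    have "(\<lambda>n. D n o\<^sub>L \<rho> A B o\<^sub>L D n) \<longlonglongrightarrow> ((C + 0 *\<^sub>R id_blinfun) o\<^sub>L \<rho> A B o\<^sub>L (C + 0 *\<^sub>R id_blinfun))"
      by (intro bounded_bilinear.tendsto[OF bounded_bilinear_blinfun_compose] tendsto_intros D0)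
    then show "(\<lambda>n. D n o\<^sub>L \<rho> A B o\<^sub>L D n) \<longlonglongrightarrow> (C o\<^sub>L \<rho> A B o\<^sub>L C)" by simp
  qed
  ultimately show "C o\<^sub>L \<rho> A B o\<^sub>L C \<sqsubseteq> \<rho>' s (C o\<^sub>L A o\<^sub>L C) (C o\<^sub>L B o\<^sub>L C)"
    using A B C s deformed_mean_positive[OF A B]
    by (intro sot_limit_le[of sequentially "\<lambda>n. D n o\<^sub>L \<rho> A B o\<^sub>L D n" _ "\<lambda>_. \<rho>' s (C o\<^sub>L A o\<^sub>L C) (C o\<^sub>L B o\<^sub>L C)"])
      (auto intro: sot_tendsto_intros sa_ops_sandwich simp: positive_inv_add)
qed (use A B C deformed_mean_positive[OF A B] in \<open>auto intro: sa_ops_sandwich\<close>)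

lemma operator_mean_deformed: "operator_mean \<rho>"
  unfolding operator_mean_def
proof (intro conjI ballI allI impI)
  fix F G :: "nat \<Rightarrow> 'a \<Rightarrow>\<^sub>L 'a" and A B
  assume "A \<in> positive_ops" "B \<in> positive_ops" "range F \<subseteq> positive_ops" "range G \<subseteq> positive_ops"
    "decreases_to F A" "decreases_to G B"
  then show "decreases_to (\<lambda>k. \<rho> (F k) (G k)) (\<rho> A B)"
    by (intro deformed_mean_continuous) auto
next
  show "\<rho> id_blinfun id_blinfun = id_blinfun"
    using deformed_inv_eqI[of id_blinfun id_blinfun id_blinfun] by (simp add: deformed_mean_inv)
qed (simp_all add: deformed_mean_positive deformed_mean_mono deformed_mean_transformer)

section \<open>The scalar equation for the representing function\<close>

sublocale D: op_mean \<rho>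
  using operator_mean_deformed T.infdim by unfold_locales

text \<open>On multiples of the identity the means act through \<open>scalar_mean\<close>, so this
  is the operator equation for scalar candidates. Its solution is scalar because
  \<open>\<rho>\<close>, being a mean, sends the pair to \<open>D.rf t\<close> times the
  identity.\<close>

lemma scalar_equation_iff:
  assumes t: "0 < t" and x: "0 < x"
  shows "scalar_mean \<tau> (scalar_mean \<sigma> x 1) (scalar_mean \<sigma> x t) = x \<longleftrightarrow> x = D.rf t"
proof -
  define a b where "a = scalar_mean \<sigma> x 1" and "b = scalar_mean \<sigma> x t"
  have a: "0 < a" "\<sigma> (x *\<^sub>R id_blinfun) id_blinfun = a *\<^sub>R id_blinfun"
    using x S.rf_pos[of "1 / x"] S.mean_scaled_ids[of x 1] by (simp_all add: a_def S.scalar_mean_eq)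
  have b: "0 < b" "\<sigma> (x *\<^sub>R id_blinfun) (t *\<^sub>R id_blinfun) = b *\<^sub>R id_blinfun"
    using x t S.rf_pos[of "t / x"] S.mean_scaled_ids[of x t] by (simp_all add: b_def S.scalar_mean_eq)
  have "\<Phi> id_blinfun (t *\<^sub>R id_blinfun) (x *\<^sub>R id_blinfun) = scalar_mean \<tau> a b *\<^sub>R id_blinfun"
    using a b T.mean_scaled_ids[of a b] by (simp add: T.scalar_mean_eq)
  then have iff: "scalar_mean \<tau> a b = x \<longleftrightarrow> x *\<^sub>R id_blinfun = \<Phi> id_blinfun (t *\<^sub>R id_blinfun) (x *\<^sub>R id_blinfun)"
    by auto
  have D: "deformed_inv \<tau> \<sigma> id_blinfun (t *\<^sub>R id_blinfun) = D.rf t *\<^sub>R id_blinfun"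
    using D.mean_scaled_id[of t] t by (simp add: deformed_mean_inv)
  have "x *\<^sub>R id_blinfun = \<Phi> id_blinfun (t *\<^sub>R id_blinfun) (x *\<^sub>R id_blinfun) \<longleftrightarrow>
      deformed_inv \<tau> \<sigma> id_blinfun (t *\<^sub>R id_blinfun) = x *\<^sub>R id_blinfun"
    using deformed_inv_eqI[of id_blinfun "t *\<^sub>R id_blinfun" "x *\<^sub>R id_blinfun"]
      deformed_inv_solution(2)[of id_blinfun "t *\<^sub>R id_blinfun"] t x by auto
  then show ?thesis using iff D by (auto simp: a_def b_def)
qed

text \<open>Homogeneity lets \<open>x\<close> factor out of both inner values; it is then
  cancelled.\<close>

lemma scalar_equation_normalized:
  assumes t: "0 < t" and x: "0 < x"
  shows "S.rf (1 / x) * T.rf (S.rf (t / x) / S.rf (1 / x)) = 1 \<longleftrightarrow>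
    scalar_mean \<tau> (scalar_mean \<sigma> x 1) (scalar_mean \<sigma> x t) = x"
  using x by (simp add: S.scalar_mean_eq T.scalar_mean_eq mult.assoc)

end

theorem theorem2p11:
  fixes \<tau> \<sigma> :: "'a::complex_hilbert binop"
  assumes "infinite_dimensional TYPE('a)" and "separable TYPE('a)"
    and "operator_mean \<tau>" and "operator_mean \<sigma>"
    and "\<not> same_mean \<sigma> left_trivial_mean"
  shows "operator_mean (deformed_mean \<tau> \<sigma>) \<and>
    represents (rep_fun (deformed_mean \<tau> \<sigma>)) (deformed_mean \<tau> \<sigma>) \<and>
    (\<forall>t>0.
      (\<forall>x. x > 0 \<and> scalar_mean \<tau> (scalar_mean \<sigma> x 1) (scalar_mean \<sigma> x t) = x \<longleftrightarrow>
           x = rep_fun (deformed_mean \<tau> \<sigma>) t) \<and>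
      (\<forall>x. x > 0 \<and>
           rep_fun \<sigma> (1 / x) * rep_fun \<tau> (rep_fun \<sigma> (t / x) / rep_fun \<sigma> (1 / x)) = 1 \<longleftrightarrow>
           x = rep_fun (deformed_mean \<tau> \<sigma>) t))"
proof -
  interpret mean_deformation \<tau> \<sigma>
    using assms by unfold_locales
  \<comment> \<open>The equivalence carries existence and uniqueness together; positivity of the
    solution comes from \<open>D.rf_pos\<close>.\<close>
  have "x > 0 \<and> scalar_mean \<tau> (scalar_mean \<sigma> x 1) (scalar_mean \<sigma> x t) = x \<longleftrightarrow> x = D.rf t"
    if "0 < t" for x t
    using scalar_equation_iff[OF that, of x] D.rf_pos[OF that] by auto
  moreover from this have "x > 0 \<and> S.rf (1 / x) * T.rf (S.rf (t / x) / S.rf (1 / x)) = 1 \<longleftrightarrow> x = D.rf t"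
    if "0 < t" for x t
    using scalar_equation_normalized[OF that, of x] that by blast
  ultimately show ?thesis
    using operator_mean_deformed D.represents_rf
    unfolding D.rep_fun_eq S.rep_fun_eq T.rep_fun_eq by simp
qed

end
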